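(* Let $\mathcal{G}=(G^0,\mathcal{G}^1,r,s)$ be an ultragraph with $G^0\neq\emptyset$ and let $K$ be a field. Then $L_K(\mathcal{G})$ is purely infinite simple if and only if the following three conditions are satisfied: (1) the only hereditary and saturated subsets of $\mathcal{G}^0$ are the trivial ones ($\emptyset$ and $\{\emptyset\}$) and $\mathcal{G}^0$; (2) every cycle in $\mathcal{G}$ has an exit; (3) every vertex connects to a cycle. Equivalently, (3) may be replaced by (3') $\mathcal{G}$ contains at least one cycle; that is, $L_K(\mathcal{G})$ is purely infinite simple if and only if (1), (2) and (3') hold.
   Context: An ultragraph $\mathcal{G}=(G^0,\mathcal{G}^1,r,s)$ consists of a countable set $G^0$ of vertices, a countable set $\mathcal{G}^1$ of edges, and functions $s:\mathcal{G}^1\to G^0$ and $r:\mathcal{G}^1\to\mathcal{P}(G^0)\setminus\{\emptyset\}$, where $\mathcal{P}(G^0)$ is the power set of $G^0$. A vertex $v$ is a sink if $s^{-1}(v)=\emptyset$, and is regular if $0<|s^{-1}(v)|<\infty$. $\mathcal{G}^0$ denotes the smallest subset of $\mathcal{P}(G^0)$ that contains $\emptyset$, $\{v\}$ for all $v\in G^0$, and $r(e)$ for all $e\in\mathcal{G}^1$, and is closed under finite unions and finite intersections. A finite path is either an element $A\in\mathcal{G}^0$ (a path of length $0$, with $s(A)=r(A)=A$), or a sequence $\alpha=\alpha_1\cdots\alpha_n$ ($n\ge1$, length $n$) of edges with $s(\alpha_{i+1})\in r(\alpha_i)$ for $1\le i\le n-1$, with $s(\alpha)=s(\alpha_1)$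 and $r(\alpha)=r(\alpha_n)$. A vertex $v$ is identified with $\{v\}$ when it is viewed as a path of length $0$. A cycle is a path $\alpha=\alpha_1\cdots\alpha_n$ of length $n\geq 1$ with $s(\alpha)\in r(\alpha)$. An exit for the cycle $\alpha$ is either an edge $e$ such that for some $1\le i\le n$ one has $s(e)\in r(\alpha_i)$ but $e\neq\alpha_{i+1}$ (where $\alpha_{n+1}:=\alpha_1$), or a sink $w$ with $w\in r(\alpha_i)$ for some $i$. A vertex $w$ connects to a cycle $\alpha=e_1\cdots e_n$ if there is a finite path $\beta$ (possibly of length $0$, i.e. $\beta=\{w\}$) with $s(\beta)=w$ and $s(e_i)\in r(\beta)$ for some $1\le i\le n$. A subset $\mathcal{H}\subseteq\mathcal{G}^0$ is hereditary if: whenever $e$ is an edge with $\{s(e)\}\in\mathcal{H}$, then $r(e)\in\mathcal{H}$; $A\cup B\in\mathcal{H}$ for all $A,B\in\mathcal{H}$; and $A\in\mathcal{H}$, $B\in\mathcal{G}^0$, $B\subseteq A$ imply $B\in\mathcal{H}$. It is saturated if for every $v\in G^0$ with $0<|s^{-1}(v)|<\infty$, $\{r(e)\mid e\in\mathcal{G}^1,\ s(e)=v\}\subseteq\mathcal{H}$ implies $\{v\}\in\mathcal{H}$. The Leavitt path algebra $L_K(\mathcal{G})$ is the (not necessarily unital) associative $K$-algebra generated by $\{s_e,s_e^*\mid e\in\mathcal{G}^1\}\cup\{p_A\mid A\in\mathcal{G}^0\}$ subject to the following relations for all $A,B\in\mathcal{G}^0$ and $e,f\in\mathcal{G}^1$: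 (i) $p_\emptyset=0$, $p_Ap_B=p_{A\cap B}$, $p_{A\cup B}=p_A+p_B-p_{A\cap B}$; (ii) $p_{s(e)}s_e=s_e=s_ep_{r(e)}$ and $p_{r(e)}s_e^*=s_e^*=s_e^*p_{s(e)}$; (iii) $s_e^*s_f=\delta_{e,f}\,p_{r(e)}$; (iv) $p_v=\sum_{s(e)=v}s_es_e^*$ for every regular vertex $v$. Here $p_v:=p_{\{v\}}$ and $\delta$ is the Kronecker delta. An idempotent $e$ in a ring $R$ is infinite if $eR$ is isomorphic as a right $R$-module to a proper direct summand of itself. $R$ is purely infinite if every nonzero right ideal of $R$ contains an infinite idempotent. $R$ is purely infinite simple if it is simple (nonzero multiplication and no two-sided ideals other than $0$ and $R$) and purely infinite. *)

theory Defs
  imports "HOL-Algebra.Module" "HOL-Algebra.QuotRing" "HOL-Library.Poly_Mapping"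
    "HOL-Library.Countable_Set"
begin

section \<open>Ultragraphs\<close>

record ('v, 'e) ugraph =
  verts :: "'v set"
  edges :: "'e set"
  src :: "'e \<Rightarrow> 'v"
  rng :: "'e \<Rightarrow> 'v set"

locale ultragraph =
  fixes G :: "('v, 'e) ugraph"
  assumes countable_verts: "countable (verts G)"
    and countable_edges: "countable (edges G)"
    and src_in_verts: "e \<in> edges G \<Longrightarrow> src G e \<in> verts G"
    and rng_subset_verts: "e \<in> edges G \<Longrightarrow> rng G e \<subseteq> verts G"
    and rng_nonempty: "e \<in> edges G \<Longrightarrow> rng G e \<noteq> {}"

definition out_edges :: "('v, 'e) ugraph \<Rightarrow> 'v \<Rightarrow> 'e set" where
  "out_edges G v = {e \<in> edges G. src G e = v}"

definition sink :: "('v, 'e) ugraph \<Rightarrow> 'v \<Rightarrow> bool" where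
  "sink G v \<longleftrightarrow> v \<in> verts G \<and> out_edges G v = {}"

definition regular_vertex :: "('v, 'e) ugraph \<Rightarrow> 'v \<Rightarrow> bool" where
  "regular_vertex G v \<longleftrightarrow> v \<in> verts G \<and> out_edges G v \<noteq> {} \<and> finite (out_edges G v)"

text \<open>The lattice written as a calligraphic G with superscript 0; only unions and intersections of
  nonempty finite families are taken, so that the set of all vertices need not be a member.\<close>

inductive_set gen_verts :: "('v, 'e) ugraph \<Rightarrow> 'v set set" for G :: "('v, 'e) ugraph" where
  empty: "{} \<in> gen_verts G"
| vertex: "v \<in> verts G \<Longrightarrow> {v} \<in> gen_verts G"
| range: "e \<in> edges G \<Longrightarrow> rng G e \<in> gen_verts G"
| union: "A \<in> gen_verts G \<Longrightarrow> B \<in> gen_verts G \<Longrightarrow> A \<union> B \<in> gen_verts G"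
| inter: "A \<in> gen_verts G \<Longrightarrow> B \<in> gen_verts G \<Longrightarrow> A \<inter> B \<in> gen_verts G"

subsection \<open>Paths and cycles\<close>

datatype ('v, 'e) path = Trivial_Path "'v set" | Edge_Path "'e list"

fun is_path :: "('v, 'e) ugraph \<Rightarrow> ('v, 'e) path \<Rightarrow> bool" where
  "is_path G (Trivial_Path A) \<longleftrightarrow> A \<in> gen_verts G"
| "is_path G (Edge_Path es) \<longleftrightarrow> es \<noteq> [] \<and> set es \<subseteq> edges G \<and>
     (\<forall>i. Suc i < length es \<longrightarrow> src G (es ! Suc i) \<in> rng G (es ! i))"

text \<open>The source of a path of positive length is a vertex, the source of a path of length 0 is a set
  of vertices; a vertex \<open>v\<close> is identified with \<open>{v}\<close>.\<close>

fun path_src :: "('v, 'e) ugraph \<Rightarrow> ('v, 'e) path \<Rightarrow> 'v set" where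
  "path_src G (Trivial_Path A) = A"
| "path_src G (Edge_Path es) = {src G (hd es)}"

fun path_rng :: "('v, 'e) ugraph \<Rightarrow> ('v, 'e) path \<Rightarrow> 'v set" where
  "path_rng G (Trivial_Path A) = A"
| "path_rng G (Edge_Path es) = rng G (last es)"

definition is_cycle :: "('v, 'e) ugraph \<Rightarrow> 'e list \<Rightarrow> bool" where
  "is_cycle G es \<longleftrightarrow> is_path G (Edge_Path es) \<and> src G (hd es) \<in> rng G (last es)"

definition edge_exit :: "('v, 'e) ugraph \<Rightarrow> 'e list \<Rightarrow> 'e \<Rightarrow> bool" where
  "edge_exit G es f \<longleftrightarrow> f \<in> edges G \<and>
     (\<exists>i < length es. src G f \<in> rng G (es ! i) \<and> f \<noteq> es ! (Suc i mod length es))"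

definition sink_exit :: "('v, 'e) ugraph \<Rightarrow> 'e list \<Rightarrow> 'v \<Rightarrow> bool" where
  "sink_exit G es w \<longleftrightarrow> sink G w \<and> (\<exists>i < length es. w \<in> rng G (es ! i))"

definition has_exit :: "('v, 'e) ugraph \<Rightarrow> 'e list \<Rightarrow> bool" where
  "has_exit G es \<longleftrightarrow> (\<exists>f. edge_exit G es f) \<or> (\<exists>w. sink_exit G es w)"

definition connects_to_cycle :: "('v, 'e) ugraph \<Rightarrow> 'v \<Rightarrow> 'e list \<Rightarrow> bool" where
  "connects_to_cycle G w es \<longleftrightarrow>
     (\<exists>\<beta>. is_path G \<beta> \<and> path_src G \<beta> = {w} \<and> (\<exists>i < length es. src G (es ! i) \<in> path_rng G \<beta>))"

subsection \<open>Hereditary and saturated sets\<close>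

definition hereditary :: "('v, 'e) ugraph \<Rightarrow> 'v set set \<Rightarrow> bool" where
  "hereditary G H \<longleftrightarrow> H \<subseteq> gen_verts G \<and>
     (\<forall>e \<in> edges G. {src G e} \<in> H \<longrightarrow> rng G e \<in> H) \<and>
     (\<forall>A \<in> H. \<forall>B \<in> H. A \<union> B \<in> H) \<and>
     (\<forall>A \<in> H. \<forall>B \<in> gen_verts G. B \<subseteq> A \<longrightarrow> B \<in> H)"

definition saturated :: "('v, 'e) ugraph \<Rightarrow> 'v set set \<Rightarrow> bool" where
  "saturated G H \<longleftrightarrow> (\<forall>v. regular_vertex G v \<longrightarrow> rng G ` out_edges G v \<subseteq> H \<longrightarrow> {v} \<in> H)"

section \<open>Not necessarily unital algebras by generators and relations\<close>

text \<open>Rings and algebras without unit are represented by the library's \<^typ>\<open>('k, 'a) module\<close>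
  records; their \<open>one\<close> component is meaningless and never used.  Scalars range over a type of
  class \<^class>\<open>field\<close>.\<close>

text \<open>A wrapper around lists carrying concatenation as addition, so that the library's convolution
  product on \<open>'g free_monoid \<Rightarrow>\<^sub>0 'k\<close> is multiplication of noncommutative polynomials.\<close>

datatype 'g free_monoid = Word (letters: "'g list")

instantiation free_monoid :: (type) monoid_add
begin

definition zero_free_monoid :: "'a free_monoid" where
  "0 = Word []"

definition plus_free_monoid :: "'a free_monoid \<Rightarrow> 'a free_monoid \<Rightarrow> 'a free_monoid" where
  "u + v = Word (letters u @ letters v)"

instance
  by intro_classes (simp_all add: zero_free_monoid_def plus_free_monoid_def)

end

definition indet :: "'g \<Rightarrow> 'g free_monoid \<Rightarrow>\<^sub>0 'k::field" where
  "indet x = Poly_Mapping.single (Word [x]) 1"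

text \<open>The free nonunital algebra on \<open>X\<close>: noncommutative polynomials in letters from \<open>X\<close> without
  constant term.\<close>

definition free_algebra ::
    "'k::field itself \<Rightarrow> 'g set \<Rightarrow> ('k, 'g free_monoid \<Rightarrow>\<^sub>0 'k) module" where
  "free_algebra K X =
     \<lparr>carrier = {p. \<forall>w \<in> Poly_Mapping.keys p. letters w \<noteq> [] \<and> set (letters w) \<subseteq> X},
      mult = (*), one = undefined, zero = 0, add = (+),
      smult = (\<lambda>c p. Poly_Mapping.single 0 c * p)\<rparr>"

definition algebra_ideal :: "('k, 'a, 'm) module_scheme \<Rightarrow> 'a set \<Rightarrow> bool" where
  "algebra_ideal A I \<longleftrightarrow> additive_subgroup I A \<and>
     (\<forall>a \<in> I. \<forall>x \<in> carrier A. x \<otimes>\<^bsub>A\<^esub> a \<in> I \<and> a \<otimes>\<^bsub>A\<^esub> x \<in> I) \<and>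
     (\<forall>a \<in> I. \<forall>c. c \<odot>\<^bsub>A\<^esub> a \<in> I)"

definition generated_ideal :: "('k, 'a, 'm) module_scheme \<Rightarrow> 'a set \<Rightarrow> 'a set" where
  "generated_ideal A S = \<Inter>{I. algebra_ideal A I \<and> S \<subseteq> I}"

definition quotient_algebra :: "('k, 'a, 'm) module_scheme \<Rightarrow> 'a set \<Rightarrow> ('k, 'a set) module" where
  "quotient_algebra A I =
     \<lparr>carrier = a_rcosets\<^bsub>A\<^esub> I, mult = rcoset_mult A I, one = undefined, zero = I, add = set_add A,
      smult = (\<lambda>c X. \<Union>x \<in> X. I +>\<^bsub>A\<^esub> (c \<odot>\<^bsub>A\<^esub> x))\<rparr>"

section \<open>Leavitt path algebras of ultragraphs\<close>

datatype ('v, 'e) lpa_gen = Proj "'v set" | Edge 'e | Ghost 'e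

definition lpa_gens :: "('v, 'e) ugraph \<Rightarrow> ('v, 'e) lpa_gen set" where
  "lpa_gens G = Proj ` gen_verts G \<union> Edge ` edges G \<union> Ghost ` edges G"

abbreviation pp :: "'v set \<Rightarrow> ('v, 'e) lpa_gen free_monoid \<Rightarrow>\<^sub>0 'k::field" where
  "pp A \<equiv> indet (Proj A)"

abbreviation ss :: "'e \<Rightarrow> ('v, 'e) lpa_gen free_monoid \<Rightarrow>\<^sub>0 'k::field" where
  "ss e \<equiv> indet (Edge e)"

abbreviation ss_star :: "'e \<Rightarrow> ('v, 'e) lpa_gen free_monoid \<Rightarrow>\<^sub>0 'k::field" where
  "ss_star e \<equiv> indet (Ghost e)"

text \<open>A relation \<open>x = y\<close> is recorded as the element \<open>x - y\<close> of the free algebra.\<close>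

inductive_set lpa_rels ::
    "'k::field itself \<Rightarrow> ('v, 'e) ugraph \<Rightarrow> (('v, 'e) lpa_gen free_monoid \<Rightarrow>\<^sub>0 'k) set"
  for K :: "'k::field itself" and G :: "('v, 'e) ugraph" where
  proj_empty: "pp {} \<in> lpa_rels K G"
| proj_mult: "A \<in> gen_verts G \<Longrightarrow> B \<in> gen_verts G \<Longrightarrow> pp A * pp B - pp (A \<inter> B) \<in> lpa_rels K G"
| proj_union: "A \<in> gen_verts G \<Longrightarrow> B \<in> gen_verts G \<Longrightarrow>
    pp (A \<union> B) - (pp A + pp B - pp (A \<inter> B)) \<in> lpa_rels K G"
| src_edge: "e \<in> edges G \<Longrightarrow> pp {src G e} * ss e - ss e \<in> lpa_rels K G"
| edge_rng: "e \<in> edges G \<Longrightarrow> ss e * pp (rng G e) - ss e \<in> lpa_rels K G"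
| rng_ghost: "e \<in> edges G \<Longrightarrow> pp (rng G e) * ss_star e - ss_star e \<in> lpa_rels K G"
| ghost_src: "e \<in> edges G \<Longrightarrow> ss_star e * pp {src G e} - ss_star e \<in> lpa_rels K G"
| ghost_edge: "e \<in> edges G \<Longrightarrow> f \<in> edges G \<Longrightarrow>
    ss_star e * ss f - (if e = f then pp (rng G e) else 0) \<in> lpa_rels K G"
| regular: "regular_vertex G v \<Longrightarrow>
    pp {v} - (\<Sum>e \<in> out_edges G v. ss e * ss_star e) \<in> lpa_rels K G"

definition leavitt_path_algebra ::
    "'k::field itself \<Rightarrow> ('v, 'e) ugraph \<Rightarrow> ('k, (('v, 'e) lpa_gen free_monoid \<Rightarrow>\<^sub>0 'k) set) module"
  where
  "leavitt_path_algebra K G =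
     (let F = free_algebra K (lpa_gens G)
      in quotient_algebra F (generated_ideal F (lpa_rels K G)))"

section \<open>Purely infinite simple rings\<close>

text \<open>The library's \<^locale>\<open>ideal\<close> presupposes a unital ring and is therefore not used.\<close>

definition right_ideal :: "('a, 'm) ring_scheme \<Rightarrow> 'a set \<Rightarrow> bool" where
  "right_ideal R I \<longleftrightarrow> additive_subgroup I R \<and> (\<forall>a \<in> I. \<forall>x \<in> carrier R. a \<otimes>\<^bsub>R\<^esub> x \<in> I)"

definition two_sided_ideal :: "('a, 'm) ring_scheme \<Rightarrow> 'a set \<Rightarrow> bool" where
  "two_sided_ideal R I \<longleftrightarrow> right_ideal R I \<and> (\<forall>a \<in> I. \<forall>x \<in> carrier R. x \<otimes>\<^bsub>R\<^esub> a \<in> I)"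

definition right_iso :: "('a, 'm) ring_scheme \<Rightarrow> 'a set \<Rightarrow> 'a set \<Rightarrow> bool" where
  "right_iso R M N \<longleftrightarrow> (\<exists>\<phi>. bij_betw \<phi> M N \<and>
     (\<forall>x \<in> M. \<forall>y \<in> M. \<phi> (x \<oplus>\<^bsub>R\<^esub> y) = \<phi> x \<oplus>\<^bsub>R\<^esub> \<phi> y) \<and>
     (\<forall>x \<in> M. \<forall>r \<in> carrier R. \<phi> (x \<otimes>\<^bsub>R\<^esub> r) = \<phi> x \<otimes>\<^bsub>R\<^esub> r))"

definition direct_summand :: "('a, 'm) ring_scheme \<Rightarrow> 'a set \<Rightarrow> 'a set \<Rightarrow> bool" where
  "direct_summand R M P \<longleftrightarrow> right_ideal R M \<and>
     (\<exists>N. right_ideal R N \<and> M <+>\<^bsub>R\<^esub> N = P \<and> M \<inter> N = {\<zero>\<^bsub>R\<^esub>})"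

definition idempotent :: "('a, 'm) ring_scheme \<Rightarrow> 'a \<Rightarrow> bool" where
  "idempotent R e \<longleftrightarrow> e \<in> carrier R \<and> e \<otimes>\<^bsub>R\<^esub> e = e"

definition infinite_idempotent :: "('a, 'm) ring_scheme \<Rightarrow> 'a \<Rightarrow> bool" where
  "infinite_idempotent R e \<longleftrightarrow> idempotent R e \<and>
     (let eR = (\<lambda>x. e \<otimes>\<^bsub>R\<^esub> x) ` carrier R
      in \<exists>M. direct_summand R M eR \<and> M \<noteq> eR \<and> right_iso R eR M)"

definition purely_infinite :: "('a, 'm) ring_scheme \<Rightarrow> bool" where
  "purely_infinite R \<longleftrightarrow>
     (\<forall>I. right_ideal R I \<longrightarrow> I \<noteq> {\<zero>\<^bsub>R\<^esub>} \<longrightarrow> (\<exists>e \<in> I. infinite_idempotent R e))"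

definition simple_ring :: "('a, 'm) ring_scheme \<Rightarrow> bool" where
  "simple_ring R \<longleftrightarrow> (\<exists>a \<in> carrier R. \<exists>b \<in> carrier R. a \<otimes>\<^bsub>R\<^esub> b \<noteq> \<zero>\<^bsub>R\<^esub>) \<and>
     (\<forall>I. two_sided_ideal R I \<longrightarrow> I = {\<zero>\<^bsub>R\<^esub>} \<or> I = carrier R)"

definition purely_infinite_simple :: "('a, 'm) ring_scheme \<Rightarrow> bool" where
  "purely_infinite_simple R \<longleftrightarrow> simple_ring R \<and> purely_infinite R"

end

theory Submission
  imports Defs "HOL-Library.Sublist" "HOL.Vector_Spaces"
begin

text \<open>
Let \<open>L\<close> be the Leavitt path algebra.

The heart of the sufficiency proof is \<open>nonzero_reducible\<close>: if every cycle has an exit, then every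
nonzero \<open>a \<in> L\<close> has a multiple \<open>x * a * y = p {v}\<close> for some vertex \<open>v\<close>.  If some product \<open>a * s e\<close> is
nonzero, it involves shorter ghost paths than \<open>a\<close>, so one may induct.  If all of them vanish, the
relations at the sources of the ghost edges turn \<open>a\<close> into an element without ghost edges.  Cutting
such an element down at a suitable vertex leaves a nonzero multiple of \<open>p {v}\<close> plus a combination of
closed paths at \<open>v\<close>, and conjugation with a path that leaves a closed path through an exit kills that
closed path without creating new ones.  A suitable vertex exists because an element whose coefficients
vanish at every vertex is zero (\<open>diag_eq_zero\<close>).

From there, a nonzero ideal contains some \<open>p {v}\<close>; the sets \<open>A\<close> with \<open>p A\<close> in the ideal form a
hereditary and saturated family, so the ideal is everything (\<open>ideal_is_all\<close>).  If moreover \<open>v\<close> connects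
to a cycle, then \<open>p {v}\<close> reduces further to \<open>p {u}\<close> with \<open>u\<close> on a cycle \<open>c\<close>, and the exit of \<open>c\<close> makes
\<open>p {u}\<close> infinite (\<open>infinite_at_cycle\<close>); being infinite is inherited by an idempotent in the right ideal
generated by the original element (\<open>nonzero_infinite\<close>).  Every vertex connects to a given
cycle because the sets that miss all vertices connecting to it form a hereditary and saturated family
(\<open>all_connect_to_cycle\<close>).

Conversely, an infinite idempotent \<open>e\<close> amounts to \<open>x, y \<in> eLe\<close> with \<open>y * x = e \<noteq> x * y\<close>.  At a cycle
without exit the corner \<open>p {v} L p {v}\<close> is commutative, so the right ideal \<open>p {v} L\<close> has no infinite
idempotent (\<open>exitless_cycle_no_infinite\<close>).  Without cycles, finitely generated subalgebras are
finite dimensional, so one-sided inverses are two-sided (\<open>acyclic_no_infinite\<close>).  Finally each hereditary and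
saturated family \<open>H\<close> is realized by an ideal that contains \<open>p A\<close> exactly for \<open>A \<in> H\<close>
(\<open>quotient_ideal_exists\<close>): it is the kernel of the representation on the boundary paths avoiding \<open>H\<close>.
This also shows \<open>p {v} \<noteq> 0\<close>, on taking \<open>H = {{}}\<close>.

The algebra is first studied inside an arbitrary unital ring type whose elements \<open>p A\<close>, \<open>s e\<close>, \<open>t e\<close>
satisfy the relations (locale \<open>leavitt_family\<close>), so that the relations can be used as equations between
elements.  A single ring type that contains the quotient algebras of all ultragraphs at once supplies such
a family, and the properties are carried over along the resulting isomorphism of rings.
\<close>

section \<open>Paths of edges\<close>

text \<open>Lists of composable edges, the empty list included.  The edges are confined to a set \<open>F\<close>
because the acyclic case works with finitely many edges at a time.\<close>

definition edge_path :: "('v, 'e) ugraph \<Rightarrow> 'e set \<Rightarrow> 'e list \<Rightarrow> bool" where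
  "edge_path G F \<alpha> \<longleftrightarrow> set \<alpha> \<subseteq> F \<and> successively (\<lambda>e f. src G f \<in> rng G e) \<alpha>"

abbreviation (in ultragraph) path :: "'e list \<Rightarrow> bool" where
  "path \<equiv> edge_path G (edges G)"

lemma edge_path_Nil [simp]: "edge_path G F []"
  by (simp add: edge_path_def)

lemma edge_path_Cons:
  "edge_path G F (e # \<alpha>) \<longleftrightarrow>
     e \<in> F \<and> edge_path G F \<alpha> \<and> (\<alpha> \<noteq> [] \<longrightarrow> src G (hd \<alpha>) \<in> rng G e)"
  by (cases \<alpha>) (auto simp: edge_path_def)

lemma edge_path_append:
  "edge_path G F (\<alpha> @ \<beta>) \<longleftrightarrow> edge_path G F \<alpha> \<and> edge_path G F \<beta> \<and>
     (\<alpha> \<noteq> [] \<longrightarrow> \<beta> \<noteq> [] \<longrightarrow> src G (hd \<beta>) \<in> rng G (last \<alpha>))"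
  by (auto simp: edge_path_def successively_append_iff)

lemma is_path_iff_edge_path:
  "is_path G (Edge_Path \<alpha>) \<longleftrightarrow> \<alpha> \<noteq> [] \<and> edge_path G (edges G) \<alpha>"
  by (auto simp: edge_path_def successively_conv_nth)

lemma is_cycle_iff_edge_path:
  "is_cycle G \<alpha> \<longleftrightarrow> \<alpha> \<noteq> [] \<and> edge_path G (edges G) \<alpha> \<and> src G (hd \<alpha>) \<in> rng G (last \<alpha>)"
  unfolding is_cycle_def is_path_iff_edge_path by simp

section \<open>Families satisfying the Leavitt relations\<close>

text \<open>Scalars enter through a ring homomorphism \<open>sc\<close> into the centre, which lets the ring operations
express everything.  The last assumption states that the relations collapse no more than they must: it says
that a hereditary and saturated family is cut out by an ideal, and is what excludes degenerate families, such
as \<open>p = s = t = 0\<close> for an ultragraph with vertices.\<close>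

locale leavitt_family = ultragraph G for G :: "('v, 'e) ugraph" +
  fixes sc :: "'k::field \<Rightarrow> 'a::ring_1"
    and p :: "'v set \<Rightarrow> 'a"
    and s t :: "'e \<Rightarrow> 'a"
  assumes sc_add: "sc (c + d) = sc c + sc d"
    and sc_mult: "sc (c * d) = sc c * sc d"
    and sc_one: "sc 1 = 1"
    and sc_central: "x * sc c = sc c * x"
    and p_empty [simp]: "p {} = 0"
    and p_mult: "A \<in> gen_verts G \<Longrightarrow> B \<in> gen_verts G \<Longrightarrow> p A * p B = p (A \<inter> B)"
    and p_union: "A \<in> gen_verts G \<Longrightarrow> B \<in> gen_verts G \<Longrightarrow> p (A \<union> B) = p A + p B - p (A \<inter> B)"
    and p_s: "e \<in> edges G \<Longrightarrow> p {src G e} * s e = s e"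
    and s_p: "e \<in> edges G \<Longrightarrow> s e * p (rng G e) = s e"
    and p_t: "e \<in> edges G \<Longrightarrow> p (rng G e) * t e = t e"
    and t_p: "e \<in> edges G \<Longrightarrow> t e * p {src G e} = t e"
    and t_s: "e \<in> edges G \<Longrightarrow> f \<in> edges G \<Longrightarrow> t e * s f = (if e = f then p (rng G e) else 0)"
    and p_regular: "regular_vertex G v \<Longrightarrow> p {v} = (\<Sum>e \<in> out_edges G v. s e * t e)"
    and quotient_ideal: "hereditary G H \<Longrightarrow> saturated G H \<Longrightarrow> {} \<in> H \<Longrightarrow>
      \<exists>J. 0 \<in> J \<and> (\<forall>x \<in> J. \<forall>y \<in> J. x + y \<in> J) \<and> (\<forall>x \<in> J. \<forall>c. sc c * x \<in> J) \<and>
        (\<forall>x \<in> J. \<forall>g \<in> p ` gen_verts G \<union> s ` edges G \<union> t ` edges G. g * x \<in> J \<and> x * g \<in> J) \<and>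
        (\<forall>A \<in> gen_verts G. p A \<in> J \<longleftrightarrow> A \<in> H)"
begin

lemma sc_zero [simp]: "sc 0 = 0"
  using sc_add[of 0 0] by simp

lemma sc_minus: "sc (- c) = - sc c"
  using sc_add[of c "- c"] by (simp add: eq_neg_iff_add_eq_0 add.commute)

lemma mult_sc: "x * (sc c * y) = sc c * (x * y)"
  by (metis mult.assoc sc_central)

sublocale vs: vector_space "\<lambda>c x. sc c * x"
  by unfold_locales (simp_all add: distrib_left distrib_right sc_add sc_mult sc_one mult.assoc)

lemma src_in [simp]: "e \<in> edges G \<Longrightarrow> {src G e} \<in> gen_verts G"
  by (simp add: gen_verts.vertex src_in_verts)

lemma rng_in [simp]: "e \<in> edges G \<Longrightarrow> rng G e \<in> gen_verts G"
  by (rule gen_verts.range)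

lemma p_idem: "A \<in> gen_verts G \<Longrightarrow> p A * p A = p A"
  by (simp add: p_mult)

lemma p_mult_left: "A \<in> gen_verts G \<Longrightarrow> B \<in> gen_verts G \<Longrightarrow> p A * (p B * x) = p (A \<inter> B) * x"
  by (simp add: p_mult flip: mult.assoc)

lemma p_mult_vertex:
  "A \<in> gen_verts G \<Longrightarrow> v \<in> verts G \<Longrightarrow> p A * p {v} = (if v \<in> A then p {v} else 0)"
  by (simp add: p_mult gen_verts.vertex)

lemma vertex_mult_p:
  "A \<in> gen_verts G \<Longrightarrow> v \<in> verts G \<Longrightarrow> p {v} * p A = (if v \<in> A then p {v} else 0)"
  by (simp add: p_mult gen_verts.vertex)

lemma p_mult_s:
  assumes "A \<in> gen_verts G" "e \<in> edges G"
  shows "p A * s e = (if src G e \<in> A then s e else 0)"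
proof -
  have "p A * s e = p A * p {src G e} * s e"
    using assms by (simp add: mult.assoc p_s)
  then show ?thesis using assms by (auto simp: p_mult p_s)
qed

lemma t_mult_p:
  assumes "A \<in> gen_verts G" "e \<in> edges G"
  shows "t e * p A = (if src G e \<in> A then t e else 0)"
proof -
  have "t e * p A = t e * (p {src G e} * p A)"
    using assms by (simp add: t_p flip: mult.assoc)
  then show ?thesis using assms by (auto simp: p_mult t_p)
qed

lemma s_mult_s:
  assumes "e \<in> edges G" "f \<in> edges G" "src G f \<notin> rng G e"
  shows "s e * s f = 0"
proof -
  have "s e * s f = s e * (p (rng G e) * s f)"
    using assms by (simp add: s_p flip: mult.assoc)
  then show ?thesis using assms by (simp add: p_mult_s)
qed

lemma t_mult_t:
  assumes "e \<in> edges G" "f \<in> edges G" "src G e \<notin> rng G f"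
  shows "t e * t f = 0"
proof -
  have "t e * t f = t e * p (rng G f) * t f"
    using assms by (simp add: mult.assoc p_t)
  then show ?thesis using assms by (simp add: t_mult_p)
qed

text \<open>The path \<open>\<alpha>\<close> as an element, and the ghost path of \<open>\<beta>\<close>, which runs backwards.\<close>

definition sw :: "'e list \<Rightarrow> 'a" where "sw \<alpha> = prod_list (map s \<alpha>)"

definition tw :: "'e list \<Rightarrow> 'a" where "tw \<beta> = prod_list (map t (rev \<beta>))"

lemma sw_simps [simp]: "sw [] = 1" "sw (e # \<alpha>) = s e * sw \<alpha>" "sw (\<alpha> @ \<beta>) = sw \<alpha> * sw \<beta>"
  by (simp_all add: sw_def)

lemma tw_simps [simp]: "tw [] = 1" "tw (e # \<alpha>) = tw \<alpha> * t e" "tw (\<alpha> @ \<beta>) = tw \<beta> * tw \<alpha>"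
  by (simp_all add: tw_def)

lemma p_mult_sw:
  assumes "A \<in> gen_verts G" "\<alpha> \<noteq> []" "set \<alpha> \<subseteq> edges G"
  shows "p A * sw \<alpha> = (if src G (hd \<alpha>) \<in> A then sw \<alpha> else 0)"
  using assms by (cases \<alpha>) (auto simp: p_mult_s simp flip: mult.assoc)

lemma tw_mult_p:
  assumes "A \<in> gen_verts G" "\<alpha> \<noteq> []" "set \<alpha> \<subseteq> edges G"
  shows "tw \<alpha> * p A = (if src G (hd \<alpha>) \<in> A then tw \<alpha> else 0)"
  using assms by (cases \<alpha>) (auto simp: t_mult_p mult.assoc)

lemma sw_mult_p:
  assumes "\<alpha> \<noteq> []" "set \<alpha> \<subseteq> edges G"
  shows "sw \<alpha> * p (rng G (last \<alpha>)) = sw \<alpha>"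
  using assms by (cases \<alpha> rule: rev_cases) (auto simp: s_p mult.assoc)

lemma sw_mult_vertex:
  assumes "\<alpha> \<noteq> []" "set \<alpha> \<subseteq> edges G" "v \<in> verts G" "v \<notin> rng G (last \<alpha>)"
  shows "sw \<alpha> * p {v} = 0"
proof -
  have "last \<alpha> \<in> edges G" using assms by auto
  have "sw \<alpha> * p {v} = sw \<alpha> * (p (rng G (last \<alpha>)) * p {v})"
    using assms by (simp add: sw_mult_p flip: mult.assoc)
  also have "\<dots> = 0" using assms \<open>last \<alpha> \<in> edges G\<close> by (simp add: p_mult_vertex)
  finally show ?thesis .
qed

text \<open>A product of edges that does not compose vanishes, because \<open>s e * s f = s e * p (rng G e) * s f\<close>
and \<open>p (rng G e)\<close> annihilates \<open>s f\<close> when \<open>src G f \<notin> rng G e\<close>.\<close>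

lemma sw_not_path: "set \<alpha> \<subseteq> edges G \<Longrightarrow> \<not> path \<alpha> \<Longrightarrow> sw \<alpha> = 0"
proof (induction \<alpha>)
  case (Cons e \<alpha>)
  show ?case
  proof (cases "path \<alpha>")
    case True
    then obtain f \<beta> where "\<alpha> = f # \<beta>" "src G f \<notin> rng G e"
      using Cons.prems by (cases \<alpha>) (auto simp: edge_path_Cons)
    then show ?thesis using Cons.prems s_mult_s[of e f] by (simp flip: mult.assoc)
  qed (use Cons in auto)
qed simp

lemma tw_sw_same:
  assumes "path \<alpha>" "\<alpha> \<noteq> []"
  shows "tw \<alpha> * sw \<alpha> = p (rng G (last \<alpha>))"
  using assms
proof (induction \<alpha>)
  case (Cons e \<alpha>)
  have "tw (e # \<alpha>) * sw (e # \<alpha>) = tw \<alpha> * (t e * s e) * sw \<alpha>"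
    by (simp add: mult.assoc)
  also have "\<dots> = tw \<alpha> * p (rng G e) * sw \<alpha>"
    using Cons.prems by (simp add: t_s edge_path_Cons)
  also have "\<dots> = p (rng G (last (e # \<alpha>)))"
  proof (cases "\<alpha> = []")
    case False
    with Cons.prems have "set \<alpha> \<subseteq> edges G" "e \<in> edges G" "src G (hd \<alpha>) \<in> rng G e"
      by (simp_all add: edge_path_Cons) (simp add: edge_path_def)
    with False have "tw \<alpha> * p (rng G e) = tw \<alpha>" by (simp add: tw_mult_p)
    then show ?thesis using False Cons by (simp add: edge_path_Cons)
  qed simp
  finally show ?case .
qed simp

text \<open>Two paths neither of which extends the other cancel at the first edge where they differ.\<close>

lemma tw_sw_zero:
  assumes "set \<alpha> \<subseteq> edges G" "set \<beta> \<subseteq> edges G" "\<not> prefix \<alpha> \<beta>" "\<not> prefix \<beta> \<alpha>"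
  shows "tw \<alpha> * sw \<beta> = 0"
  using assms
proof (induction \<alpha> arbitrary: \<beta>)
  case (Cons e \<alpha>)
  then obtain f \<gamma> where \<beta>: "\<beta> = f # \<gamma>" by (cases \<beta>) auto
  have *: "tw (e # \<alpha>) * sw \<beta> = tw \<alpha> * (t e * s f) * sw \<gamma>"
    by (simp add: mult.assoc \<beta>)
  show ?case
  proof (cases "e = f")
    case True
    then have "\<alpha> \<noteq> []" "\<not> prefix \<alpha> \<gamma>" "\<not> prefix \<gamma> \<alpha>" using Cons.prems \<beta> by auto
    moreover have "tw (e # \<alpha>) * sw \<beta> = tw \<alpha> * p (rng G e) * sw \<gamma>"
      using * True Cons.prems \<beta> by (simp add: t_s)
    ultimately show ?thesis using Cons \<beta> by (auto simp: tw_mult_p)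
  next
    case False
    then show ?thesis using * Cons.prems \<beta> by (simp add: t_s)
  qed
qed simp

definition mon :: "'e list \<Rightarrow> 'v set \<Rightarrow> 'e list \<Rightarrow> 'a" where
  "mon \<alpha> A \<beta> = sw \<alpha> * p A * tw \<beta>"

definition mons :: "'e set \<Rightarrow> 'v set set \<Rightarrow> 'a set" where
  "mons F \<A> = {mon \<alpha> A \<beta> | \<alpha> A \<beta>. edge_path G F \<alpha> \<and> edge_path G F \<beta> \<and> A \<in> \<A>}"

lemma monsI: "edge_path G F \<alpha> \<Longrightarrow> edge_path G F \<beta> \<Longrightarrow> A \<in> \<A> \<Longrightarrow> mon \<alpha> A \<beta> \<in> mons F \<A>"
  by (auto simp: mons_def)

text \<open>Left multiplication by a generator sends a monomial to a monomial or to zero, hence so does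
multiplication by a monomial.  With all edges and all sets this provides a linear spanning set of the algebra; with
finitely many edges and a finite family \<open>\<A>\<close> it provides finite-dimensional subalgebras.\<close>

context
  fixes F :: "'e set" and \<A> :: "'v set set"
  assumes F: "F \<subseteq> edges G" and \<A>: "\<A> \<subseteq> gen_verts G"
    and inter: "\<And>A B. A \<in> \<A> \<Longrightarrow> B \<in> \<A> \<Longrightarrow> A \<inter> B \<in> \<A>"
    and rng: "\<And>e. e \<in> F \<Longrightarrow> rng G e \<in> \<A>"
begin

lemma p_mult_mons:
  assumes "A \<in> \<A>" "m \<in> mons F \<A>" shows "p A * m \<in> insert 0 (mons F \<A>)"
proof -
  from assms obtain \<alpha> B \<beta> where m: "m = mon \<alpha> B \<beta>" "edge_path G F \<alpha>" "edge_path G F \<beta>" "B \<in> \<A>"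
    by (auto simp: mons_def)
  show ?thesis
  proof (cases "\<alpha> = []")
    case True
    then have "p A * m = mon [] (A \<inter> B) \<beta>"
      using m subsetD[OF \<A> assms(1)] subsetD[OF \<A> \<open>B \<in> \<A>\<close>] by (simp add: mon_def p_mult_left)
    then show ?thesis using m assms inter by (auto intro!: monsI)
  next
    case False
    have "set \<alpha> \<subseteq> edges G" using m F by (auto simp: edge_path_def)
    then have "p A * m \<in> {0, m}"
      using False m subsetD[OF \<A> assms(1)] p_mult_sw[of A \<alpha>]
      by (cases "src G (hd \<alpha>) \<in> A") (simp_all add: mon_def flip: mult.assoc)
    then show ?thesis using assms by auto
  qed
qed

lemma s_mult_mons:
  assumes "e \<in> F" "m \<in> mons F \<A>" shows "s e * m \<in> insert 0 (mons F \<A>)"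
proof -
  from assms obtain \<alpha> B \<beta> where m: "m = mon \<alpha> B \<beta>" "edge_path G F \<alpha>" "edge_path G F \<beta>" "B \<in> \<A>"
    by (auto simp: mons_def)
  have eq: "s e * m = mon (e # \<alpha>) B \<beta>" by (simp add: m mon_def mult.assoc)
  show ?thesis
  proof (cases "edge_path G F (e # \<alpha>)")
    case True
    then show ?thesis unfolding eq using m by (auto intro: monsI)
  next
    case False
    then have "\<not> path (e # \<alpha>)" "set (e # \<alpha>) \<subseteq> edges G"
      using m assms F by (auto simp: edge_path_def)
    then have "sw (e # \<alpha>) = 0" by (rule sw_not_path[rotated])
    then show ?thesis unfolding eq mon_def by simp
  qed
qed

lemma t_mult_mons:
  assumes "e \<in> F" "m \<in> mons F \<A>" shows "t e * m \<in> insert 0 (mons F \<A>)"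
proof -
  from assms obtain \<alpha> B \<beta> where m: "m = mon \<alpha> B \<beta>" "edge_path G F \<alpha>" "edge_path G F \<beta>" "B \<in> \<A>"
    by (auto simp: mons_def)
  have e: "e \<in> edges G" and B: "B \<in> gen_verts G" using assms m F \<A> by auto
  show ?thesis
  proof (cases \<alpha>)
    case Nil
    then have eq: "t e * m = (if src G e \<in> B then t e * tw \<beta> else 0)"
      using e B by (simp add: m mon_def t_mult_p flip: mult.assoc)
    have path: "t e * tw \<beta> = mon [] (rng G e) (\<beta> @ [e])"
      using e by (simp add: mon_def p_t flip: mult.assoc)
    show ?thesis
    proof (cases "edge_path G F (\<beta> @ [e])")
      case True
      then show ?thesis unfolding eq path using assms rng by (auto intro: monsI)
    next
      case False
      then obtain \<gamma> f where \<beta>: "\<beta> = \<gamma> @ [f]" "src G e \<notin> rng G f" "f \<in> F"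
        using m assms by (cases \<beta> rule: rev_cases) (auto simp: edge_path_append edge_path_Cons)
      have "t e * tw \<beta> = 0"
        using \<beta> e F t_mult_t[of e f] by (auto simp flip: mult.assoc)
      then show ?thesis unfolding eq by simp
    qed
  next
    case (Cons f \<alpha>')
    then have f: "f \<in> F" "f \<in> edges G" and \<alpha>': "edge_path G F \<alpha>'"
      using m F by (auto simp: edge_path_Cons)
    have "t e * m = t e * s f * mon \<alpha>' B \<beta>" by (simp add: m mon_def Cons mult.assoc)
    moreover have "mon \<alpha>' B \<beta> \<in> mons F \<A>" using \<alpha>' m by (auto intro: monsI)
    ultimately show ?thesis
      using p_mult_mons[of "rng G e" "mon \<alpha>' B \<beta>"] rng assms by (auto simp: t_s e f)
  qed
qed

lemma mons_mult:
  assumes "m \<in> mons F \<A>" "m' \<in> mons F \<A>" shows "m * m' \<in> insert 0 (mons F \<A>)"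
proof -
  from assms obtain \<alpha> B \<beta> where m: "m = mon \<alpha> B \<beta>" "edge_path G F \<alpha>" "edge_path G F \<beta>" "B \<in> \<A>"
    by (auto simp: mons_def)
  have tw: "tw \<gamma> * x \<in> insert 0 (mons F \<A>)"
    if "set \<gamma> \<subseteq> F" "x \<in> insert 0 (mons F \<A>)" for \<gamma> x
    using that
  proof (induction \<gamma> arbitrary: x)
    case (Cons e \<gamma>)
    then have "t e * x \<in> insert 0 (mons F \<A>)" using t_mult_mons[of e x] by auto
    with Cons show ?case by (simp add: mult.assoc)
  qed simp
  have sw: "sw \<gamma> * x \<in> insert 0 (mons F \<A>)"
    if "set \<gamma> \<subseteq> F" "x \<in> insert 0 (mons F \<A>)" for \<gamma> x
    using that
  proof (induction \<gamma>)
    case (Cons e \<gamma>)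
    then have "s e * (sw \<gamma> * x) \<in> insert 0 (mons F \<A>)" using s_mult_mons[of e "sw \<gamma> * x"] by auto
    then show ?case by (simp add: mult.assoc)
  qed simp
  have "tw \<beta> * m' \<in> insert 0 (mons F \<A>)"
    using m assms tw by (auto simp: edge_path_def)
  then have "p B * (tw \<beta> * m') \<in> insert 0 (mons F \<A>)"
    using p_mult_mons[of B "tw \<beta> * m'"] m by auto
  then show ?thesis
    using sw[of \<alpha>] m by (auto simp: edge_path_def mon_def mult.assoc)
qed

end

lemma span_mult:
  assumes "\<And>m m'. m \<in> M \<Longrightarrow> m' \<in> M' \<Longrightarrow> m * m' \<in> vs.span N"
    and "x \<in> vs.span M" "y \<in> vs.span M'"
  shows "x * y \<in> vs.span N"
proof -
  have *: "m * y \<in> vs.span N" if "m \<in> M" for m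
    using assms(3)
  proof (induction rule: vs.span_induct_alt)
    case (step c m' y)
    then show ?case using assms(1)[OF that, of m']
      by (simp add: distrib_left mult_sc vs.span_add vs.span_scale)
  qed (simp add: vs.span_zero)
  show ?thesis using assms(2)
  proof (induction rule: vs.span_induct_alt)
    case (step c m x)
    then show ?case using *[of m]
      by (simp add: distrib_right mult.assoc vs.span_add vs.span_scale)
  qed (simp add: vs.span_zero)
qed

text \<open>The algebra generated by the family, which in general lacks the unit of the ambient ring.\<close>

definition lpa :: "'a set" where
  "lpa = vs.span (mons (edges G) (gen_verts G))"

lemma lpa_mult:
  assumes "x \<in> lpa" "y \<in> lpa" shows "x * y \<in> lpa"
proof -
  let ?M = "mons (edges G) (gen_verts G)"
  have "m * m' \<in> vs.span ?M" if "m \<in> ?M" "m' \<in> ?M" for m m'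
    using mons_mult[of "edges G" "gen_verts G" m m', OF _ _ gen_verts.inter rng_in] that
    by (auto intro: vs.span_base vs.span_zero)
  then show ?thesis using assms unfolding lpa_def by (rule span_mult)
qed

lemma mon_in_lpa: "path \<alpha> \<Longrightarrow> path \<beta> \<Longrightarrow> A \<in> gen_verts G
    \<Longrightarrow> mon \<alpha> A \<beta> \<in> lpa"
  unfolding lpa_def by (intro vs.span_base monsI)

lemma p_in_lpa: "A \<in> gen_verts G \<Longrightarrow> p A \<in> lpa"
  using mon_in_lpa[of "[]" "[]" A] by (simp add: mon_def)

lemma s_in_lpa: "e \<in> edges G \<Longrightarrow> s e \<in> lpa"
  using mon_in_lpa[of "[e]" "[]" "rng G e"] by (simp add: mon_def s_p edge_path_def)

lemma t_in_lpa: "e \<in> edges G \<Longrightarrow> t e \<in> lpa"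
  using mon_in_lpa[of "[]" "[e]" "rng G e"] by (simp add: mon_def p_t edge_path_def)

lemma sw_mult_in_lpa: "set \<alpha> \<subseteq> edges G \<Longrightarrow> x \<in> lpa \<Longrightarrow> sw \<alpha> * x \<in> lpa"
  by (induction \<alpha>) (auto simp: mult.assoc s_in_lpa lpa_mult)

lemma mult_tw_in_lpa: "set \<alpha> \<subseteq> edges G \<Longrightarrow> x \<in> lpa \<Longrightarrow> x * tw \<alpha> \<in> lpa"
  by (induction \<alpha>) (auto simp: t_in_lpa lpa_mult simp flip: mult.assoc)

lemmas lpa_closed = vs.span_zero[of "mons (edges G) (gen_verts G)", folded lpa_def]
  vs.span_add[of _ "mons (edges G) (gen_verts G)", folded lpa_def]
  vs.span_diff[of _ "mons (edges G) (gen_verts G)", folded lpa_def]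
  vs.span_neg[of _ "mons (edges G) (gen_verts G)", folded lpa_def]
  vs.span_scale[of _ "mons (edges G) (gen_verts G)", folded lpa_def]
  vs.span_sum[of _ _ "mons (edges G) (gen_verts G)", folded lpa_def]

text \<open>The smallest hereditary and saturated family \<open>{{}}\<close> contains no vertex, so the ideal attached to it
contains \<open>0\<close> but no \<open>p {v}\<close>.\<close>

lemma p_vertex_nonzero:
  assumes "v \<in> verts G" shows "p {v} \<noteq> 0"
proof -
  have "hereditary G {{}}" using rng_nonempty by (auto simp: hereditary_def gen_verts.empty)
  moreover have "saturated G {{}}"
    using rng_nonempty by (fastforce simp: saturated_def regular_vertex_def out_edges_def)
  ultimately obtain J where "(0::'a) \<in> J" "\<forall>A \<in> gen_verts G. p A \<in> J \<longleftrightarrow> A \<in> {{}}"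
    using quotient_ideal[of "{{}}"] by auto
  then show ?thesis using assms gen_verts.vertex[of v G] by force
qed

lemma p_nonzero:
  assumes "A \<in> gen_verts G" "v \<in> A" "v \<in> verts G" shows "p A \<noteq> 0"
  using p_vertex_nonzero[OF assms(3)] p_mult_vertex[OF assms(1,3)] assms(2) by auto

end

section \<open>Leaving a cycle through an exit\<close>

lemma (in ultragraph) gen_verts_subset: "A \<in> gen_verts G \<Longrightarrow> A \<subseteq> verts G"
  by (induction rule: gen_verts.induct) (use rng_subset_verts in auto)

text \<open>The path \<open>\<delta>\<close> follows the closed path \<open>\<gamma>\<close> up to the exit; then it either ends in a sink or takes the
exit edge.  In the second case it is not an initial segment of any continuation of \<open>\<gamma>\<close> that starts a second
turn, which is why only the first edge of \<open>\<zeta>\<close> matters.\<close>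

lemma (in ultragraph) exit_path:
  assumes "is_cycle G \<gamma>" "has_exit G \<gamma>"
  obtains \<delta> w where "path \<delta>" "\<delta> \<noteq> []" "src G (hd \<delta>) = src G (hd \<gamma>)"
    "w \<in> rng G (last \<delta>)" "w \<in> verts G" "length \<delta> \<le> Suc (length \<gamma>)"
    "sink G w \<and> length \<delta> \<le> length \<gamma> \<or> (\<forall>\<zeta>. \<zeta> \<noteq> [] \<longrightarrow> hd \<zeta> = hd \<gamma> \<longrightarrow> \<not> prefix \<delta> (\<gamma> @ \<zeta>))"
proof -
  from assms have \<gamma>: "\<gamma> \<noteq> []" "path \<gamma>" by (auto simp: is_cycle_iff_edge_path)
  have take_path: "path (take j \<gamma>)" for j
    using \<gamma>(2) edge_path_append[of G _ "take j \<gamma>" "drop j \<gamma>"] by simp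
  have last_take: "last (take (Suc i) \<gamma>) = \<gamma> ! i" if "i < length \<gamma>" for i
    using that by (simp add: take_Suc_conv_app_nth)
  from assms(2) consider f i where "f \<in> edges G" "i < length \<gamma>" "src G f \<in> rng G (\<gamma> ! i)"
      "f \<noteq> \<gamma> ! (Suc i mod length \<gamma>)"
    | w i where "sink G w" "i < length \<gamma>" "w \<in> rng G (\<gamma> ! i)"
    unfolding has_exit_def edge_exit_def sink_exit_def by blast
  then show thesis
  proof cases
    case 1
    obtain w where w: "w \<in> rng G f" using rng_nonempty[OF 1(1)] by blast
    have "\<not> prefix (take (Suc i) \<gamma> @ [f]) (\<gamma> @ \<zeta>)" if "\<zeta> \<noteq> []" "hd \<zeta> = hd \<gamma>" for \<zeta>
    proof
      assume "prefix (take (Suc i) \<gamma> @ [f]) (\<gamma> @ \<zeta>)"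
      then obtain \<eta> where "\<gamma> @ \<zeta> = take (Suc i) \<gamma> @ f # \<eta>" by (auto elim: prefixE)
      then have "(\<gamma> @ \<zeta>) ! Suc i = f" using 1(2) by (simp add: nth_append)
      moreover have "(\<gamma> @ \<zeta>) ! Suc i = \<gamma> ! (Suc i mod length \<gamma>)"
      proof (cases "Suc i < length \<gamma>")
        case False
        then have "Suc i = length \<gamma>" using 1(2) by simp
        then show ?thesis using that \<gamma>(1) by (simp add: nth_append hd_conv_nth)
      qed (simp add: nth_append)
      ultimately show False using 1(4) by simp
    qed
    then show thesis using 1 \<gamma> w take_path[of "Suc i"] rng_subset_verts[OF 1(1)]
      by (intro that[of "take (Suc i) \<gamma> @ [f]" w])
        (auto simp: edge_path_append edge_path_Cons last_take)
  next
    case 2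
    then show thesis using \<gamma> take_path[of "Suc i"]
      by (intro that[of "take (Suc i) \<gamma>" w]) (auto simp: last_take sink_def)
  qed
qed

section \<open>Reduction of nonzero elements to vertices\<close>

context leavitt_family
begin

definition reducible :: "'a \<Rightarrow> bool" where
  "reducible a \<longleftrightarrow> (\<exists>x \<in> lpa. \<exists>y \<in> lpa. \<exists>v \<in> verts G. x * a * y = p {v})"

lemma p_vertex_in_lpa: "v \<in> verts G \<Longrightarrow> p {v} \<in> lpa"
  by (simp add: p_in_lpa gen_verts.vertex)

lemma reducible_mult: "reducible (x * a * y) \<Longrightarrow> x \<in> lpa \<Longrightarrow> y \<in> lpa \<Longrightarrow> reducible a"
  unfolding reducible_def
  by (metis (no_types, opaque_lifting) lpa_mult mult.assoc)

lemma reducible_mult_right: "reducible (a * y) \<Longrightarrow> y \<in> lpa \<Longrightarrow> reducible a"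
  unfolding reducible_def
  by (metis (no_types, opaque_lifting) lpa_mult mult.assoc)

lemma not_reducible_zero: "\<not> reducible 0"
  using p_vertex_nonzero by (auto simp: reducible_def)

lemma vertex_mult_sw:
  assumes "v \<in> verts G" "\<alpha> \<noteq> []" "set \<alpha> \<subseteq> edges G"
  shows "p {v} * sw \<alpha> = (if src G (hd \<alpha>) = v then sw \<alpha> else 0)"
  using p_mult_sw[OF gen_verts.vertex[OF assms(1)] assms(2,3)] by auto

lemma tw_sw_p:
  assumes "path \<alpha>" "\<alpha> \<noteq> []" "v \<in> rng G (last \<alpha>)" "v \<in> verts G"
  shows "p {v} * tw \<alpha> * sw \<alpha> = p {v}"
proof -
  have "last \<alpha> \<in> edges G" using assms(1,2) by (auto simp: edge_path_def)
  then show ?thesis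
    using tw_sw_same[OF assms(1,2)] assms(3,4) by (simp add: mult.assoc vertex_mult_p)
qed

text \<open>Compressing a longer path \<open>\<beta>\<close> by \<open>\<delta>\<close> strips \<open>\<delta>\<close> from the front of \<open>\<beta>\<close>, or gives zero.\<close>

lemma compress_path:
  assumes "path \<delta>" "\<delta> \<noteq> []" "w \<in> rng G (last \<delta>)" "w \<in> verts G"
    and "set \<beta> \<subseteq> edges G" "length \<delta> < length \<beta>"
  shows "p {w} * tw \<delta> * sw \<beta> =
    (if prefix \<delta> \<beta> \<and> src G (hd (drop (length \<delta>) \<beta>)) = w then sw (drop (length \<delta>) \<beta>) else 0)"
proof (cases "prefix \<delta> \<beta>")
  case True
  then obtain \<eta> where \<eta>: "\<beta> = \<delta> @ \<eta>" by (auto elim: prefixE)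
  have "p {w} * tw \<delta> * sw \<beta> = (p {w} * tw \<delta> * sw \<delta>) * sw \<eta>"
    by (simp add: \<eta> mult.assoc)
  also have "\<dots> = p {w} * sw \<eta>" using assms by (simp add: tw_sw_p)
  finally show ?thesis using assms \<eta> by (auto simp: vertex_mult_sw)
next
  case False
  moreover have "\<not> prefix \<beta> \<delta>" using assms(6) by (auto dest: prefix_length_le)
  ultimately have "tw \<delta> * sw \<beta> = 0" using assms by (intro tw_sw_zero) (auto simp: edge_path_def)
  then show ?thesis using False by (simp add: mult.assoc)
qed

text \<open>Conjugating with an exit path \<open>\<delta>\<close> of one of the closed paths keeps the scalar term, kills that
closed path, and turns every other closed path \<open>\<gamma> i\<close> into zero or into the closed path \<open>\<eta>\<close> given by
\<open>\<gamma> i @ \<delta> = \<delta> @ \<eta>\<close>.  So the number of closed paths drops while the base vertex moves to the end of \<open>\<delta>\<close>.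
Indexing by \<open>I\<close> instead of summing over a set of paths makes it irrelevant whether the new paths are
distinct.\<close>

lemma reducible_closed_paths:
  assumes exits: "\<And>\<alpha>. is_cycle G \<alpha> \<Longrightarrow> has_exit G \<alpha>"
    and "finite I" "v \<in> verts G" "c \<noteq> 0"
    and "\<And>i. i \<in> I \<Longrightarrow> is_cycle G (\<gamma> i) \<and> src G (hd (\<gamma> i)) = v"
  shows "reducible (sc c * p {v} + (\<Sum>i \<in> I. sc (k i) * (sw (\<gamma> i) * p {v})))"
  using assms(2-)
proof (induction I arbitrary: v \<gamma> rule: finite_psubset_induct)
  case (psubset I)
  note v = \<open>v \<in> verts G\<close>
  show ?case
  proof (cases "I = {}")
    case True
    have pp: "p {v} * p {v} = p {v}" using v by (simp add: p_idem gen_verts.vertex)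
    have "p {v} * (sc c * p {v}) * (sc (1 / c) * p {v}) = sc c * (sc (1 / c) * (p {v} * p {v}))"
      by (simp only: mult_sc[of "p {v}"] pp mult.assoc)
    also have "\<dots> = sc (c * (1 / c)) * p {v}" by (simp only: pp sc_mult mult.assoc)
    finally have "p {v} * (sc c * p {v}) * (sc (1 / c) * p {v}) = p {v}"
      using \<open>c \<noteq> 0\<close> by (simp add: sc_one)
    moreover have "p {v} \<in> lpa" "sc (1 / c) * p {v} \<in> lpa" using v by (simp_all add: p_vertex_in_lpa lpa_closed)
    ultimately show ?thesis using True v unfolding reducible_def by fastforce
  next
    case False
    then obtain i0 where i0: "i0 \<in> I" by blast
    have cyc: "is_cycle G (\<gamma> i)" "src G (hd (\<gamma> i)) = v" if "i \<in> I" for i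
      using psubset.prems(3) that by auto
    obtain \<delta> w where \<delta>: "path \<delta>" "\<delta> \<noteq> []" "src G (hd \<delta>) = v"
        "w \<in> rng G (last \<delta>)" "w \<in> verts G"
        "sink G w \<or> (\<forall>\<zeta>. \<zeta> \<noteq> [] \<longrightarrow> hd \<zeta> = hd (\<gamma> i0) \<longrightarrow> \<not> prefix \<delta> (\<gamma> i0 @ \<zeta>))"
      using exit_path[OF cyc(1)[OF i0] exits[OF cyc(1)[OF i0]]] cyc(2)[OF i0] by metis
    define \<eta> where "\<eta> i = drop (length \<delta>) (\<gamma> i @ \<delta>)" for i
    define I' where "I' = {i \<in> I. prefix \<delta> (\<gamma> i @ \<delta>) \<and> src G (hd (\<eta> i)) = w \<and> path (\<eta> i)}"
    have \<gamma>: "\<gamma> i \<noteq> []" "set (\<gamma> i) \<subseteq> edges G" if "i \<in> I" for i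
      using cyc[OF that] by (auto simp: is_cycle_iff_edge_path edge_path_def)
    have set\<delta>: "set \<delta> \<subseteq> edges G" using \<delta>(1) by (simp add: edge_path_def)
    have \<eta>_split: "\<gamma> i @ \<delta> = \<delta> @ \<eta> i" if "prefix \<delta> (\<gamma> i @ \<delta>)" for i
      using that unfolding \<eta>_def by (metis append_eq_conv_conj prefix_def)
    have \<eta>_set: "\<eta> i \<noteq> []" "set (\<eta> i) \<subseteq> edges G" if "i \<in> I" for i
    proof -
      show "\<eta> i \<noteq> []" using \<gamma>[OF that] by (simp add: \<eta>_def del: drop_append)
      show "set (\<eta> i) \<subseteq> edges G"
        using set_drop_subset[of "length \<delta>" "\<gamma> i @ \<delta>"] \<gamma>(2)[OF that] set\<delta> by (auto simp: \<eta>_def)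
    qed
    have "i0 \<notin> I'"
    proof
      assume "i0 \<in> I'"
      then have pre: "prefix \<delta> (\<gamma> i0 @ \<delta>)" and path: "path (\<eta> i0)"
        and src: "src G (hd (\<eta> i0)) = w" by (auto simp: I'_def)
      show False using \<delta>(6)
      proof
        assume "sink G w"
        moreover have "hd (\<eta> i0) \<in> edges G" using \<eta>_set[OF i0] by auto
        ultimately show False using src by (auto simp: sink_def out_edges_def)
      next
        assume *: "\<forall>\<zeta>. \<zeta> \<noteq> [] \<longrightarrow> hd \<zeta> = hd (\<gamma> i0) \<longrightarrow> \<not> prefix \<delta> (\<gamma> i0 @ \<zeta>)"
        have "hd \<delta> = hd (\<gamma> i0)"
          using \<eta>_split[OF pre] \<gamma>(1)[OF i0] \<delta>(2) by (metis hd_append2)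
        then show False using * \<delta>(2) pre by blast
      qed
    qed
    then have sub: "I' \<subset> I" using i0 by (auto simp: I'_def)
    have cyc': "is_cycle G (\<eta> i)" "src G (hd (\<eta> i)) = w" if "i \<in> I'" for i
    proof -
      from that have i: "i \<in> I" "prefix \<delta> (\<gamma> i @ \<delta>)" "src G (hd (\<eta> i)) = w"
        "path (\<eta> i)" by (auto simp: I'_def)
      then have "last (\<eta> i) = last \<delta>"
        using \<eta>_split[OF i(2)] \<eta>_set[OF i(1)] \<delta>(2) by (metis last_append)
      with i \<eta>_set[OF i(1)] \<delta>(4) show "is_cycle G (\<eta> i)" "src G (hd (\<eta> i)) = w"
        by (auto simp: is_cycle_iff_edge_path)
    qed
    define x where "x = p {w} * tw \<delta>"
    define y where "y = sw \<delta> * p {w}"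
    have xy: "x \<in> lpa" "y \<in> lpa"
      using \<delta> set\<delta> by (auto simp: x_def y_def p_vertex_in_lpa mult_tw_in_lpa sw_mult_in_lpa)
    have vy: "p {v} * y = y"
      using v \<delta> set\<delta> by (simp add: y_def vertex_mult_sw flip: mult.assoc)
    have "x * p {v} * y = p {w}"
      using \<delta> by (simp add: mult.assoc vy) (simp add: x_def y_def tw_sw_p p_idem gen_verts.vertex flip: mult.assoc)
    then have first: "x * (sc c * p {v}) * y = sc c * p {w}"
      by (simp add: mult_sc mult.assoc)
    have summand: "x * (sw (\<gamma> i) * p {v}) * y = (if i \<in> I' then sw (\<eta> i) * p {w} else 0)"
      if i: "i \<in> I" for i
    proof -
      have "x * (sw (\<gamma> i) * p {v}) * y = x * sw (\<gamma> i @ \<delta>) * p {w}"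
        by (simp add: mult.assoc vy) (simp add: y_def)
      also have "x * sw (\<gamma> i @ \<delta>) = (if prefix \<delta> (\<gamma> i @ \<delta>) \<and> src G (hd (\<eta> i)) = w then sw (\<eta> i) else 0)"
        unfolding x_def \<eta>_def using \<delta> set\<delta> \<gamma>[OF i] by (intro compress_path) auto
      also have "\<dots> = (if i \<in> I' then sw (\<eta> i) else 0)"
        using sw_not_path[OF \<eta>_set(2)[OF i]] i by (auto simp: I'_def)
      finally show ?thesis by simp
    qed
    have "x * (sc c * p {v} + (\<Sum>i \<in> I. sc (k i) * (sw (\<gamma> i) * p {v}))) * y
        = sc c * p {w} + (\<Sum>i \<in> I. sc (k i) * (if i \<in> I' then sw (\<eta> i) * p {w} else 0))"
    proof -
      have "x * (sc (k i) * (sw (\<gamma> i) * p {v})) * y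
          = sc (k i) * (if i \<in> I' then sw (\<eta> i) * p {w} else 0)" if "i \<in> I" for i
        using summand[OF that] by (simp only: mult_sc mult.assoc)
      then show ?thesis
        by (simp add: distrib_left distrib_right sum_distrib_left sum_distrib_right first cong: sum.cong)
    qed
    also have "(\<Sum>i \<in> I. sc (k i) * (if i \<in> I' then sw (\<eta> i) * p {w} else 0))
        = (\<Sum>i \<in> I'. sc (k i) * (sw (\<eta> i) * p {w}))"
      using sub \<open>finite I\<close> by (intro sum.mono_neutral_cong_right) auto
    finally have "reducible (x * (sc c * p {v} + (\<Sum>i \<in> I. sc (k i) * (sw (\<gamma> i) * p {v}))) * y)"
      using psubset.IH[OF sub \<delta>(5) \<open>c \<noteq> 0\<close>, of \<eta>] cyc' by simp
    then show ?thesis using xy by (rule reducible_mult)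
  qed
qed

definition ends_at :: "'e list \<Rightarrow> 'v \<Rightarrow> bool" where
  "ends_at \<alpha> v \<longleftrightarrow> path \<alpha> \<and> (\<alpha> \<noteq> [] \<longrightarrow> v \<in> rng G (last \<alpha>))"

lemma sw_mult_vertex_not_end:
  "path \<alpha> \<Longrightarrow> \<not> ends_at \<alpha> v \<Longrightarrow> v \<in> verts G \<Longrightarrow> sw \<alpha> * p {v} = 0"
  by (rule sw_mult_vertex) (auto simp: ends_at_def edge_path_def)

text \<open>Stripping a shortest path \<open>\<alpha>0\<close> from the left leaves a multiple of the vertex, and every other path
either vanishes or leaves a nonempty closed path.\<close>

lemma reducible_paths:
  assumes exits: "\<And>\<alpha>. is_cycle G \<alpha> \<Longrightarrow> has_exit G \<alpha>"
    and S: "finite S" "S \<noteq> {}" and v: "v \<in> verts G"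
    and ends: "\<And>\<alpha>. \<alpha> \<in> S \<Longrightarrow> ends_at \<alpha> v" and k: "\<And>\<alpha>. \<alpha> \<in> S \<Longrightarrow> k \<alpha> \<noteq> 0"
  shows "reducible (\<Sum>\<alpha> \<in> S. sc (k \<alpha>) * (sw \<alpha> * p {v}))"
proof -
  define \<alpha>0 where "\<alpha>0 = arg_min_on length S"
  have \<alpha>0: "\<alpha>0 \<in> S" and min: "\<And>\<alpha>. \<alpha> \<in> S \<Longrightarrow> length \<alpha>0 \<le> length \<alpha>"
    using S by (auto simp: \<alpha>0_def arg_min_if_finite arg_min_least)
  define \<gamma> where "\<gamma> \<alpha> = drop (length \<alpha>0) \<alpha>" for \<alpha> :: "'e list"
  define I where "I = {\<alpha> \<in> S - {\<alpha>0}. prefix \<alpha>0 \<alpha> \<and> src G (hd (\<gamma> \<alpha>)) = v}"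
  define x where "x = p {v} * tw \<alpha>0"
  have "x \<in> lpa" using ends[OF \<alpha>0] v
    by (auto simp: x_def ends_at_def edge_path_def p_vertex_in_lpa mult_tw_in_lpa)
  have x0: "x * sw \<alpha>0 = p {v}"
    using ends[OF \<alpha>0] v by (cases "\<alpha>0 = []") (auto simp: x_def ends_at_def tw_sw_p)
  have first: "x * (sw \<alpha>0 * p {v}) = p {v}"
    using x0 v by (simp add: p_idem gen_verts.vertex flip: mult.assoc)
  have summand: "x * (sw \<alpha> * p {v}) = (if \<alpha> \<in> I then sw (\<gamma> \<alpha>) * p {v} else 0)"
    if \<alpha>: "\<alpha> \<in> S - {\<alpha>0}" for \<alpha>
  proof (cases "prefix \<alpha>0 \<alpha>")
    case True
    then obtain \<eta> where \<eta>: "\<alpha> = \<alpha>0 @ \<eta>" by (auto elim: prefixE)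
    have "\<eta> \<noteq> []" "set \<eta> \<subseteq> edges G" using \<alpha> ends[of \<alpha>] \<eta> by (auto simp: ends_at_def edge_path_def)
    moreover have "x * (sw \<alpha> * p {v}) = p {v} * sw \<eta> * p {v}"
      using x0 by (simp add: \<eta> flip: mult.assoc)
    ultimately show ?thesis using \<alpha> \<eta> v by (auto simp: I_def \<gamma>_def vertex_mult_sw)
  next
    case False
    moreover have "\<not> prefix \<alpha> \<alpha>0"
      using min[of \<alpha>] \<alpha> by (metis DiffE False append_eq_conv_conj order_refl prefixE prefix_length_le prefix_order.antisym take_all)
    ultimately have "tw \<alpha>0 * sw \<alpha> = 0" using \<alpha> ends[of \<alpha>] ends[OF \<alpha>0]
      by (intro tw_sw_zero) (auto simp: ends_at_def edge_path_def)
    then show ?thesis using False by (simp add: x_def I_def mult.assoc) (simp flip: mult.assoc)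
  qed
  have cyc: "is_cycle G (\<gamma> \<alpha>) \<and> src G (hd (\<gamma> \<alpha>)) = v" if "\<alpha> \<in> I" for \<alpha>
  proof -
    from that have \<alpha>: "prefix \<alpha>0 \<alpha>" "\<alpha> \<noteq> \<alpha>0" "\<alpha> \<in> S" "src G (hd (\<gamma> \<alpha>)) = v"
      by (auto simp: I_def)
    then obtain \<eta> where \<eta>: "\<alpha> = \<alpha>0 @ \<eta>" by (auto elim: prefixE)
    then show ?thesis using ends[OF \<alpha>(3)] \<alpha>
      by (auto simp: is_cycle_iff_edge_path \<gamma>_def ends_at_def edge_path_append)
  qed
  have "x * (\<Sum>\<alpha> \<in> S. sc (k \<alpha>) * (sw \<alpha> * p {v}))
      = (\<Sum>\<alpha> \<in> S. sc (k \<alpha>) * (x * (sw \<alpha> * p {v})))"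
    by (simp add: sum_distrib_left mult_sc)
  also have "\<dots> = sc (k \<alpha>0) * (x * (sw \<alpha>0 * p {v})) + (\<Sum>\<alpha> \<in> S - {\<alpha>0}. sc (k \<alpha>) * (x * (sw \<alpha> * p {v})))"
    using S \<alpha>0 by (simp add: sum.remove)
  also have "\<dots> = sc (k \<alpha>0) * p {v} + (\<Sum>\<alpha> \<in> S - {\<alpha>0}. sc (k \<alpha>) * (if \<alpha> \<in> I then sw (\<gamma> \<alpha>) * p {v} else 0))"
    by (simp only: first summand cong: sum.cong)
  also have "(\<Sum>\<alpha> \<in> S - {\<alpha>0}. sc (k \<alpha>) * (if \<alpha> \<in> I then sw (\<gamma> \<alpha>) * p {v} else 0))
      = (\<Sum>\<alpha> \<in> I. sc (k \<alpha>) * (sw (\<gamma> \<alpha>) * p {v}))"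
    using S by (intro sum.mono_neutral_cong_right) (auto simp: I_def)
  finally have eq: "x * (\<Sum>\<alpha> \<in> S. sc (k \<alpha>) * (sw \<alpha> * p {v})) * p {v}
      = sc (k \<alpha>0) * p {v} + (\<Sum>\<alpha> \<in> I. sc (k \<alpha>) * (sw (\<gamma> \<alpha>) * p {v}))"
    using v by (simp add: distrib_right sum_distrib_right mult.assoc p_idem gen_verts.vertex)
  have "finite I" using S by (auto simp: I_def)
  then have "reducible (x * (\<Sum>\<alpha> \<in> S. sc (k \<alpha>) * (sw \<alpha> * p {v})) * p {v})"
    unfolding eq using reducible_closed_paths[OF exits, of I v "k \<alpha>0" \<gamma> k] v k[OF \<alpha>0] cyc by blast
  then show ?thesis using \<open>x \<in> lpa\<close> v by (auto intro: reducible_mult p_vertex_in_lpa)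
qed

text \<open>A combination of projections acts on the cell \<open>B - C\<close> like a combination of indicator functions.
The induction splits the cell along one set of the combination after the other; at the end a cell is empty,
hence its idempotent \<open>p B * (1 - p C)\<close> is zero, or it has a point, at which the scalar is seen to be
zero.  The sets \<open>gen_verts G\<close> need not be closed under differences, which is why cells are pairs.\<close>

lemma cell_zero:
  assumes "B \<in> gen_verts G" "C \<in> gen_verts G" "\<And>k A. (k, A) \<in> set xs \<Longrightarrow> A \<in> gen_verts G"
    and "\<And>v. v \<in> B - C \<Longrightarrow> c + (\<Sum>(k, A) \<leftarrow> xs. if v \<in> A then k else 0) = 0"
  shows "p B * (1 - p C) * (sc c + (\<Sum>(k, A) \<leftarrow> xs. sc k * p A)) = 0"
  using assms
proof (induction xs arbitrary: B C c)
  case Nil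
  show ?case
  proof (cases "B \<subseteq> C")
    case True
    then have "p B * (1 - p C) = 0" using Nil by (simp add: right_diff_distrib p_mult Int_absorb2)
    then show ?thesis by simp
  next
    case False
    then have "c = 0" using Nil(4) by auto
    then show ?thesis by simp
  qed
next
  case (Cons x xs)
  obtain k A where x: "x = (k, A)" by (cases x)
  have A: "A \<in> gen_verts G" using Cons.prems(3) x by auto
  define z where "z = (\<Sum>(k, A) \<leftarrow> xs. sc k * p A)"
  have 1: "p (B \<inter> A) * (1 - p C) * (sc (c + k) + z) = 0"
    unfolding z_def
  proof (rule Cons.IH)
    show "c + k + (\<Sum>(k, A) \<leftarrow> xs. if v \<in> A then k else 0) = 0" if "v \<in> B \<inter> A - C" for v
      using that Cons.prems(4)[of v] by (auto simp: x add.assoc)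
  qed (use Cons.prems A in \<open>auto intro: gen_verts.inter\<close>)
  have 2: "p B * (1 - p (C \<union> A)) * (sc c + z) = 0"
    unfolding z_def
  proof (rule Cons.IH)
    show "c + (\<Sum>(k, A) \<leftarrow> xs. if v \<in> A then k else 0) = 0" if "v \<in> B - (C \<union> A)" for v
      using that Cons.prems(4)[of v] by (auto simp: x)
  qed (use Cons.prems A in \<open>auto intro: gen_verts.union\<close>)
  have in_gen: "B \<inter> C \<in> gen_verts G" "B \<inter> A \<in> gen_verts G" "C \<inter> A \<in> gen_verts G"
      "C \<union> A \<in> gen_verts G"
    using Cons.prems A by (auto intro: gen_verts.inter gen_verts.union)
  have BC: "p B * (1 - p C) * p A = p (B \<inter> A) * (1 - p C)"
    using Cons.prems A in_gen by (simp add: right_diff_distrib left_diff_distrib p_mult Int_ac)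
  have BCA: "p B * (1 - p C) * (1 - p A) = p B * (1 - p (C \<union> A))"
    using Cons.prems A in_gen
    by (simp add: right_diff_distrib left_diff_distrib distrib_left p_mult p_union Int_ac)
  have split: "sc c + (sc k * p A + z) = p A * (sc (c + k) + z) + (1 - p A) * (sc c + z)"
    using sc_central[of "p A" k] sc_central[of "p A" c] by (simp add: sc_add algebra_simps)
  have "p B * (1 - p C) * (sc c + (sc k * p A + z)) =
      p B * (1 - p C) * p A * (sc (c + k) + z) + p B * (1 - p C) * (1 - p A) * (sc c + z)"
    unfolding split by (simp only: distrib_left mult.assoc)
  then show ?case using 1 2 by (simp add: x z_def[symmetric] BC BCA)
qed

abbreviation diag :: "'a set" where "diag \<equiv> vs.span (p ` gen_verts G)"

lemma diag_list:
  assumes "q \<in> diag"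
  obtains xs where "q = (\<Sum>(k, A) \<leftarrow> xs. sc k * p A)" "\<And>k A. (k, A) \<in> set xs \<Longrightarrow> A \<in> gen_verts G"
proof -
  have "\<exists>xs. q = (\<Sum>(k, A) \<leftarrow> xs. sc k * p A) \<and> (\<forall>(k, A) \<in> set xs. A \<in> gen_verts G)"
    using assms
  proof (induction rule: vs.span_induct_alt)
    case base then show ?case by (intro exI[of _ "[]"]) simp
  next
    case (step c x y)
    then obtain A xs where "x = p A" "A \<in> gen_verts G" "y = (\<Sum>(k, A) \<leftarrow> xs. sc k * p A)"
      "\<forall>(k, A) \<in> set xs. A \<in> gen_verts G" by auto
    then show ?case by (intro exI[of _ "(c, A) # xs"]) auto
  qed
  then show thesis using that by auto
qed

lemma diag_list_vertex:
  assumes "\<And>k A. (k, A) \<in> set xs \<Longrightarrow> A \<in> gen_verts G" "v \<in> verts G"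
  shows "(\<Sum>(k, A) \<leftarrow> xs. sc k * p A) * p {v} = sc (\<Sum>(k, A) \<leftarrow> xs. if v \<in> A then k else 0) * p {v}"
  using assms(1)
proof (induction xs)
  case (Cons x xs)
  obtain k A where x: "x = (k, A)" by (cases x)
  then have "A \<in> gen_verts G" using Cons.prems by auto
  moreover have "(\<Sum>(k, A) \<leftarrow> xs. sc k * p A) * p {v} = sc (\<Sum>(k, A) \<leftarrow> xs. if v \<in> A then k else 0) * p {v}"
    using Cons.prems by (intro Cons.IH) auto
  ultimately show ?case using assms(2)
    by (simp add: x distrib_right sc_add mult.assoc p_mult_vertex)
qed simp

lemma diag_vertex: "q \<in> diag \<Longrightarrow> v \<in> verts G \<Longrightarrow> \<exists>k. q * p {v} = sc k * p {v}"
  by (metis diag_list diag_list_vertex)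

lemma diag_eq_zero:
  assumes "q \<in> diag" "B \<in> gen_verts G" "\<And>v. v \<in> B \<Longrightarrow> q * p {v} = 0"
  shows "p B * q = 0"
proof -
  obtain xs where xs: "q = (\<Sum>(k, A) \<leftarrow> xs. sc k * p A)" "\<And>k A. (k, A) \<in> set xs \<Longrightarrow> A \<in> gen_verts G"
    using diag_list[OF assms(1)] by metis
  have "0 + (\<Sum>(k, A) \<leftarrow> xs. if v \<in> A then k else 0) = 0" if "v \<in> B - {}" for v
  proof -
    have v: "v \<in> verts G" using that gen_verts_subset[OF assms(2)] by auto
    then show ?thesis using assms(3)[of v] diag_list_vertex[of xs v] xs that p_vertex_nonzero[OF v]
      by (auto simp: vs.scale_eq_0_iff)
  qed
  from cell_zero[OF assms(2) gen_verts.empty xs(2) this] show ?thesis by (simp add: xs(1))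
qed

lemma diag_support: "q \<in> diag \<Longrightarrow> \<exists>B \<in> gen_verts G. p B * q = q"
proof (induction rule: vs.span_induct_alt)
  case base then show ?case using gen_verts.empty by auto
next
  case (step c x y)
  then obtain A B where x: "x = p A" "A \<in> gen_verts G" and B: "B \<in> gen_verts G" "p B * y = y" by auto
  have "p (A \<union> B) * y = p (A \<union> B) * p B * y" using B by (simp add: mult.assoc)
  also have "\<dots> = p ((A \<union> B) \<inter> B) * y" using x B by (simp add: p_mult gen_verts.union)
  also have "(A \<union> B) \<inter> B = B" by blast
  finally have "p (A \<union> B) * y = y" using B by simp
  moreover have "(A \<union> B) \<inter> A = A" by blast
  then have "p (A \<union> B) * x = x" using x B by (simp add: p_mult gen_verts.union)
  ultimately have "p (A \<union> B) * (sc c * x + y) = sc c * x + y"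
    by (simp add: distrib_left mult_sc)
  then show ?case using x B gen_verts.union by blast
qed

text \<open>Collects the terms of a linear combination according to an index \<open>i\<close>.\<close>

lemma span_sum_form:
  assumes "x \<in> vs.span {f i m | i m. i \<in> I \<and> m \<in> B i}"
    and add: "\<And>i x y. f i (x + y) = f i x + f i y" and scale: "\<And>i c x. f i (sc c * x) = sc c * f i x"
  shows "\<exists>S q. finite S \<and> S \<subseteq> I \<and> (\<forall>i. q i \<in> vs.span (B i)) \<and> x = (\<Sum>i \<in> S. f i (q i))"
  using assms(1)
proof (induction rule: vs.span_induct_alt)
  case base
  then show ?case by (intro exI[of _ "{}"] exI[of _ "\<lambda>_. 0"]) (simp add: vs.span_zero)
next
  case (step c m y)
  then obtain i b S q where m: "m = f i b" "i \<in> I" "b \<in> B i" and S: "finite S" "S \<subseteq> I"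
    and q: "\<forall>i. q i \<in> vs.span (B i)" and y: "y = (\<Sum>i \<in> S. f i (q i))" by blast
  define q' where "q' = (\<lambda>j. if j \<in> S then q j else 0)"
  have f0: "f j 0 = 0" for j using add[of j 0 0] by simp
  have "y = (\<Sum>j \<in> S. f j (q' j))" unfolding y by (intro sum.cong) (auto simp: q'_def)
  also have "\<dots> = (\<Sum>j \<in> insert i S. f j (q' j))"
    using S f0 by (intro sum.mono_neutral_left) (auto simp: q'_def)
  also have "\<dots> = f i (q' i) + (\<Sum>j \<in> S - {i}. f j (q' j))"
    using S by (simp add: sum.insert_remove)
  finally have "sc c * m + y = f i (sc c * b + q' i) + (\<Sum>j \<in> S - {i}. f j (q' j))"
    by (simp add: m add scale add.assoc)
  also have "\<dots> = (\<Sum>j \<in> insert i S. f j ((q'(i := sc c * b + q' i)) j))"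
    using S by (simp add: sum.insert_remove)
  finally show ?case
    using S m q by (intro exI[of _ "insert i S"] exI[of _ "q'(i := sc c * b + q' i)"])
      (auto simp: q'_def intro: vs.span_add vs.span_scale vs.span_base vs.span_zero)
qed

text \<open>The elements that can be written with ghost paths of length at most \<open>n\<close>; those in \<open>ghost_le 0\<close>
are called ghost-free below.\<close>

definition ghost_le :: "nat \<Rightarrow> 'a set" where
  "ghost_le n = vs.span {mon \<alpha> A \<beta> | \<alpha> A \<beta>. path \<alpha> \<and> path \<beta> \<and>
     A \<in> gen_verts G \<and> length \<beta> \<le> n}"

lemma ghost_free_form:
  assumes "x \<in> ghost_le 0"
  obtains S q where "finite S" "S \<subseteq> {\<alpha>. path \<alpha>}" "\<And>\<alpha>. q \<alpha> \<in> diag"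
    "x = (\<Sum>\<alpha> \<in> S. sw \<alpha> * q \<alpha>)"
proof -
  have "{mon \<alpha> A \<beta> | \<alpha> A \<beta>. path \<alpha> \<and> path \<beta> \<and>
      A \<in> gen_verts G \<and> length \<beta> \<le> 0} =
      {sw \<alpha> * m | \<alpha> m. \<alpha> \<in> {\<alpha>. path \<alpha>} \<and> m \<in> p ` gen_verts G}"
    by (fastforce simp: mon_def)
  then have "x \<in> vs.span {sw \<alpha> * m | \<alpha> m. \<alpha> \<in> {\<alpha>. path \<alpha>} \<and> m \<in> p ` gen_verts G}"
    using assms by (simp only: ghost_le_def)
  from span_sum_form[of x "\<lambda>\<alpha> m. sw \<alpha> * m", OF this distrib_left mult_sc] show thesis
    using that by blast
qed

lemma ghost_free_sum: "finite S \<Longrightarrow> S \<subseteq> {\<alpha>. path \<alpha>} \<Longrightarrow> (\<And>\<alpha>. \<alpha> \<in> S \<Longrightarrow> q \<alpha> \<in> diag)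
    \<Longrightarrow> (\<Sum>\<alpha> \<in> S. sw \<alpha> * q \<alpha>) \<in> ghost_le 0"
  unfolding ghost_le_def
proof (intro vs.span_sum)
  fix \<alpha> assume "S \<subseteq> {\<alpha>. path \<alpha>}" "\<alpha> \<in> S" "\<And>\<alpha>. \<alpha> \<in> S \<Longrightarrow> q \<alpha> \<in> diag"
  then have \<alpha>: "path \<alpha>" and "q \<alpha> \<in> diag" by auto
  from this(2) show "sw \<alpha> * q \<alpha> \<in> vs.span {mon \<alpha> A \<beta> | \<alpha> A \<beta>. path \<alpha> \<and>
      path \<beta> \<and> A \<in> gen_verts G \<and> length \<beta> \<le> 0}"
  proof (induction rule: vs.span_induct_alt)
    case (step c m y)
    then obtain A where "m = p A" "A \<in> gen_verts G" by auto
    then have "sw \<alpha> * m \<in> {mon \<alpha> A \<beta> | \<alpha> A \<beta>. path \<alpha> \<and>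
      path \<beta> \<and> A \<in> gen_verts G \<and> length \<beta> \<le> 0}"
      using \<alpha> by (fastforce simp: mon_def)
    then show ?case using step
      by (auto simp: distrib_left mult_sc intro!: vs.span_add vs.span_scale intro: vs.span_base)
  qed (simp add: vs.span_zero)
qed

text \<open>Multiplication by \<open>p {v}\<close> turns every coefficient \<open>q \<alpha>\<close> into a scalar, and the paths that do not
end at \<open>v\<close> disappear.\<close>

lemma reducible_at_vertex:
  assumes exits: "\<And>\<alpha>. is_cycle G \<alpha> \<Longrightarrow> has_exit G \<alpha>"
    and S: "finite S" "S \<subseteq> {\<alpha>. path \<alpha>}" and q: "\<And>\<alpha>. q \<alpha> \<in> diag"
    and v: "v \<in> verts G" and \<alpha>: "\<alpha> \<in> S" "ends_at \<alpha> v" "q \<alpha> * p {v} \<noteq> 0"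
  shows "reducible (\<Sum>\<alpha> \<in> S. sw \<alpha> * q \<alpha>)"
proof -
  obtain k where k: "\<And>\<alpha>. q \<alpha> * p {v} = sc (k \<alpha>) * p {v}"
    using diag_vertex[OF q v] by metis
  define T where "T = {\<alpha> \<in> S. ends_at \<alpha> v \<and> k \<alpha> \<noteq> 0}"
  have "(\<Sum>\<alpha> \<in> S. sw \<alpha> * q \<alpha>) * p {v} = (\<Sum>\<alpha> \<in> S. sc (k \<alpha>) * (sw \<alpha> * p {v}))"
    by (simp add: sum_distrib_right mult.assoc k mult_sc)
  also have "\<dots> = (\<Sum>\<alpha> \<in> T. sc (k \<alpha>) * (sw \<alpha> * p {v}))"
    using S v sw_mult_vertex_not_end[of _ v]
    by (intro sum.mono_neutral_right) (auto simp: T_def)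
  finally have eq: "(\<Sum>\<alpha> \<in> S. sw \<alpha> * q \<alpha>) * p {v} = (\<Sum>\<alpha> \<in> T. sc (k \<alpha>) * (sw \<alpha> * p {v}))" .
  have "\<alpha> \<in> T" using \<alpha> k[of \<alpha>] by (auto simp: T_def)
  then have "reducible ((\<Sum>\<alpha> \<in> S. sw \<alpha> * q \<alpha>) * p {v})"
    unfolding eq using S v by (intro reducible_paths[OF exits]) (auto simp: T_def)
  then show ?thesis using v by (auto intro: reducible_mult_right p_vertex_in_lpa)
qed

text \<open>If some coefficient \<open>q \<alpha>\<close> is nonzero at a vertex of the range of \<open>\<alpha>\<close>, the previous lemma applies;
otherwise all terms \<open>sw \<alpha> * q \<alpha>\<close> are zero by \<open>diag_eq_zero\<close>.\<close>

lemma reducible_ghost_free: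
  assumes exits: "\<And>\<alpha>. is_cycle G \<alpha> \<Longrightarrow> has_exit G \<alpha>" and x: "x \<in> ghost_le 0" "x \<noteq> 0"
  shows "reducible x"
proof -
  obtain S q where S: "finite S" "S \<subseteq> {\<alpha>. path \<alpha>}" and q: "\<And>\<alpha>. q \<alpha> \<in> diag"
    and eq: "x = (\<Sum>\<alpha> \<in> S. sw \<alpha> * q \<alpha>)" using ghost_free_form[OF x(1)] by metis
  obtain \<alpha> where \<alpha>: "\<alpha> \<in> S" "sw \<alpha> * q \<alpha> \<noteq> 0"
    using x(2) unfolding eq by (auto elim: sum.not_neutral_contains_not_neutral)
  obtain B where B: "B \<in> gen_verts G" "\<alpha> \<noteq> [] \<Longrightarrow> B = rng G (last \<alpha>)" "sw \<alpha> * p B * q \<alpha> = sw \<alpha> * q \<alpha>"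
  proof (cases "\<alpha> = []")
    case True
    then show thesis using that diag_support[OF q, of \<alpha>] by auto
  next
    case False
    have "set \<alpha> \<subseteq> edges G" using S \<alpha> by (auto simp: edge_path_def)
    moreover from this have "last \<alpha> \<in> edges G" using False by auto
    ultimately show thesis using that[of "rng G (last \<alpha>)"] False by (simp add: sw_mult_p)
  qed
  have "p B * q \<alpha> \<noteq> 0" using B(3) \<alpha>(2) by (metis mult.assoc mult_zero_right)
  then obtain v where v: "v \<in> B" "q \<alpha> * p {v} \<noteq> 0" using diag_eq_zero[OF q B(1)] by blast
  have "v \<in> verts G" "ends_at \<alpha> v"
    using v B gen_verts_subset S \<alpha> by (auto simp: ends_at_def)
  then show ?thesis unfolding eq
    by (intro reducible_at_vertex[where v = v and \<alpha> = \<alpha>] exits S q \<alpha>(1) v(2))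
qed

text \<open>If \<open>x * p {src G f}\<close> had a nonzero term, appending \<open>f\<close> to its paths would show that \<open>x * s f\<close> is
reducible, but \<open>0\<close> is not.\<close>

lemma ghost_free_cancel:
  assumes exits: "\<And>\<alpha>. is_cycle G \<alpha> \<Longrightarrow> has_exit G \<alpha>"
    and x: "x \<in> ghost_le 0" "x * s f = 0" and f: "f \<in> edges G"
  shows "x * p {src G f} = 0"
proof (rule ccontr)
  let ?v = "src G f"
  assume nz: "x * p {?v} \<noteq> 0"
  have v: "?v \<in> verts G" using f by (rule src_in_verts)
  obtain w where w: "w \<in> rng G f" "w \<in> verts G" using f rng_nonempty rng_subset_verts by blast
  obtain S q where S: "finite S" "S \<subseteq> {\<alpha>. path \<alpha>}" and q: "\<And>\<alpha>. q \<alpha> \<in> diag"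
    and eq: "x = (\<Sum>\<alpha> \<in> S. sw \<alpha> * q \<alpha>)" using ghost_free_form[OF x(1)] by metis
  obtain k where k: "\<And>\<alpha>. q \<alpha> * p {?v} = sc (k \<alpha>) * p {?v}"
    using diag_vertex[OF q v] by metis
  have "x * p {?v} = (\<Sum>\<alpha> \<in> S. sc (k \<alpha>) * (sw \<alpha> * p {?v}))"
    by (simp add: eq sum_distrib_right mult.assoc k mult_sc)
  then obtain \<alpha> where \<alpha>: "\<alpha> \<in> S" "sc (k \<alpha>) * (sw \<alpha> * p {?v}) \<noteq> 0"
    using nz by (auto elim: sum.not_neutral_contains_not_neutral)
  then have \<alpha>v: "ends_at \<alpha> ?v" "k \<alpha> \<noteq> 0"
    using S v sw_mult_vertex_not_end[of \<alpha> ?v] by auto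
  define T where "T = {\<alpha> \<in> S. ends_at \<alpha> ?v}"
  have summand: "sw \<alpha> * q \<alpha> * s f = sc (k \<alpha>) * sw (\<alpha> @ [f])" for \<alpha>
  proof -
    have "sw \<alpha> * q \<alpha> * s f = sw \<alpha> * (q \<alpha> * p {?v}) * s f"
      using p_s[OF f] by (simp add: mult.assoc)
    then show ?thesis using p_s[OF f] by (simp add: k mult.assoc mult_sc)
  qed
  have "x * s f = (\<Sum>\<alpha> \<in> S. sc (k \<alpha>) * sw (\<alpha> @ [f]))"
    by (simp only: eq sum_distrib_right summand)
  also have "\<dots> = (\<Sum>\<alpha> \<in> T. sc (k \<alpha>) * sw (\<alpha> @ [f]))"
  proof (rule sum.mono_neutral_right)
    have "sw (\<alpha> @ [f]) = 0" if "\<alpha> \<in> S - T" for \<alpha>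
    proof (rule sw_not_path)
      have \<alpha>: "path \<alpha>" "\<not> ends_at \<alpha> ?v" using that S by (auto simp: T_def)
      then show "\<not> path (\<alpha> @ [f])" by (auto simp: ends_at_def edge_path_append)
      show "set (\<alpha> @ [f]) \<subseteq> edges G" using \<alpha> f by (auto simp: edge_path_def)
    qed
    then show "\<forall>\<alpha> \<in> S - T. sc (k \<alpha>) * sw (\<alpha> @ [f]) = 0" by simp
  qed (use S in \<open>auto simp: T_def\<close>)
  also have "\<dots> = (\<Sum>\<alpha> \<in> (\<lambda>\<alpha>. \<alpha> @ [f]) ` T. sw \<alpha> * (sc (k (butlast \<alpha>)) * p (rng G f)))"
    using f by (subst sum.reindex) (auto simp: inj_on_def mult_sc mult.assoc s_p intro!: sum.cong)
  finally have sum: "x * s f = \<dots>" .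
  have "reducible (x * s f)"
    unfolding sum
  proof (rule reducible_at_vertex[OF exits, where v = w and \<alpha> = "\<alpha> @ [f]"])
    show "(\<lambda>\<alpha>. \<alpha> @ [f]) ` T \<subseteq> {\<alpha>. path \<alpha>}"
      using f by (auto simp: T_def ends_at_def edge_path_append edge_path_Cons)
    show "\<alpha> @ [f] \<in> (\<lambda>\<alpha>. \<alpha> @ [f]) ` T" using \<alpha> \<alpha>v by (auto simp: T_def)
    show "ends_at (\<alpha> @ [f]) w" using \<alpha>v w f by (auto simp: ends_at_def edge_path_append edge_path_Cons)
    show "sc (k (butlast (\<alpha> @ [f]))) * p (rng G f) * p {w} \<noteq> 0"
      using \<alpha>v w f p_vertex_nonzero by (simp add: mult.assoc p_mult_vertex vs.scale_eq_0_iff)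
    show "sc (k (butlast \<alpha>)) * p (rng G f) \<in> diag" for \<alpha>
      using f by (intro vs.span_scale vs.span_base imageI rng_in)
  qed (use S w f in \<open>auto simp: T_def\<close>)
  then show False using x(2) not_reducible_zero by simp
qed

lemma ghost_le_mult_s:
  assumes "x \<in> ghost_le (Suc n)" "f \<in> edges G" shows "x * s f \<in> ghost_le n"
  using assms(1) unfolding ghost_le_def
proof (induction rule: vs.span_induct_alt)
  case base then show ?case by (simp add: vs.span_zero)
next
  case (step c m y)
  let ?S = "{mon \<alpha> A \<beta> | \<alpha> A \<beta>. path \<alpha> \<and> path \<beta> \<and>
     A \<in> gen_verts G \<and> length \<beta> \<le> n}"
  from step obtain \<alpha> A \<beta> where m: "m = mon \<alpha> A \<beta>" "path \<alpha>"
    "path \<beta>" "A \<in> gen_verts G" "length \<beta> \<le> Suc n" by auto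
  have S: "mon \<alpha> A \<beta> \<in> ?S" if "path \<alpha>" "path \<beta>" "A \<in> gen_verts G"
    "length \<beta> \<le> n" for \<alpha> A \<beta> using that by blast
  have "m * s f \<in> insert 0 ?S"
  proof (cases \<beta>)
    case Nil
    then have "m * s f = sw \<alpha> * (p A * s f)" by (simp add: m mon_def mult.assoc)
    also have "\<dots> \<in> {0, sw (\<alpha> @ [f])}" using m assms(2) by (simp add: p_mult_s)
    finally have 1: "m * s f \<in> {0, sw (\<alpha> @ [f])}" .
    show ?thesis
    proof (cases "path (\<alpha> @ [f])")
      case True
      then have "mon (\<alpha> @ [f]) (rng G f) [] \<in> ?S" using assms(2) by (intro S) auto
      moreover have "mon (\<alpha> @ [f]) (rng G f) [] = sw (\<alpha> @ [f])"
        using assms(2) by (simp add: mon_def mult.assoc s_p)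
      ultimately show ?thesis using 1 by auto
    next
      case False
      have "sw (\<alpha> @ [f]) = 0"
        by (rule sw_not_path[OF _ False]) (use m assms(2) in \<open>auto simp: edge_path_def\<close>)
      then show ?thesis using 1 by auto
    qed
  next
    case (Cons e \<beta>')
    have e: "e \<in> edges G" "path \<beta>'" using m Cons by (auto simp: edge_path_Cons)
    have eq: "m * s f = sw \<alpha> * p A * tw \<beta>' * (t e * s f)" by (simp add: m mon_def Cons mult.assoc)
    show ?thesis
    proof (cases "e = f")
      case True
      then have eq: "m * s f = sw \<alpha> * p A * (tw \<beta>' * p (rng G e))"
        using eq assms(2) by (simp add: t_s mult.assoc)
      show ?thesis
      proof (cases "\<beta>' = []")
        case True
        then have "m * s f = mon \<alpha> (A \<inter> rng G e) []"
          using eq m e by (simp add: mon_def mult.assoc p_mult)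
        moreover have "mon \<alpha> (A \<inter> rng G e) [] \<in> ?S" using m e by (intro S) (auto intro: gen_verts.inter)
        ultimately show ?thesis by simp
      next
        case False
        have "set \<beta>' \<subseteq> edges G" using e by (simp add: edge_path_def)
        then have "tw \<beta>' * p (rng G e) \<in> {0, tw \<beta>'}" using False e by (simp add: tw_mult_p)
        then have "m * s f \<in> {0, mon \<alpha> A \<beta>'}" unfolding eq by (auto simp: mon_def)
        moreover have "mon \<alpha> A \<beta>' \<in> ?S" using m e Cons by (intro S) auto
        ultimately show ?thesis by auto
      qed
    next
      case False
      then show ?thesis using eq e assms(2) by (simp add: t_s)
    qed
  qed
  then show ?case using step
    by (auto simp: distrib_right mult.assoc intro!: vs.span_add vs.span_scale intro: vs.span_base vs.span_zero)
qed

lemma ghost_le_mono: "m \<le> n \<Longrightarrow> ghost_le m \<subseteq> ghost_le n"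
  unfolding ghost_le_def by (intro vs.span_mono) (blast intro: le_trans)

lemma ghost_le_Suc_form:
  assumes "x \<in> ghost_le (Suc n)"
  obtains a F b where "a \<in> ghost_le 0" "finite F" "F \<subseteq> edges G" "x = a + (\<Sum>e \<in> F. b e * t e)"
proof -
  let ?B = "{mon \<alpha> A \<beta> | \<alpha> A \<beta>. True}"
  let ?M0 = "{mon \<alpha> A \<beta> | \<alpha> A \<beta>. path \<alpha> \<and> path \<beta> \<and>
      A \<in> gen_verts G \<and> length \<beta> \<le> 0}"
  have "{mon \<alpha> A \<beta> | \<alpha> A \<beta>. path \<alpha> \<and> path \<beta> \<and>
      A \<in> gen_verts G \<and> length \<beta> \<le> Suc n} \<subseteq> ?M0 \<union> {m * t e | e m. e \<in> edges G \<and> m \<in> ?B}"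
  proof safe
    fix \<alpha> A \<beta>
    assume *: "path \<alpha>" "path \<beta>" "A \<in> gen_verts G"
      "\<nexists>e m. mon \<alpha> A \<beta> = m * t e \<and> e \<in> edges G \<and> m \<in> ?B"
    have "\<beta> = []"
    proof (cases \<beta>)
      case (Cons e \<beta>')
      then have "mon \<alpha> A \<beta> = mon \<alpha> A \<beta>' * t e" "e \<in> edges G"
        using * by (auto simp: mon_def mult.assoc edge_path_Cons)
      then show ?thesis using *(4) by blast
    qed
    then show "\<exists>\<alpha>' A' \<beta>'. mon \<alpha> A \<beta> = mon \<alpha>' A' \<beta>' \<and> path \<alpha>' \<and>
      path \<beta>' \<and> A' \<in> gen_verts G \<and> length \<beta>' \<le> 0"
      using * by blast
  qed
  then have "x \<in> vs.span (?M0 \<union> {m * t e | e m. e \<in> edges G \<and> m \<in> ?B})"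
    using assms vs.span_mono unfolding ghost_le_def by blast
  then obtain a y where "x = a + y" "a \<in> ghost_le 0" "y \<in> vs.span {m * t e | e m. e \<in> edges G \<and> m \<in> ?B}"
    unfolding vs.span_Un ghost_le_def by blast
  moreover from this(3) obtain F b where "finite F" "F \<subseteq> edges G" "y = (\<Sum>e \<in> F. b e * t e)"
    using span_sum_form[of y "\<lambda>e m. m * t e" "edges G" "\<lambda>_. ?B"] by (auto simp: distrib_right mult.assoc)
  ultimately show thesis using that by blast
qed

text \<open>Suppose that \<open>x = a + (\<Sum>e \<in> F. b e * t e)\<close> is not reducible, with \<open>a\<close> ghost-free.  By induction
\<open>x * s f = 0\<close> for every edge \<open>f\<close>, which determines \<open>b f * t f = - a * s f * t f\<close> for \<open>f \<in> F\<close> and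
gives \<open>a * s f = 0\<close> for \<open>f \<notin> F\<close>.  At the source \<open>v\<close> of an edge in \<open>F\<close> this yields \<open>x * p {v} = 0\<close>: for regular
\<open>v\<close> by the relation for \<open>p {v}\<close>, and for an infinite emitter because some edge from \<open>v\<close> lies outside \<open>F\<close>, so
that \<open>a * p {v} = 0\<close> by cancellation.  Hence \<open>x = a - (\<Sum>v \<in> src G ` F. a * p {v})\<close> is ghost-free.\<close>

lemma reducible_ghost_le:
  assumes exits: "\<And>\<alpha>. is_cycle G \<alpha> \<Longrightarrow> has_exit G \<alpha>"
  shows "x \<in> ghost_le n \<Longrightarrow> x \<noteq> 0 \<Longrightarrow> reducible x"
proof (induction n arbitrary: x)
  case 0
  then show ?case using reducible_ghost_free exits by blast
next
  case (Suc n)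
  show ?case
  proof (rule ccontr)
    assume nred: "\<not> reducible x"
    have xs: "x * s f = 0" if "f \<in> edges G" for f
      using Suc.IH[OF ghost_le_mult_s[OF Suc.prems(1) that]] nred that
      by (meson reducible_mult_right s_in_lpa)
    obtain a F b where a: "a \<in> ghost_le 0" and F: "finite F" "F \<subseteq> edges G"
      and x: "x = a + (\<Sum>e \<in> F. b e * t e)" using ghost_le_Suc_form[OF Suc.prems(1)] by metis
    have xs': "x * s f = a * s f + (if f \<in> F then b f * p (rng G f) else 0)" if f: "f \<in> edges G" for f
    proof -
      have "b e * t e * s f = (if f = e then b f * p (rng G f) else 0)" if "e \<in> F" for e
        using that f F by (auto simp: mult.assoc t_s)
      then show ?thesis using F(1)
        by (simp add: x distrib_right sum_distrib_right cong: sum.cong)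
    qed
    have b: "b f * t f = - (a * s f * t f)" if "f \<in> F" for f
    proof -
      have f: "f \<in> edges G" using that F by auto
      have "b f * p (rng G f) = - (a * s f)"
        using xs'[OF f] xs[OF f] that by (simp add: eq_neg_iff_add_eq_0 add.commute)
      then have "b f * p (rng G f) * t f = - (a * s f) * t f" by simp
      then show ?thesis using f by (simp add: mult.assoc p_t)
    qed
    have outF: "a * s f = 0" if "f \<in> edges G - F" for f
      using xs'[of f] xs[of f] that by simp
    have x_eq: "x = a - (\<Sum>f \<in> F. a * s f * t f)"
      by (simp add: x b sum_negf cong: sum.cong)
    define V where "V = src G ` F"
    have V: "finite V" "V \<subseteq> verts G" using F src_in_verts by (auto simp: V_def)
    have st_p: "a * s f * t f * p {v} = (if src G f = v then a * s f * t f else 0)"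
      if "f \<in> F" "v \<in> verts G" for f v
      using that F t_mult_p[OF gen_verts.vertex[OF that(2)], of f] by (auto simp: mult.assoc)
    have at_v: "x * p {v} = a * p {v} - (\<Sum>f \<in> {f \<in> F. src G f = v}. a * s f * t f)" if "v \<in> verts G" for v
      using that F by (simp add: x_eq left_diff_distrib sum_distrib_right st_p sum.inter_filter cong: sum.cong)
    have V0: "a * p {v} = (\<Sum>f \<in> {f \<in> F. src G f = v}. a * s f * t f)" if "v \<in> V" for v
    proof (cases "finite (out_edges G v)")
      case True
      from that V F have v: "v \<in> verts G" and reg: "regular_vertex G v"
        using True by (auto simp: regular_vertex_def V_def out_edges_def)
      have "x * p {v} = (\<Sum>e \<in> out_edges G v. x * s e * t e)"
        by (simp add: p_regular[OF reg] sum_distrib_left mult.assoc)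
      also have "\<dots> = 0" using xs by (intro sum.neutral) (auto simp: out_edges_def)
      finally show ?thesis using at_v[OF v] by simp
    next
      case False
      then obtain f where f: "f \<in> out_edges G v - F" using F(1) by (metis finite_subset Diff_eq_empty_iff ex_in_conv)
      then have fe: "f \<in> edges G" "src G f = v" "a * s f = 0"
        using outF by (auto simp: out_edges_def)
      then have ap: "a * p {v} = 0" using ghost_free_cancel[OF exits a] by blast
      have "a * s g = 0" if "g \<in> F" "src G g = v" for g
      proof -
        have "a * s g = a * p {v} * s g" using that F p_s[of g] by (auto simp: mult.assoc)
        then show ?thesis by (simp add: ap)
      qed
      then show ?thesis by (simp add: ap)
    qed
    have "(\<Sum>f \<in> F. a * s f * t f) = (\<Sum>v \<in> V. \<Sum>f \<in> {f \<in> F. src G f = v}. a * s f * t f)"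
      unfolding V_def using F(1) by (rule sum.image_gen)
    then have "x = a - (\<Sum>v \<in> V. a * p {v})" by (simp add: x_eq V0)
    moreover have "a * p {v} \<in> ghost_le 0" if "v \<in> V" for v
    proof -
      have v: "v \<in> verts G" using that V by auto
      obtain S q where S: "finite S" "S \<subseteq> {\<alpha>. path \<alpha>}" and q: "\<And>\<alpha>. q \<alpha> \<in> diag"
        and eq: "a = (\<Sum>\<alpha> \<in> S. sw \<alpha> * q \<alpha>)" using ghost_free_form[OF a] by metis
      have "q \<alpha> * p {v} \<in> diag" for \<alpha>
        using diag_vertex[OF q v, of \<alpha>] vs.span_scale[OF vs.span_base[OF imageI[OF gen_verts.vertex[OF v]]]]
        by metis
      then show ?thesis using ghost_free_sum[OF S, of "\<lambda>\<alpha>. q \<alpha> * p {v}"]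
        by (simp add: eq sum_distrib_right mult.assoc)
    qed
    ultimately have "x \<in> ghost_le 0"
      using a unfolding ghost_le_def by (auto intro!: vs.span_diff vs.span_sum)
    then show False using reducible_ghost_free exits Suc.prems(2) nred by blast
  qed
qed

theorem nonzero_reducible:
  assumes "\<And>\<alpha>. is_cycle G \<alpha> \<Longrightarrow> has_exit G \<alpha>" and "x \<in> lpa" "x \<noteq> 0"
  shows "reducible x"
proof -
  have "\<exists>n. x \<in> ghost_le n"
    using assms(2) unfolding lpa_def
  proof (induction rule: vs.span_induct_alt)
    case base
    then show ?case by (auto simp: ghost_le_def vs.span_zero)
  next
    case (step c m y)
    from step obtain n where n: "y \<in> ghost_le n" by blast
    from step obtain \<alpha> A \<beta> where m: "m = mon \<alpha> A \<beta>" "path \<alpha>"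
      "path \<beta>" "A \<in> gen_verts G" by (auto simp: mons_def)
    have "m \<in> ghost_le (max n (length \<beta>))"
      unfolding ghost_le_def m(1) using m
      by (intro vs.span_base CollectI exI[of _ \<alpha>] exI[of _ A] exI[of _ \<beta>]) simp
    moreover have "y \<in> ghost_le (max n (length \<beta>))" using n ghost_le_mono[of n "max n (length \<beta>)"] by auto
    ultimately show ?case unfolding ghost_le_def by (auto intro: vs.span_add vs.span_scale)
  qed
  then show ?thesis using reducible_ghost_le assms by blast
qed

end

section \<open>Infinite idempotents\<close>

text \<open>The elementwise form of an infinite idempotent of the subring \<open>S\<close>: \<open>x\<close> maps \<open>e S\<close>
isomorphically onto the proper direct summand \<open>(x * y) S\<close>.\<close>

definition infinite_in :: "'a::ring set \<Rightarrow> 'a \<Rightarrow> bool" where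
  "infinite_in S e \<longleftrightarrow> e \<in> S \<and> e * e = e \<and>
     (\<exists>x \<in> S. \<exists>y \<in> S. e * x = x \<and> x * e = x \<and> e * y = y \<and> y * e = y \<and> y * x = e \<and> x * y \<noteq> e)"

text \<open>If \<open>e = x * a * y\<close> with \<open>x = e * x\<close> and \<open>y = y * e\<close>, then \<open>a * y * x\<close> is an idempotent and
\<open>z \<mapsto> a * y * z * x\<close> is an isomorphism from the corner of \<open>e\<close> to its corner.\<close>

lemma infinite_in_corner:
  assumes S: "\<And>x y. x \<in> S \<Longrightarrow> y \<in> S \<Longrightarrow> x * y \<in> S"
    and "infinite_in S (x * a * y)" and "a \<in> S" "x \<in> S" "y \<in> S"
  shows "\<exists>z \<in> S. infinite_in S (a * z)"
proof -
  define e where "e = x * a * y"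
  from assms(2) obtain x' y' where e: "e \<in> S" "e * e = e" and xy': "x' \<in> S" "y' \<in> S" "e * x' = x'"
    "x' * e = x'" "e * y' = y'" "y' * e = y'" "y' * x' = e" "x' * y' \<noteq> e"
    unfolding infinite_in_def e_def by blast
  define X where "X = e * x"
  define Y where "Y = y * e"
  have XaY: "X * (a * Y) = e"
    unfolding X_def Y_def using e(2) by (metis e_def mult.assoc)
  have XY: "X \<in> S" "Y \<in> S" using assms e S by (auto simp: X_def Y_def)
  have Ye: "Y * e = Y" using e(2) by (simp add: Y_def mult.assoc)
  have eX: "e * X = X" using e(2) by (simp add: X_def flip: mult.assoc)
  have XaYz: "X * (a * (Y * z)) = e * z" for z using XaY by (metis mult.assoc)
  have eXz: "e * (X * z) = X * z" for z using eX by (metis mult.assoc)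
  have xz: "e * (x' * z) = x' * z" "e * (y' * z) = y' * z" "x' * (e * z) = x' * z" "y' * (e * z) = y' * z"
    "y' * (x' * z) = e * z" for z
    using xy' by (metis mult.assoc)+
  let ?f = "a * (Y * X)" and ?x = "a * (Y * (x' * X))" and ?y = "a * (Y * (y' * X))"
  have "?x * ?y \<noteq> ?f"
  proof
    assume "?x * ?y = ?f"
    then have "X * (?x * ?y) * (a * Y) = X * ?f * (a * Y)" by simp
    moreover have "X * (?x * ?y) * (a * Y) = x' * y'"
      using xy' by (simp add: mult.assoc XaYz XaY xz)
    moreover have "X * ?f * (a * Y) = e" using e(2) by (simp add: mult.assoc XaYz XaY)
    ultimately show False using xy'(8) by simp
  qed
  moreover have "?f * ?f = ?f" by (simp add: mult.assoc XaYz eX)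
  moreover have "?f * ?x = ?x" "?x * ?f = ?x" "?f * ?y = ?y" "?y * ?f = ?y"
    by (simp_all add: mult.assoc XaYz eX xz)
  moreover have "?y * ?x = ?f" by (simp add: mult.assoc XaYz eX xz)
  moreover have "?f \<in> S" "?x \<in> S" "?y \<in> S" using assms XY xy' by (auto intro!: S)
  ultimately have "infinite_in S ?f" unfolding infinite_in_def by blast
  then show ?thesis using XY S by blast
qed

lemma is_cycle_rotate: "is_cycle G \<alpha> \<Longrightarrow> is_cycle G (rotate i \<alpha>)"
proof (induction i)
  case (Suc i)
  moreover have "is_cycle G (rotate1 \<beta>)" if "is_cycle G \<beta>" for \<beta>
    using that by (cases \<beta>)
      (auto simp: is_cycle_iff_edge_path edge_path_Cons edge_path_append hd_append split: if_splits)
  ultimately show ?case by simp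
qed simp

text \<open>The walk of \<open>m\<close> steps from \<open>u\<close> when \<open>E\<close> gives the next edge and \<open>nx\<close> the next vertex.\<close>

primrec walk :: "('v \<Rightarrow> 'e) \<Rightarrow> ('v \<Rightarrow> 'v) \<Rightarrow> nat \<Rightarrow> 'v \<Rightarrow> 'e list" where
  "walk E nx 0 u = []"
| "walk E nx (Suc m) u = E u # walk E nx m (nx u)"

lemma length_walk [simp]: "length (walk E nx m u) = m"
  by (induction m arbitrary: u) auto

lemma walk_add: "walk E nx (m + k) u = walk E nx m u @ walk E nx k ((nx ^^ m) u)"
  by (induction m arbitrary: u) (simp_all add: funpow_swap1)

text \<open>A further vertex in the range of an edge of the cycle would be a sink, hence an exit, or would emit an edge
that is an exit.\<close>

lemma (in ultragraph) exitless_cycle: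
  assumes "is_cycle G c" "\<not> has_exit G c" and j: "j < length c"
  shows "out_edges G (src G (c ! j)) = {c ! j}" "rng G (c ! j) = {src G (c ! (Suc j mod length c))}"
proof -
  have c: "c \<noteq> []" "set c \<subseteq> edges G" using assms by (auto simp: is_cycle_iff_edge_path edge_path_def)
  have c_in: "c ! i \<in> edges G" if "i < length c" for i using c that by auto
  have noexit: "f = c ! (Suc i mod length c)"
    if "i < length c" "f \<in> edges G" "src G f \<in> rng G (c ! i)" for i f
    using assms(2) that unfolding has_exit_def edge_exit_def by blast
  have sub: "rng G (c ! i) \<subseteq> {src G (c ! (Suc i mod length c))}" if i: "i < length c" for i
  proof
    fix w assume w: "w \<in> rng G (c ! i)"
    then have "w \<in> verts G" "\<not> sink G w"
      using assms(2) i rng_subset_verts[OF c_in[OF i]] unfolding has_exit_def sink_exit_def by auto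
    then obtain f where f: "f \<in> edges G" "src G f = w" by (auto simp: sink_def out_edges_def)
    then have "f = c ! (Suc i mod length c)" using noexit i w by blast
    then show "w \<in> {src G (c ! (Suc i mod length c))}" using f by simp
  qed
  have rng: "rng G (c ! i) = {src G (c ! (Suc i mod length c))}" if i: "i < length c" for i
    using sub[OF i] rng_nonempty[OF c_in[OF i]] by blast
  show "rng G (c ! j) = {src G (c ! (Suc j mod length c))}" by (rule rng[OF j])
  define i where "i = (if j = 0 then length c - 1 else j - 1)"
  have i: "i < length c" "Suc i mod length c = j" using j c(1) by (auto simp: i_def)
  show "out_edges G (src G (c ! j)) = {c ! j}"
    using noexit[OF i(1)] rng[OF i(1)] i(2) c_in[OF j] by (auto simp: out_edges_def)
qed

text \<open>The stretch between two occurrences of an edge is a cycle.\<close>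

lemma (in ultragraph) acyclic_distinct:
  assumes "\<nexists>\<alpha>. is_cycle G \<alpha>" "F \<subseteq> edges G" "edge_path G F \<alpha>" shows "distinct \<alpha>"
proof (rule ccontr)
  assume "\<not> distinct \<alpha>"
  then obtain xs ys zs e where \<alpha>: "\<alpha> = xs @ [e] @ ys @ [e] @ zs" using not_distinct_decomp by blast
  have path: "path \<alpha>" using assms by (auto simp: edge_path_def)
  have "is_cycle G (e # ys)"
    using path unfolding \<alpha> is_cycle_iff_edge_path
    by (cases "ys = []") (auto simp: edge_path_append edge_path_Cons split: if_splits)
  then show False using assms(1) by blast
qed

context leavitt_family
begin

text \<open>The element \<open>x\<close> goes once around the cycle, and \<open>y * x = p {u}\<close>.  If \<open>x * y = p {u}\<close> held, then
\<open>p {u}\<close> would factor through three turns of the cycle; but these are annihilated by the ghost of an exit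
path, whereas \<open>p {u}\<close> is not.  Three turns are taken because they are longer than the exit path even when
the cycle has length one.\<close>

lemma infinite_at_cycle:
  assumes "is_cycle G c" "has_exit G c"
  shows "infinite_in lpa (p {src G (hd c)})"
proof -
  define u where "u = src G (hd c)"
  have c: "c \<noteq> []" "path c" "u \<in> rng G (last c)" "set c \<subseteq> edges G"
    using assms by (auto simp: is_cycle_iff_edge_path u_def edge_path_def)
  have "hd c \<in> edges G" using c by auto
  then have u: "u \<in> verts G" by (simp add: src_in_verts u_def)
  have pp: "p {u} * p {u} = p {u}" using u by (simp add: p_idem gen_verts.vertex)
  have pc: "p {u} * sw c = sw c" using u c by (simp add: vertex_mult_sw u_def)
  have cp: "tw c * p {u} = tw c" using u c tw_mult_p[of "{u}" c] by (simp add: u_def gen_verts.vertex)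
  define x where "x = sw c * p {u}"
  define y where "y = p {u} * tw c"
  have yx: "y * x = p {u}"
    using tw_sw_p[OF c(2,1,3) u] pp by (simp add: x_def y_def flip: mult.assoc)
  have "x * y \<noteq> p {u}"
  proof
    assume "x * y = p {u}"
    then have once: "sw c * (p {u} * tw c) = p {u}"
      by (simp only: x_def y_def pp mult.assoc) (simp only: pp flip: mult.assoc)
    have "p {u} = sw c * (sw c * (sw c * (p {u} * tw c) * tw c) * tw c)"
      by (simp only: once mult.assoc)
    then have thrice: "p {u} = sw (c @ c @ c) * (p {u} * tw (c @ c @ c))" by (simp add: mult.assoc)
    obtain \<delta> w where \<delta>: "path \<delta>" "\<delta> \<noteq> []" "src G (hd \<delta>) = u"
        "w \<in> rng G (last \<delta>)" "w \<in> verts G" "length \<delta> \<le> Suc (length c)"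
        "sink G w \<or> (\<forall>\<zeta>. \<zeta> \<noteq> [] \<longrightarrow> hd \<zeta> = hd c \<longrightarrow> \<not> prefix \<delta> (c @ \<zeta>))"
      using exit_path[OF assms] unfolding u_def by metis
    have len: "length \<delta> < length (c @ c @ c)" using \<delta>(6) c(1) by (cases c) auto
    have set\<delta>: "set \<delta> \<subseteq> edges G" using \<delta> by (simp add: edge_path_def)
    have "\<not> (prefix \<delta> (c @ c @ c) \<and> src G (hd (drop (length \<delta>) (c @ c @ c))) = w)"
      using \<delta>(7)
    proof
      assume "sink G w"
      moreover have "drop (length \<delta>) (c @ c @ c) \<noteq> []" using len by (simp del: drop_append)
      then have "hd (drop (length \<delta>) (c @ c @ c)) \<in> set (drop (length \<delta>) (c @ c @ c))"
        by (rule hd_in_set)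
      then have "hd (drop (length \<delta>) (c @ c @ c)) \<in> set (c @ c @ c)" by (rule in_set_dropD)
      then have "hd (drop (length \<delta>) (c @ c @ c)) \<in> edges G" using c(4) by auto
      ultimately show ?thesis by (auto simp: sink_def out_edges_def)
    next
      assume "\<forall>\<zeta>. \<zeta> \<noteq> [] \<longrightarrow> hd \<zeta> = hd c \<longrightarrow> \<not> prefix \<delta> (c @ \<zeta>)"
      then show ?thesis using c(1) by (metis append_is_Nil_conv hd_append2)
    qed
    then have zero: "p {w} * tw \<delta> * sw (c @ c @ c) = 0"
      using compress_path[OF \<delta>(1,2,4,5), of "c @ c @ c"] len c(4) by auto
    have "p {w} = p {w} * tw \<delta> * (p {u} * sw \<delta>)"
      using tw_sw_p[OF \<delta>(1,2,4,5)] vertex_mult_sw[OF u \<delta>(2) set\<delta>] \<delta>(3) by simp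
    also have "\<dots> = p {w} * tw \<delta> * sw (c @ c @ c) * (p {u} * tw (c @ c @ c)) * sw \<delta>"
      by (subst thrice) (simp only: mult.assoc)
    also have "\<dots> = 0" by (simp only: zero mult_zero_left)
    finally show False using p_vertex_nonzero[OF \<delta>(5)] by simp
  qed
  moreover have "p {u} * x = x" "x * p {u} = x" "p {u} * y = y" "y * p {u} = y"
    using pp pc cp by (simp_all add: x_def y_def mult.assoc) (simp_all flip: mult.assoc)
  moreover have "p {u} \<in> lpa" "x \<in> lpa" "y \<in> lpa"
    using u c by (auto simp: x_def y_def p_vertex_in_lpa sw_mult_in_lpa mult_tw_in_lpa)
  ultimately show ?thesis using pp yx unfolding infinite_in_def u_def by blast
qed

lemma connects_reducible:
  assumes "is_cycle G \<alpha>" "connects_to_cycle G v \<alpha>" "v \<in> verts G"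
  shows "\<exists>x \<in> lpa. \<exists>y \<in> lpa. \<exists>c. is_cycle G c \<and> x * p {v} * y = p {src G (hd c)}"
proof -
  from assms obtain \<beta> i where \<beta>: "is_path G \<beta>" "path_src G \<beta> = {v}"
    and i: "i < length \<alpha>" "src G (\<alpha> ! i) \<in> path_rng G \<beta>" by (auto simp: connects_to_cycle_def)
  define c where "c = rotate i \<alpha>"
  define u where "u = src G (\<alpha> ! i)"
  have "\<alpha> \<noteq> []" using i by auto
  then have c: "is_cycle G c" "hd c = \<alpha> ! i"
    using is_cycle_rotate[OF assms(1)] i by (auto simp: c_def hd_rotate_conv_nth)
  have "\<alpha> ! i \<in> edges G" using assms(1) i by (auto simp: is_cycle_iff_edge_path edge_path_def)
  then have u: "u \<in> verts G" by (simp add: u_def src_in_verts)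
  have "\<exists>x \<in> lpa. \<exists>y \<in> lpa. x * p {v} * y = p {u}"
  proof (cases \<beta>)
    case (Trivial_Path A)
    then have "u = v" using \<beta> i by (simp add: u_def)
    moreover have "p {v} * p {v} * p {v} = p {v}" using assms by (simp add: p_idem gen_verts.vertex)
    ultimately show ?thesis using p_vertex_in_lpa[OF assms(3)] by blast
  next
    case (Edge_Path es)
    then have es: "es \<noteq> []" "path es" "src G (hd es) = v" "u \<in> rng G (last es)"
      using \<beta> i is_path_iff_edge_path[of G es] by (auto simp: u_def)
    then have set: "set es \<subseteq> edges G" by (simp add: edge_path_def)
    have "p {v} * sw es = sw es" using es set assms(3) by (simp add: vertex_mult_sw)
    then have "(p {u} * tw es) * p {v} * (sw es * p {u}) = p {u} * tw es * sw es * p {u}"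
      by (metis mult.assoc)
    also have "\<dots> = p {u}" using tw_sw_p[OF es(2,1,4) u] u by (simp add: p_idem gen_verts.vertex)
    finally show ?thesis using u set
      by (meson p_vertex_in_lpa mult_tw_in_lpa sw_mult_in_lpa)
  qed
  then show ?thesis using c unfolding u_def by metis
qed

theorem nonzero_infinite:
  assumes exits: "\<And>\<alpha>. is_cycle G \<alpha> \<Longrightarrow> has_exit G \<alpha>"
    and conn: "\<And>w. w \<in> verts G \<Longrightarrow> \<exists>\<alpha>. is_cycle G \<alpha> \<and> connects_to_cycle G w \<alpha>"
    and a: "a \<in> lpa" "a \<noteq> 0"
  shows "\<exists>z \<in> lpa. infinite_in lpa (a * z)"
proof -
  obtain x y v where xy: "x \<in> lpa" "y \<in> lpa" "v \<in> verts G" "x * a * y = p {v}"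
    using nonzero_reducible[OF exits a] by (auto simp: reducible_def)
  obtain x' y' c where xy': "x' \<in> lpa" "y' \<in> lpa" "is_cycle G c" "x' * p {v} * y' = p {src G (hd c)}"
    using conn[OF xy(3)] connects_reducible xy(3) by blast
  have "(x' * x) * a * (y * y') = x' * (x * a * y) * y'" by (simp only: mult.assoc)
  then have "infinite_in lpa ((x' * x) * a * (y * y'))"
    using infinite_at_cycle[OF xy'(3) exits[OF xy'(3)]] by (simp only: xy(4) xy'(4))
  then show ?thesis
    using xy xy' a by (intro infinite_in_corner[of lpa "x' * x" a "y * y'"] lpa_mult)
qed

section \<open>The corner at a cycle without exit\<close>

text \<open>On a set \<open>C\<close> of vertices from which there is only one way to go, every \<open>s (E u)\<close> is invertible
between the corners of \<open>u\<close> and \<open>nx u\<close>, and all paths are determined by their length.\<close>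

context
  fixes C :: "'v set" and E :: "'v \<Rightarrow> 'e" and nx :: "'v \<Rightarrow> 'v"
  assumes C_out: "\<And>u. u \<in> C \<Longrightarrow> out_edges G u = {E u}"
    and C_rng: "\<And>u. u \<in> C \<Longrightarrow> rng G (E u) = {nx u}"
    and C_nx: "\<And>u. u \<in> C \<Longrightarrow> nx u \<in> C"
begin

abbreviation W where "W \<equiv> walk E nx"

lemma C_edge: "u \<in> C \<Longrightarrow> E u \<in> edges G" "u \<in> C \<Longrightarrow> src G (E u) = u"
  using C_out[of u] by (auto simp: out_edges_def)

lemma C_verts: "u \<in> C \<Longrightarrow> u \<in> verts G"
  using C_edge src_in_verts by metis

lemma C_pow: "u \<in> C \<Longrightarrow> (nx ^^ m) u \<in> C"
  by (induction m) (auto simp: C_nx)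

lemma C_s_t: "u \<in> C \<Longrightarrow> s (E u) * t (E u) = p {u}"
  using p_regular[of u] C_out[of u] C_verts[of u] by (simp add: regular_vertex_def)

lemma C_gen: "u \<in> C \<Longrightarrow> p {u} * s (E u) = s (E u)" "u \<in> C \<Longrightarrow> s (E u) * p {nx u} = s (E u)"
   "u \<in> C \<Longrightarrow> t (E u) * p {u} = t (E u)" "u \<in> C \<Longrightarrow> p {nx u} * t (E u) = t (E u)"
   "u \<in> C \<Longrightarrow> t (E u) * s (E u) = p {nx u}"
  using p_s[of "E u"] s_p[of "E u"] t_p[of "E u"] p_t[of "E u"] t_s[of "E u" "E u"] C_edge[of u] C_rng[of u]
  by simp_all

lemma sw_tw_walk: "u \<in> C \<Longrightarrow> sw (W m u) * (p {(nx ^^ m) u} * tw (W m u)) = p {u}"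
proof (induction m arbitrary: u)
  case (Suc m)
  have "sw (W (Suc m) u) * (p {(nx ^^ Suc m) u} * tw (W (Suc m) u))
      = s (E u) * (sw (W m (nx u)) * (p {(nx ^^ m) (nx u)} * tw (W m (nx u)))) * t (E u)"
    by (simp add: funpow_swap1 mult.assoc)
  also have "\<dots> = p {u}" using Suc C_nx[of u] by (simp add: C_gen C_s_t)
  finally show ?case .
qed simp

lemma tw_sw_walk: "u \<in> C \<Longrightarrow> tw (W m u) * (p {u} * sw (W m u)) = p {(nx ^^ m) u}"
proof (induction m arbitrary: u)
  case (Suc m)
  have "tw (W (Suc m) u) * (p {u} * sw (W (Suc m) u))
      = tw (W m (nx u)) * (t (E u) * (p {u} * s (E u))) * sw (W m (nx u))"
    by (simp add: mult.assoc)
  also have "\<dots> = tw (W m (nx u)) * (p {nx u} * sw (W m (nx u)))"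
    using Suc by (simp add: C_gen mult.assoc)
  finally show ?case using Suc C_nx[of u] by (simp add: funpow_swap1)
qed simp

lemma vertex_mult_walk: "u \<in> C \<Longrightarrow> p {u} * sw (W m u) = sw (W m u) * p {(nx ^^ m) u}"
proof (induction m arbitrary: u)
  case (Suc m)
  then have "p {u} * sw (W (Suc m) u) = s (E u) * (p {nx u} * sw (W m (nx u)))"
    by (simp add: C_gen flip: mult.assoc)
  also have "\<dots> = s (E u) * (sw (W m (nx u)) * p {(nx ^^ m) (nx u)})"
    using Suc C_nx[of u] by simp
  finally show ?case by (simp add: funpow_swap1 mult.assoc)
qed simp

lemma walk_mult_vertex: "u \<in> C \<Longrightarrow> tw (W m u) * p {u} = p {(nx ^^ m) u} * tw (W m u)"
proof (induction m arbitrary: u)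
  case (Suc m)
  then have "tw (W (Suc m) u) * p {u} = tw (W m (nx u)) * p {nx u} * t (E u)"
    by (simp add: C_gen mult.assoc)
  also have "\<dots> = p {(nx ^^ m) (nx u)} * tw (W m (nx u)) * t (E u)"
    using Suc C_nx[of u] by simp
  finally show ?case by (simp add: funpow_swap1 mult.assoc)
qed simp

lemma forward_path_is_walk:
  assumes "u \<in> C" "set \<alpha> \<subseteq> edges G" "p {u} * sw \<alpha> \<noteq> 0" shows "\<alpha> = W (length \<alpha>) u"
  using assms
proof (induction \<alpha> arbitrary: u)
  case (Cons e \<alpha>)
  have "src G e = u"
    using Cons.prems vertex_mult_sw[OF C_verts, of u "e # \<alpha>"] by (auto split: if_splits)
  then have e: "e = E u" using C_out[of u] Cons.prems by (auto simp: out_edges_def)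
  have "s e * (p {nx u} * sw \<alpha>) \<noteq> 0"
    using Cons.prems C_gen[of u] by (auto simp: e simp flip: mult.assoc)
  then have "p {nx u} * sw \<alpha> \<noteq> 0" by auto
  then show ?case using Cons C_nx[of u] e by simp
qed simp

lemma backward_path_is_walk:
  assumes "u \<in> C" "set \<alpha> \<subseteq> edges G" "tw \<alpha> * p {u} \<noteq> 0" shows "\<alpha> = W (length \<alpha>) u"
  using assms
proof (induction \<alpha> arbitrary: u)
  case (Cons e \<alpha>)
  have "src G e = u"
    using Cons.prems tw_mult_p[OF gen_verts.vertex[OF C_verts], of u "e # \<alpha>"] by (auto split: if_splits)
  then have e: "e = E u" using C_out[of u] Cons.prems by (auto simp: out_edges_def)
  have "tw \<alpha> * p {nx u} * t e \<noteq> 0"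
    using Cons.prems C_gen[of u] by (auto simp: e mult.assoc)
  then have "tw \<alpha> * p {nx u} \<noteq> 0" by auto
  then show ?case using Cons C_nx[of u] e by simp
qed simp

text \<open>At a recurrent vertex \<open>v\<close> the walks that return to \<open>v\<close> give elements \<open>wind m\<close> that commute,
because \<open>wind m * wind k = wind (m + k)\<close>, and that are invertible in the corner of \<open>v\<close>, with inverse
\<open>unwind m\<close>.\<close>

context
  fixes v :: 'v and n :: nat
  assumes v: "v \<in> C" and n: "n > 0" "(nx ^^ n) v = v"
begin

abbreviation returns where "returns m \<equiv> (nx ^^ m) v = v"

definition wind where "wind m = p {v} * sw (W m v)"
definition unwind where "unwind m = tw (W m v) * p {v}"

lemma pv_idem: "p {v} * p {v} = p {v}"
  using C_verts[OF v] by (simp add: p_idem gen_verts.vertex)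

lemma wind_right: "returns m \<Longrightarrow> wind m = sw (W m v) * p {v}"
  using vertex_mult_walk[OF v, of m] by (simp add: wind_def)

lemma unwind_left: "returns m \<Longrightarrow> unwind m = p {v} * tw (W m v)"
  using walk_mult_vertex[OF v, of m] by (simp add: unwind_def)

lemma wind_add:
  assumes "returns m" "returns k" shows "wind m * wind k = wind (m + k)"
proof -
  have "wind m * wind k = sw (W m v) * (p {v} * p {v}) * sw (W k v)"
    using assms by (simp only: wind_right[of m] wind_def[of k] mult.assoc)
  also have "\<dots> = wind m * sw (W k v)" using assms by (simp only: pv_idem wind_right)
  finally show ?thesis using assms by (simp add: wind_def walk_add mult.assoc)
qed

lemma unwind_add:
  assumes "returns m" "returns k" shows "unwind k * unwind m = unwind (m + k)"
proof -
  have "unwind k * unwind m = tw (W k v) * (p {v} * p {v}) * tw (W m v)"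
    using assms by (simp only: unwind_left[of m] unwind_def[of k] mult.assoc)
  also have "\<dots> = tw (W k v) * unwind m" using assms by (simp only: pv_idem unwind_left mult.assoc)
  finally show ?thesis using assms by (simp add: unwind_def walk_add mult.assoc)
qed

lemma wind_unwind: "returns m \<Longrightarrow> wind m * unwind m = p {v}"
  using sw_tw_walk[OF v, of m] pv_idem
  by (simp add: wind_right unwind_left mult.assoc) (simp flip: mult.assoc)

lemma unwind_wind: "returns m \<Longrightarrow> unwind m * wind m = p {v}"
  using tw_sw_walk[OF v, of m] pv_idem
  by (simp add: wind_def unwind_def mult.assoc) (simp flip: mult.assoc)

lemma p_wind:
  assumes "returns m"
  shows "p {v} * wind m = wind m" "wind m * p {v} = wind m"
    "p {v} * unwind m = unwind m" "unwind m * p {v} = unwind m"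
proof -
  show "p {v} * wind m = wind m" by (simp add: wind_def pv_idem flip: mult.assoc)
  show "unwind m * p {v} = unwind m" by (simp add: unwind_def pv_idem mult.assoc)
  show "wind m * p {v} = wind m" using assms by (simp add: wind_right pv_idem mult.assoc)
  show "p {v} * unwind m = unwind m" using assms by (simp add: unwind_left pv_idem flip: mult.assoc)
qed

lemma wind_unwind_commute:
  assumes "returns m" "returns k" shows "wind m * unwind k = unwind k * wind m"
proof -
  have "unwind k * wind m = unwind k * wind m * (wind k * unwind k)"
    using assms by (simp add: wind_unwind p_wind mult.assoc)
  also have "\<dots> = unwind k * (wind m * wind k) * unwind k" by (simp only: mult.assoc)
  also have "wind m * wind k = wind k * wind m"
    using assms by (simp add: wind_add add.commute)
  also have "unwind k * (wind k * wind m) * unwind k = (unwind k * wind k) * wind m * unwind k"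
    by (simp only: mult.assoc)
  also have "\<dots> = wind m * unwind k" using assms by (simp add: unwind_wind p_wind)
  finally show ?thesis by simp
qed

definition windings where
  "windings = {wind m * unwind k | m k. returns m \<and> returns k}"

lemma windings_commute:
  assumes "x \<in> windings" "y \<in> windings" shows "x * y = y * x"
proof -
  from assms obtain m k m' k' where x: "x = wind m * unwind k" and y: "y = wind m' * unwind k'"
    and r: "returns m" "returns k" "returns m'" "returns k'" by (auto simp: windings_def)
  have "a * b * (c * d) = a * c * (b * d)" if "b * c = c * b" for a b c d :: 'a
    using that by (metis mult.assoc)
  then show ?thesis
    using r by (simp add: x y wind_unwind_commute wind_add unwind_add add.commute)
qed

text \<open>A monomial that survives in the corner consists of a walk from \<open>v\<close> to some vertex and the ghost of a
walk from \<open>v\<close> to the same vertex; prolonging both by the same walk back to \<open>v\<close> does not change the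
element.\<close>

lemma corner_mon:
  assumes "path \<alpha>" "path \<beta>" "A \<in> gen_verts G"
  shows "p {v} * mon \<alpha> A \<beta> * p {v} \<in> insert 0 windings"
proof (cases "p {v} * mon \<alpha> A \<beta> * p {v} = 0")
  case False
  have sets: "set \<alpha> \<subseteq> edges G" "set \<beta> \<subseteq> edges G" using assms by (auto simp: edge_path_def)
  define a where "a = length \<alpha>"
  define b where "b = length \<beta>"
  have "p {v} * sw \<alpha> * p A * (tw \<beta> * p {v}) \<noteq> 0" using False by (simp add: mon_def mult.assoc)
  then have "p {v} * sw \<alpha> \<noteq> 0" "tw \<beta> * p {v} \<noteq> 0" by auto
  then have \<alpha>\<beta>: "\<alpha> = W a v" "\<beta> = W b v"
    unfolding a_def b_def using sets v by (auto intro: forward_path_is_walk backward_path_is_walk)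
  let ?w = "(nx ^^ a) v" and ?w' = "(nx ^^ b) v"
  have w: "?w \<in> C" "?w \<in> verts G" "?w' \<in> verts G" using C_pow[OF v] C_verts by auto
  have eq: "p {v} * mon \<alpha> A \<beta> * p {v} = sw (W a v) * (p {?w} * p A * p {?w'}) * tw (W b v)"
  proof -
    have "p {v} * mon \<alpha> A \<beta> * p {v} = (p {v} * sw (W a v)) * p A * (tw (W b v) * p {v})"
      by (simp add: mon_def \<alpha>\<beta> mult.assoc)
    then show ?thesis by (simp add: vertex_mult_walk[OF v] walk_mult_vertex[OF v] mult.assoc)
  qed
  then have "p {?w} * p A * p {?w'} \<noteq> 0" using False by auto
  moreover have "p {?w} * p A = (if ?w \<in> A then p {?w} else 0)"
    using w assms(3) by (simp only: vertex_mult_p)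
  moreover have "p {?w} * p {?w'} = (if ?w \<in> {?w'} then p {?w} else 0)"
    using w by (simp only: vertex_mult_p gen_verts.vertex)
  ultimately have "p {?w} * p A * p {?w'} = p {?w}" and same: "?w' = ?w"
    by (auto split: if_splits)
  then have eq: "p {v} * mon \<alpha> A \<beta> * p {v} = sw (W a v) * p {?w} * tw (W b v)" using eq by simp
  \<comment> \<open>After \<open>(n - 1) * a\<close> further steps the walk has made \<open>n * a\<close> steps, a multiple of the period \<open>n\<close>.\<close>
  define d where "d = (n - 1) * a"
  have "d + a = a * n" using n(1) by (cases n) (auto simp: d_def)
  moreover have "(nx ^^ (a * n)) v = v"
    using n(2) by (induction a) (simp_all add: funpow_add)
  ultimately have d: "(nx ^^ d) ?w = v" by (metis comp_apply funpow_add)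
  have "p {?w} = sw (W d ?w) * (p {v} * tw (W d ?w))"
    using sw_tw_walk[OF w(1), of d] d by simp
  then have "p {v} * mon \<alpha> A \<beta> * p {v} = sw (W (a + d) v) * p {v} * tw (W (b + d) v)"
    unfolding eq by (simp add: walk_add same mult.assoc)
  moreover have r: "returns (a + d)" "returns (b + d)"
    using d same by (simp_all add: add.commute[of _ d] funpow_add)
  ultimately have "p {v} * mon \<alpha> A \<beta> * p {v} = wind (a + d) * unwind (b + d)"
    using pv_idem by (simp add: wind_right unwind_left mult.assoc) (simp flip: mult.assoc)
  then show ?thesis using r by (auto simp: windings_def)
qed simp

lemma corner_in_span: "x \<in> lpa \<Longrightarrow> p {v} * x * p {v} \<in> vs.span windings"
  unfolding lpa_def
proof (induction rule: vs.span_induct_alt)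
  case (step c m y)
  have "p {v} * m * p {v} \<in> vs.span windings"
  proof -
    from step obtain \<alpha> A \<beta> where "m = mon \<alpha> A \<beta>" "path \<alpha>" "path \<beta>"
      "A \<in> gen_verts G" by (auto simp: mons_def)
    then have "p {v} * m * p {v} \<in> insert 0 windings" using corner_mon by blast
    then show ?thesis by (auto intro: vs.span_base vs.span_zero)
  qed
  moreover have "p {v} * (sc c * m + y) * p {v} = sc c * (p {v} * m * p {v}) + p {v} * y * p {v}"
    by (simp add: distrib_left distrib_right mult_sc mult.assoc)
  ultimately show ?case using step by (auto intro: vs.span_add vs.span_scale)
qed (simp add: vs.span_zero)

lemma span_windings_commute:
  assumes "x \<in> vs.span windings" "y \<in> vs.span windings" shows "x * y = y * x"
proof -
  have 1: "m * y = y * m" if "m \<in> windings" for m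
    using assms(2)
  proof (induction rule: vs.span_induct_alt)
    case (step c m' y)
    then show ?case using windings_commute[OF that, of m']
      by (simp add: distrib_left distrib_right mult_sc mult.assoc)
  qed simp
  show ?thesis using assms(1)
  proof (induction rule: vs.span_induct_alt)
    case (step c m x)
    then show ?case using 1[of m] by (simp add: distrib_left distrib_right mult_sc mult.assoc)
  qed simp
qed

lemma corner_commute:
  "x \<in> lpa \<Longrightarrow> y \<in> lpa \<Longrightarrow> (p {v} * x * p {v}) * (p {v} * y * p {v}) = (p {v} * y * p {v}) * (p {v} * x * p {v})"
  by (intro span_windings_commute corner_in_span)

end
end

text \<open>The idempotent \<open>e\<close> lies in the right ideal of \<open>p {v}\<close> only, so it is first moved into the corner:
\<open>e * p {v}\<close>, \<open>x * p {v}\<close> and \<open>y * p {v}\<close> satisfy the same equations there, and the corner is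
commutative.\<close>

theorem exitless_cycle_no_infinite:
  assumes "is_cycle G c" "\<not> has_exit G c" and e: "p {src G (hd c)} * e = e"
  shows "\<not> infinite_in lpa e"
proof
  assume "infinite_in lpa e"
  then obtain x y where xy: "e * e = e" "x \<in> lpa" "y \<in> lpa" "e * x = x" "x * e = x" "e * y = y"
    "y * e = y" "y * x = e" "x * y \<noteq> e" by (auto simp: infinite_in_def)
  define v where "v = src G (hd c)"
  have c: "c \<noteq> []" using assms by (auto simp: is_cycle_iff_edge_path)
  define C where "C = src G ` set c"
  define E where "E u = the_elem (out_edges G u)" for u
  define nx where "nx u = the_elem (rng G (E u))" for u
  have at: "out_edges G (src G (c ! j)) = {c ! j}" "E (src G (c ! j)) = c ! j"
    "rng G (c ! j) = {src G (c ! (Suc j mod length c))}" "nx (src G (c ! j)) = src G (c ! (Suc j mod length c))"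
    if "j < length c" for j
    using exitless_cycle[OF assms(1,2) that] by (simp_all add: E_def nx_def)
  have C: "out_edges G u = {E u} \<and> rng G (E u) = {nx u} \<and> nx u \<in> C" if "u \<in> C" for u
  proof -
    from that obtain j where j: "j < length c" "u = src G (c ! j)" by (auto simp: C_def in_set_conv_nth)
    have "c ! (Suc j mod length c) \<in> set c" using c by simp
    then show ?thesis using at[OF j(1)] by (auto simp: j(2) C_def)
  qed
  have pow: "(nx ^^ k) v = src G (c ! (k mod length c))" for k
  proof (induction k)
    case 0
    then show ?case using c by (simp add: v_def hd_conv_nth)
  next
    case (Suc k)
    then show ?case using at(4)[of "k mod length c"] c by (simp add: mod_Suc_eq)
  qed
  have "v \<in> C" using c by (auto simp: C_def v_def)
  have comm: "(p {v} * x * p {v}) * (p {v} * y * p {v}) = (p {v} * y * p {v}) * (p {v} * x * p {v})"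
  proof (rule corner_commute[where C = C and E = E and nx = nx and n = "length c"])
    show "v \<in> C" by fact
    show "0 < length c" using c by simp
    show "(nx ^^ length c) v = v" using pow[of "length c"] pow[of 0] by simp
  qed (use C xy in auto)
  have ve: "p {v} * e = e" using e by (simp add: v_def)
  have "p {v} * (e * x) = e * x" "p {v} * (e * y) = e * y" by (simp_all only: ve mult.assoc[symmetric])
  then have vx: "p {v} * x = x" "p {v} * y = y" using xy by simp_all
  have "x * y * p {v} = y * x * p {v}" using comm by (simp add: vx mult.assoc) (simp add: vx flip: mult.assoc)
  then have "x * y * (p {v} * e) = y * x * (p {v} * e)" by (metis mult.assoc)
  then show False using xy ve by (simp add: mult.assoc)
qed

section \<open>Acyclic ultragraphs\<close>

lemma mons_mono: "F \<subseteq> F' \<Longrightarrow> \<A> \<subseteq> \<A>' \<Longrightarrow> mons F \<A> \<subseteq> mons F' \<A>'"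
  unfolding mons_def edge_path_def by blast

lemma lpa_finite_support:
  "x \<in> lpa \<Longrightarrow> \<exists>F \<A>. finite F \<and> F \<subseteq> edges G \<and> finite \<A> \<and> \<A> \<subseteq> gen_verts G \<and> x \<in> vs.span (mons F \<A>)"
  unfolding lpa_def
proof (induction rule: vs.span_induct_alt)
  case base
  then show ?case by (intro exI[of _ "{}"]) (simp add: vs.span_zero)
next
  case (step c m y)
  then obtain F \<A> where F: "finite F" "F \<subseteq> edges G" "finite \<A>" "\<A> \<subseteq> gen_verts G"
    "y \<in> vs.span (mons F \<A>)" by blast
  obtain \<alpha> A \<beta> where m: "m = mon \<alpha> A \<beta>" "path \<alpha>" "path \<beta>"
    "A \<in> gen_verts G" using step by (auto simp: mons_def)
  let ?F = "F \<union> set \<alpha> \<union> set \<beta>" and ?A = "insert A \<A>"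
  have "m \<in> mons ?F ?A" unfolding m(1) using m by (intro monsI) (auto simp: edge_path_def)
  moreover have "y \<in> vs.span (mons ?F ?A)"
    using F(5) vs.span_mono[OF mons_mono[of F ?F \<A> ?A]] by auto
  ultimately have "sc c * m + y \<in> vs.span (mons ?F ?A)"
    by (intro vs.span_add vs.span_scale) (auto intro: vs.span_base)
  moreover have "finite ?F" "?F \<subseteq> edges G" "finite ?A" "?A \<subseteq> gen_verts G"
    using F m by (auto simp: edge_path_def)
  ultimately show ?case by (intro exI[of _ ?F] exI[of _ ?A] conjI)
qed

text \<open>The element involves finitely many edges and sets.  Closing the sets under intersection
keeps them finite, and without cycles the edges of a path are distinct, so only finitely many monomials occur in
all powers.\<close>

lemma acyclic_finite_dimensional:
  assumes "\<nexists>\<alpha>. is_cycle G \<alpha>" "x \<in> lpa"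
  obtains M where "finite M" "\<And>k. x ^ Suc k \<in> vs.span M"
proof -
  obtain F \<A>0 where F: "finite F" "F \<subseteq> edges G" "finite \<A>0" "\<A>0 \<subseteq> gen_verts G"
    "x \<in> vs.span (mons F \<A>0)" using lpa_finite_support[OF assms(2)] by blast
  define \<A>1 where "\<A>1 = \<A>0 \<union> rng G ` F"
  have \<A>1: "finite \<A>1" "\<A>1 \<subseteq> gen_verts G" using F by (auto simp: \<A>1_def)
  define \<A> where "\<A> = Inter ` (Pow \<A>1 - {{}})"
  have "finite \<A>" using \<A>1 by (simp add: \<A>_def)
  have "\<Inter> S \<in> gen_verts G" if "finite S" "S \<noteq> {}" "S \<subseteq> gen_verts G" for S
    using that by (induction rule: finite_ne_induct) (auto intro: gen_verts.inter)
  then have sub: "\<A> \<subseteq> gen_verts G"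
    using \<A>1 unfolding \<A>_def by (auto dest: finite_subset)
  have inter: "A \<inter> B \<in> \<A>" if AB: "A \<in> \<A>" "B \<in> \<A>" for A B
  proof -
    from AB obtain S T where "A = \<Inter> S" "B = \<Inter> T" "S \<in> Pow \<A>1 - {{}}" "T \<in> Pow \<A>1 - {{}}"
      by (auto simp: \<A>_def)
    then have "A \<inter> B = \<Inter> (S \<union> T)" "S \<union> T \<in> Pow \<A>1 - {{}}" by auto
    then show ?thesis unfolding \<A>_def by blast
  qed
  have \<A>1_sub: "\<A>1 \<subseteq> \<A>"
  proof
    fix A assume "A \<in> \<A>1"
    then have "A = \<Inter> {A}" "{A} \<in> Pow \<A>1 - {{}}" by auto
    then show "A \<in> \<A>" unfolding \<A>_def by blast
  qed
  have rng: "rng G e \<in> \<A>" if "e \<in> F" for e using that \<A>1_sub by (auto simp: \<A>1_def)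
  let ?M = "mons F \<A>"
  have paths: "finite {\<alpha>. edge_path G F \<alpha>}"
  proof (rule finite_subset)
    show "{\<alpha>. edge_path G F \<alpha>} \<subseteq> {\<alpha>. set \<alpha> \<subseteq> F \<and> distinct \<alpha>}"
      using acyclic_distinct[OF assms(1) F(2)] by (auto simp: edge_path_def)
  qed (use F in \<open>simp add: finite_subset_distinct\<close>)
  have "?M = (\<lambda>(\<alpha>, A, \<beta>). mon \<alpha> A \<beta>) ` ({\<alpha>. edge_path G F \<alpha>} \<times> \<A> \<times> {\<alpha>. edge_path G F \<alpha>})"
    by (auto simp: mons_def image_iff) blast
  then have "finite ?M" using paths \<open>finite \<A>\<close> by simp
  have x: "x \<in> vs.span ?M"
    using F(5) vs.span_mono[OF mons_mono[of F F \<A>0 \<A>]] \<A>1_sub by (auto simp: \<A>1_def)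
  have prod: "m * m' \<in> vs.span ?M" if "m \<in> ?M" "m' \<in> ?M" for m m'
    using mons_mult[OF F(2) sub inter rng that] by (auto intro: vs.span_base vs.span_zero)
  have "x ^ Suc k \<in> vs.span ?M" for k
  proof (induction k)
    case (Suc k)
    have "x * x ^ Suc k \<in> vs.span ?M" by (rule span_mult[OF prod x Suc])
    then show ?case by (simp only: power_Suc)
  qed (simp add: x)
  then show thesis using that \<open>finite ?M\<close> by blast
qed

lemma linear_relation:
  fixes f :: "nat \<Rightarrow> 'a"
  assumes "finite M" "\<And>k. f k \<in> vs.span M"
  obtains N c where "(\<Sum>k \<le> N. sc (c k) * f k) = 0" "\<exists>k \<le> N. c k \<noteq> 0"
proof (cases "inj_on f {..card M}")
  case True
  let ?S = "f ` {..card M}"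
  have "card ?S = Suc (card M)" using True by (simp add: card_image)
  then have "vs.dependent ?S"
    using vs.independent_span_bound[OF assms(1), of ?S] assms(2) by auto
  then obtain u where u: "\<exists>v \<in> ?S. u v \<noteq> 0" "(\<Sum>v \<in> ?S. sc (u v) * v) = 0"
    using vs.dependent_finite[of ?S] by auto
  then have "(\<Sum>k \<le> card M. sc (u (f k)) * f k) = 0" using True by (simp add: sum.reindex)
  then show thesis using u(1) by (intro that[of "\<lambda>k. u (f k)" "card M"]) auto
next
  case False
  then obtain i j where ij: "i \<le> card M" "j \<le> card M" "i \<noteq> j" "f i = f j" by (auto simp: inj_on_def)
  define c :: "nat \<Rightarrow> 'k" where "c k = (if k = i then 1 else if k = j then - 1 else 0)" for k
  have "sc (c k) * f k = (if k = i then f i else 0) - (if k = j then f j else 0)" for k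
    using ij by (simp add: c_def sc_one sc_minus)
  then have "(\<Sum>k \<le> card M. sc (c k) * f k) = f i - f j"
    using ij by (simp add: sum_subtractf)
  then show thesis using ij by (intro that[of c "card M"]) (auto simp: c_def)
qed

text \<open>The powers of \<open>x\<close> satisfy a linear relation.  Multiplying it by a power of \<open>y\<close> removes
the lowest power of \<open>x\<close> and leaves \<open>e = x * z\<close>; so the left inverse \<open>y\<close> equals the right inverse \<open>z\<close>.\<close>

theorem acyclic_no_infinite:
  assumes "\<nexists>\<alpha>. is_cycle G \<alpha>" shows "\<not> infinite_in lpa e"
proof
  assume "infinite_in lpa e"
  then obtain x y where xy: "e * e = e" "x \<in> lpa" "y \<in> lpa" "e * x = x" "x * e = x" "e * y = y"
    "y * e = y" "y * x = e" "x * y \<noteq> e" by (auto simp: infinite_in_def)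
  obtain M where M: "finite M" "\<And>k. x ^ Suc k \<in> vs.span M"
    using acyclic_finite_dimensional[OF assms xy(2)] by blast
  obtain c N where rel: "(\<Sum>k \<le> N. sc (c k) * x ^ Suc k) = 0" and nz: "\<exists>k \<le> N. c k \<noteq> 0"
    by (rule linear_relation[of M "\<lambda>k. x ^ Suc k", OF M])
  define j where "j = (LEAST k. k \<le> N \<and> c k \<noteq> 0)"
  have j: "j \<le> N" "c j \<noteq> 0" using LeastI_ex[of "\<lambda>k. k \<le> N \<and> c k \<noteq> 0"] nz by (auto simp: j_def)
  have below: "c k = 0" if "k < j" for k
    using not_less_Least[of k "\<lambda>k. k \<le> N \<and> c k \<noteq> 0"] that j by (auto simp: j_def)
  have cancel: "y ^ Suc k * x ^ Suc k = e" for k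
  proof (induction k)
    case (Suc k)
    have "y ^ Suc (Suc k) * x ^ Suc (Suc k) = y ^ Suc k * (y * x) * x ^ Suc k"
      by (simp only: power_Suc2[of y "Suc k"] power_Suc[of x "Suc k"] mult.assoc)
    also have "\<dots> = y ^ Suc k * (e * x) * x ^ k" by (simp only: xy(8) power_Suc mult.assoc)
    also have "\<dots> = y ^ Suc k * x ^ Suc k" by (simp only: xy(4) power_Suc mult.assoc)
    finally show ?case using Suc by (simp only:)
  qed (simp add: xy)
  have shift: "y ^ Suc j * x ^ Suc k = x * (e * x ^ (k - Suc j))" if "k > j" for k
  proof -
    have "x ^ Suc k = x ^ Suc j * (x * x ^ (k - Suc j))"
      using that by (simp only: power_Suc[symmetric] power_add[symmetric]) simp
    then have "y ^ Suc j * x ^ Suc k = e * x * x ^ (k - Suc j)"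
      using cancel by (metis mult.assoc)
    also have "\<dots> = x * e * x ^ (k - Suc j)" using xy by simp
    finally show ?thesis by (simp add: mult.assoc)
  qed
  define z where "z = (\<Sum>k \<in> {j<..N}. sc (- c k / c j) * (e * x ^ (k - Suc j)))"
  have "0 = y ^ Suc j * (\<Sum>k \<le> N. sc (c k) * x ^ Suc k)" using rel by simp
  also have "\<dots> = (\<Sum>k \<le> N. sc (c k) * (y ^ Suc j * x ^ Suc k))"
    by (simp only: sum_distrib_left mult_sc)
  also have "\<dots> = (\<Sum>k \<in> insert j {j<..N}. sc (c k) * (y ^ Suc j * x ^ Suc k))"
    using j below by (intro sum.mono_neutral_right) (auto simp: not_le)
  also have "\<dots> = sc (c j) * e + (\<Sum>k \<in> {j<..N}. sc (c k) * (x * (e * x ^ (k - Suc j))))"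
  proof -
    have "(\<Sum>k \<in> {j<..N}. sc (c k) * (y ^ Suc j * x ^ Suc k))
        = (\<Sum>k \<in> {j<..N}. sc (c k) * (x * (e * x ^ (k - Suc j))))"
      using shift by (intro sum.cong refl arg_cong[of _ _ "(*) _"]) (simp only: greaterThanAtMost_iff)
    then show ?thesis by (subst sum.insert) (simp_all only: cancel finite_greaterThanAtMost, auto)
  qed
  finally have "sc (- 1 / c j) * (sc (c j) * e + (\<Sum>k \<in> {j<..N}. sc (c k) * (x * (e * x ^ (k - Suc j))))) = 0"
    by simp
  then have "- e + x * z = 0"
    using j by (simp add: z_def distrib_left sum_distrib_left mult_sc[of x] vs.scale_scale sc_minus sc_one
        del: mult.assoc)
  then have xz: "x * z = e" by (simp add: neg_eq_iff_add_eq_0)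
  have ez: "e * z = z"
    using xy by (simp add: z_def sum_distrib_left mult_sc[of e]) (simp flip: mult.assoc add: xy)
  have "y = y * (x * z)" using xz xy by simp
  also have "\<dots> = z" using ez xy by (simp flip: mult.assoc)
  finally show False using xz xy by simp
qed

end

section \<open>Ideals and idempotents of subrings of a ring type\<close>

text \<open>Ring records whose addition is that of a type; the free algebra and the subrings of a ring type
both have this form.\<close>

context
  fixes R :: "('a::ab_group_add, 'm) ring_scheme"
  assumes R: "add R = (+)" "zero R = 0" "0 \<in> carrier R"
    "\<And>x y. x \<in> carrier R \<Longrightarrow> y \<in> carrier R \<Longrightarrow> x + y \<in> carrier R" "\<And>x. x \<in> carrier R \<Longrightarrow> - x \<in> carrier R"
begin

lemma typed_abelian_group: "abelian_group R"
proof (rule abelian_groupI)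
  fix x assume "x \<in> carrier R"
  then show "\<exists>y \<in> carrier R. y \<oplus>\<^bsub>R\<^esub> x = \<zero>\<^bsub>R\<^esub>"
    using R by (intro bexI[of _ "- x"]) auto
qed (auto simp: R add.assoc add.commute)

lemma typed_a_inv: "x \<in> carrier R \<Longrightarrow> \<ominus>\<^bsub>R\<^esub> x = - x"
  using abelian_group.minus_equality[OF typed_abelian_group, of "- x" x] R by simp

lemma typed_additive_subgroup:
  "additive_subgroup I R \<longleftrightarrow> I \<subseteq> carrier R \<and> 0 \<in> I \<and> (\<forall>x \<in> I. \<forall>y \<in> I. x + y \<in> I) \<and> (\<forall>x \<in> I. - x \<in> I)"
proof -
  have "I \<subseteq> carrier R \<Longrightarrow> x \<in> I \<Longrightarrow> inv\<^bsub>add_monoid R\<^esub> x = - x" for x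
    using typed_a_inv[of x] by (auto simp: a_inv_def)
  then show ?thesis unfolding additive_subgroup_def by (auto simp: subgroup_def R)
qed

end

definition ring_on :: "'a::ring set \<Rightarrow> 'a ring" where
  "ring_on S = \<lparr>carrier = S, mult = (*), one = undefined, zero = 0, add = (+)\<rparr>"

lemma ring_on_simps [simp]:
  "carrier (ring_on S) = S" "x \<otimes>\<^bsub>ring_on S\<^esub> y = x * y" "x \<oplus>\<^bsub>ring_on S\<^esub> y = x + y" "\<zero>\<^bsub>ring_on S\<^esub> = 0"
  by (simp_all add: ring_on_def)

lemma set_add_ring_on: "A <+>\<^bsub>ring_on S\<^esub> B = {a + b | a b. a \<in> A \<and> b \<in> B}"
  by (auto simp: set_add_def set_mult_def)

locale subring_type =
  fixes S :: "'a::ring set"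
  assumes zero: "0 \<in> S" and add: "\<And>x y. x \<in> S \<Longrightarrow> y \<in> S \<Longrightarrow> x + y \<in> S"
    and neg: "\<And>x. x \<in> S \<Longrightarrow> - x \<in> S" and mult: "\<And>x y. x \<in> S \<Longrightarrow> y \<in> S \<Longrightarrow> x * y \<in> S"
begin

lemma diff: "x \<in> S \<Longrightarrow> y \<in> S \<Longrightarrow> x - y \<in> S"
  using add[of x "- y"] neg by simp

lemma abelian_group_ring_on: "abelian_group (ring_on S)"
  by (rule typed_abelian_group) (auto simp: ring_on_def zero add neg)

lemma right_ideal_iff:
  "right_ideal (ring_on S) I \<longleftrightarrow> I \<subseteq> S \<and> 0 \<in> I \<and> (\<forall>x \<in> I. \<forall>y \<in> I. x + y \<in> I) \<and> (\<forall>x \<in> I. - x \<in> I) \<and>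
     (\<forall>a \<in> I. \<forall>x \<in> S. a * x \<in> I)"
proof -
  have "additive_subgroup I (ring_on S) \<longleftrightarrow> I \<subseteq> carrier (ring_on S) \<and> 0 \<in> I \<and>
      (\<forall>x \<in> I. \<forall>y \<in> I. x + y \<in> I) \<and> (\<forall>x \<in> I. - x \<in> I)"
    by (rule typed_additive_subgroup) (auto simp: ring_on_def zero add neg)
  then show ?thesis unfolding right_ideal_def by auto
qed

lemma right_ideal_mult: "g \<in> S \<Longrightarrow> right_ideal (ring_on S) ((\<lambda>z. g * z) ` S)"
  unfolding right_ideal_iff
proof (intro conjI ballI)
  assume g: "g \<in> S"
  show "(\<lambda>z. g * z) ` S \<subseteq> S" using g mult by auto
  show "0 \<in> (\<lambda>z. g * z) ` S" using zero by (intro image_eqI[of _ _ 0]) auto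
  fix x assume "x \<in> (\<lambda>z. g * z) ` S"
  then obtain a where a: "a \<in> S" "x = g * a" by blast
  show "- x \<in> (\<lambda>z. g * z) ` S" using a neg by (intro image_eqI[of _ _ "- a"]) auto
  show "x * y \<in> (\<lambda>z. g * z) ` S" if "y \<in> S" for y
    using that a mult by (intro image_eqI[of _ _ "a * y"]) (auto simp: mult.assoc)
  fix y assume "y \<in> (\<lambda>z. g * z) ` S"
  then obtain b where b: "b \<in> S" "y = g * b" by blast
  then show "x + y \<in> (\<lambda>z. g * z) ` S"
    using a add by (intro image_eqI[of _ _ "a + b"]) (auto simp: distrib_left)
qed

text \<open>With \<open>f = x * y\<close>, the right ideal \<open>e S\<close> is the direct sum of \<open>f S\<close> and \<open>(e - f) S\<close>, and left
multiplication by \<open>x\<close> maps it onto \<open>f S\<close>, with inverse left multiplication by \<open>y\<close>.\<close>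

lemma infinite_idempotent_if:
  assumes "infinite_in S e" shows "infinite_idempotent (ring_on S) e"
proof -
  obtain x y where e: "e \<in> S" "e * e = e" and xy: "x \<in> S" "y \<in> S" "e * x = x" "x * e = x"
    "e * y = y" "y * e = y" "y * x = e" "x * y \<noteq> e"
    using assms by (auto simp: infinite_in_def)
  let ?f = "x * y"
  have ff: "?f * ?f = ?f" "e * ?f = ?f" "?f * e = ?f" "?f \<in> S"
    using xy by (metis mult.assoc mult)+
  let ?eS = "(\<lambda>z. e * z) ` S" and ?M = "(\<lambda>z. ?f * z) ` S" and ?N = "(\<lambda>z. (e - ?f) * z) ` S"
  have fe: "?f * ((e - ?f) * z) = 0" "(e - ?f) * (?f * z) = 0" for z
    using ff by (simp_all add: right_diff_distrib left_diff_distrib flip: mult.assoc)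
  have sum: "?M <+>\<^bsub>ring_on S\<^esub> ?N = ?eS"
  proof
    show "?eS \<subseteq> ?M <+>\<^bsub>ring_on S\<^esub> ?N"
    proof
      fix w assume "w \<in> ?eS"
      then obtain z where z: "z \<in> S" "w = e * z" by blast
      then have "w = ?f * z + (e - ?f) * z" by (simp add: left_diff_distrib)
      then show "w \<in> ?M <+>\<^bsub>ring_on S\<^esub> ?N" using z unfolding set_add_ring_on by blast
    qed
    show "?M <+>\<^bsub>ring_on S\<^esub> ?N \<subseteq> ?eS"
    proof
      fix w assume "w \<in> ?M <+>\<^bsub>ring_on S\<^esub> ?N"
      then obtain a b where "a \<in> S" "b \<in> S" and w: "w = ?f * a + (e - ?f) * b"
        unfolding set_add_ring_on by blast
      moreover have "w = e * (?f * a + (e - ?f) * b)"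
        unfolding w using e(2) ff by (simp add: distrib_left right_diff_distrib left_diff_distrib flip: mult.assoc)
      moreover have "?f * a + (e - ?f) * b \<in> S" using calculation(1,2) ff(4) e xy(1,2) by (intro add mult diff)
      ultimately show "w \<in> ?eS" by (metis imageI)
    qed
  qed
  have int: "?M \<inter> ?N = {0}"
  proof -
    have "w = 0" if w: "w \<in> ?M" "w \<in> ?N" for w
    proof -
      from w obtain a b where "w = ?f * a" "w = (e - ?f) * b" by blast
      then have "w = ?f * w" using ff by (simp flip: mult.assoc)
      then show "w = 0" using fe(1)[of b] \<open>w = (e - ?f) * b\<close> by simp
    qed
    moreover have "0 \<in> ?M" "0 \<in> ?N" using zero by (force intro: image_eqI[of _ _ 0])+
    ultimately show ?thesis by blast
  qed
  have summand: "direct_summand (ring_on S) ?M ?eS"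
    unfolding direct_summand_def using right_ideal_mult[OF ff(4)] right_ideal_mult[OF diff[OF e(1) ff(4)]] sum int by auto
  have ne: "?M \<noteq> ?eS"
  proof
    assume "?M = ?eS"
    then have "e \<in> ?M" using e by (metis imageI)
    then obtain z where "e = ?f * z" by blast
    then have "?f * e = e" using ff by (simp flip: mult.assoc)
    then show False using ff xy by simp
  qed
  have "bij_betw (\<lambda>z. x * z) ?eS ?M"
  proof (rule bij_betwI[where g = "\<lambda>z. y * z"])
    show "(\<lambda>z. x * z) \<in> ?eS \<rightarrow> ?M"
    proof
      fix w assume "w \<in> ?eS"
      then obtain z where z: "z \<in> S" "w = e * z" by blast
      then have "x * w = ?f * (x * z)" using xy by (metis mult.assoc)
      then show "x * w \<in> ?M" using z xy mult by blast
    qed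
    show "(\<lambda>z. y * z) \<in> ?M \<rightarrow> ?eS"
    proof
      fix w assume "w \<in> ?M"
      then obtain z where z: "z \<in> S" "w = ?f * z" by blast
      then have "y * w = e * (y * z)" using xy by (metis mult.assoc)
      then show "y * w \<in> ?eS" using z xy mult by blast
    qed
    show "y * (x * w) = w" if "w \<in> ?eS" for w
      using that e xy by (auto simp flip: mult.assoc)
    show "x * (y * w) = w" if "w \<in> ?M" for w
      using that ff by (auto simp flip: mult.assoc)
  qed
  then have "right_iso (ring_on S) ?eS ?M"
    unfolding right_iso_def by (intro exI[of _ "\<lambda>z. x * z"]) (auto simp: distrib_left mult.assoc)
  then show ?thesis using summand ne e
    unfolding infinite_idempotent_def idempotent_def Let_def by auto
qed

text \<open>Let \<open>e S\<close> be the direct sum of \<open>M\<close> and \<open>N\<close>, and let \<open>m\<close> be the component of \<open>e\<close> in \<open>M\<close>, a left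
identity of \<open>M\<close>.  For an isomorphism \<open>\<phi>\<close> from \<open>e S\<close> to \<open>M\<close>, the elements \<open>x = \<phi> e\<close> and the preimage
\<open>y\<close> of \<open>m\<close> satisfy \<open>x * y = m\<close> and \<open>y * x = e\<close>.\<close>

lemma infinite_in_if:
  assumes "infinite_idempotent (ring_on S) e" shows "infinite_in S e"
proof -
  let ?eS = "(\<lambda>z. e * z) ` S"
  from assms obtain M where e: "e \<in> S" "e * e = e" and M: "direct_summand (ring_on S) M ?eS" "M \<noteq> ?eS"
    and iso: "right_iso (ring_on S) ?eS M"
    unfolding infinite_idempotent_def idempotent_def Let_def by auto
  from M obtain N where M': "right_ideal (ring_on S) M" and N: "right_ideal (ring_on S) N"
    and sum: "M <+>\<^bsub>ring_on S\<^esub> N = ?eS" and int: "M \<inter> N = {0}"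
    unfolding direct_summand_def by auto
  from iso obtain \<phi> where bij: "bij_betw \<phi> ?eS M" and "\<forall>x \<in> ?eS. \<forall>r \<in> S. \<phi> (x * r) = \<phi> x * r"
    unfolding right_iso_def ring_on_simps by (elim exE conjE)
  then have \<phi>: "\<phi> (x * r) = \<phi> x * r" if "x \<in> ?eS" "r \<in> S" for x r
    using that by (elim ballE) auto
  have MN: "M \<subseteq> S" "N \<subseteq> S" "0 \<in> M" "0 \<in> N" "\<And>a x. a \<in> M \<Longrightarrow> x \<in> S \<Longrightarrow> a * x \<in> M"
    "\<And>a x. a \<in> N \<Longrightarrow> x \<in> S \<Longrightarrow> a * x \<in> N" "\<And>a b. a \<in> M \<Longrightarrow> b \<in> M \<Longrightarrow> a + b \<in> M"
    "\<And>a. a \<in> M \<Longrightarrow> - a \<in> M"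
    using M' N by (auto simp: right_ideal_iff)
  have eS: "e \<in> ?eS" "\<And>z. z \<in> ?eS \<Longrightarrow> e * z = z" "?eS \<subseteq> S"
  proof -
    show "e \<in> ?eS" using e by (intro image_eqI[of _ _ e]) auto
    show "e * z = z" if "z \<in> ?eS" for z using that e(2) by (auto simp flip: mult.assoc)
    show "?eS \<subseteq> S" using e(1) mult by auto
  qed
  have M_eS: "M \<subseteq> ?eS"
  proof
    fix m assume "m \<in> M"
    then have "m + 0 \<in> M <+>\<^bsub>ring_on S\<^esub> N" using MN unfolding set_add_ring_on by blast
    then show "m \<in> ?eS" using sum by simp
  qed
  obtain m n where mn: "m \<in> M" "n \<in> N" "e = m + n" using eS(1) unfolding sum[symmetric] set_add_ring_on by blast
  have m_mult: "m * z = z" if z: "z \<in> M" for z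
  proof -
    have "z \<in> S" using z MN by auto
    have "e * z = z" using eS(2) subsetD[OF M_eS z] by blast
    then have "m * z + n * z = z" unfolding mn(3) by (simp only: distrib_right)
    then have "n * z = z - m * z" by (simp add: algebra_simps)
    moreover have "z - m * z \<in> M" using MN(7)[OF z MN(8)[OF MN(5)[OF mn(1) \<open>z \<in> S\<close>]]] by simp
    moreover have "n * z \<in> N" using MN(6)[OF mn(2) \<open>z \<in> S\<close>] .
    ultimately have "z - m * z \<in> M \<inter> N" by simp
    then show ?thesis unfolding int by simp
  qed
  define x where "x = \<phi> e"
  have x: "x \<in> M" "x * e = x"
    unfolding x_def using bspec[OF bij_betwE[OF bij] eS(1)] \<phi>[OF eS(1) e(1)] by (simp_all only: e(2))
  obtain y where y: "y \<in> ?eS" "\<phi> y = m"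
    using bij_betw_imp_surj_on[OF bij] mn(1) by blast
  have S: "x \<in> S" "y \<in> S" "m \<in> S" using x(1) y(1) mn(1) MN(1) eS(3) by blast+
  have ey: "e * y = y" using eS(2)[OF y(1)] .
  have xye: "x * (y * e) = m * e"
  proof -
    have "x * y = \<phi> (e * y)" unfolding x_def using \<phi>[OF eS(1) S(2)] by simp
    then have "x * y = m" by (simp only: ey y(2))
    then show ?thesis by (simp only: mult.assoc[symmetric])
  qed
  have ex: "e * x = x" using eS(2) subsetD[OF M_eS x(1)] by blast
  have yx: "(y * e) * x = e"
  proof -
    have "\<phi> (y * x) = m * x" using \<phi>[OF y(1) S(1)] y by simp
    also have "\<dots> = \<phi> e" using m_mult x by (simp add: x_def)
    finally have "\<phi> (y * x) = \<phi> e" .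
    moreover have "y * x = e * (y * x)" by (simp only: ey mult.assoc[symmetric])
    then have "y * x \<in> ?eS" using mult[OF S(2,1)] by (rule image_eqI)
    ultimately have "y * x = e" using bij_betw_imp_inj_on[OF bij] eS(1) by (meson inj_onD)
    then show ?thesis using ex by (simp add: mult.assoc)
  qed
  have "x * (y * e) \<noteq> e"
  proof
    assume "x * (y * e) = e"
    then have "m * e = e" using xye by simp
    then have "e \<in> M" using MN(5)[OF mn(1) e(1)] by simp
    then have "?eS \<subseteq> M" using MN(5) by blast
    then show False using M(2) M_eS by blast
  qed
  moreover have "e * x = x" "e * (y * e) = y * e" "y * e * e = y * e"
    using ex ey e(2) by (simp_all only: mult.assoc[symmetric]) (simp only: e(2) mult.assoc)
  ultimately show ?thesis
    unfolding infinite_in_def using e x yx S mult by blast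
qed

lemma infinite_idempotent_iff: "infinite_idempotent (ring_on S) e \<longleftrightarrow> infinite_in S e"
  using infinite_in_if infinite_idempotent_if by blast

end

section \<open>Simplicity, and the characterization for Leavitt families\<close>

text \<open>The sets disjoint from \<open>C\<close>, the vertices connecting to the cycle, form a hereditary family since \<open>C\<close> is
closed under going backwards along edges, and a saturated one since every vertex of \<open>C\<close> emits an edge whose
range meets \<open>C\<close>.  It contains no vertex of the cycle, so it is not the whole lattice, and being trivial it is \<open>{{}}\<close>.\<close>

lemma (in ultragraph) all_connect_to_cycle:
  assumes trivial: "\<And>H. hereditary G H \<Longrightarrow> saturated G H \<Longrightarrow> H = {} \<or> H = {{}} \<or> H = gen_verts G"
    and cyc: "is_cycle G \<alpha>" and w: "w \<in> verts G"
  shows "connects_to_cycle G w \<alpha>"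
proof -
  define C where "C = {v. connects_to_cycle G v \<alpha>}"
  define H where "H = {A \<in> gen_verts G. A \<inter> C = {}}"
  have \<alpha>: "\<alpha> \<noteq> []" "path \<alpha>" "src G (hd \<alpha>) \<in> rng G (last \<alpha>)"
    using cyc by (auto simp: is_cycle_iff_edge_path)
  have on_cycle: "v \<in> C" if "i < length \<alpha>" "v = src G (\<alpha> ! i)" "v \<in> verts G" for i v
    using that unfolding C_def connects_to_cycle_def
    by (intro CollectI exI[of _ "Trivial_Path {v}"]) (auto intro: gen_verts.vertex)
  have step: "src G e \<in> C" if e: "e \<in> edges G" "v \<in> rng G e" "v \<in> C" for e v
  proof -
    from e obtain \<beta> i where \<beta>: "is_path G \<beta>" "path_src G \<beta> = {v}" "i < length \<alpha>"
      "src G (\<alpha> ! i) \<in> path_rng G \<beta>" by (auto simp: C_def connects_to_cycle_def)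
    show ?thesis
    proof (cases \<beta>)
      case (Trivial_Path A)
      then show ?thesis using \<beta> e unfolding C_def connects_to_cycle_def
        by (intro CollectI exI[of _ "Edge_Path [e]"]) auto
    next
      case (Edge_Path es)
      then have "path es" "es \<noteq> []" "src G (hd es) = v"
        using \<beta> is_path_iff_edge_path[of G es] by auto
      then have "is_path G (Edge_Path (e # es))"
        using e unfolding is_path_iff_edge_path by (simp add: edge_path_Cons)
      then show ?thesis using \<beta> Edge_Path \<open>es \<noteq> []\<close> unfolding C_def connects_to_cycle_def
        by (intro CollectI exI[of _ "Edge_Path (e # es)"]) auto
    qed
  qed
  have leave: "\<exists>e \<in> out_edges G v. rng G e \<inter> C \<noteq> {}" if v: "v \<in> C" "v \<in> verts G" for v
  proof -
    from v obtain \<beta> i where \<beta>: "is_path G \<beta>" "path_src G \<beta> = {v}" "i < length \<alpha>"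
      "src G (\<alpha> ! i) \<in> path_rng G \<beta>" by (auto simp: C_def connects_to_cycle_def)
    have in_edges: "\<alpha> ! j \<in> edges G" if "j < length \<alpha>" for j
      using \<alpha>(2) that by (auto simp: edge_path_def)
    show ?thesis
    proof (cases \<beta>)
      case (Trivial_Path A)
      then have src: "src G (\<alpha> ! i) = v" using \<beta> by simp
      define j where "j = (if Suc i < length \<alpha> then Suc i else 0)"
      have j: "j < length \<alpha>" "src G (\<alpha> ! j) \<in> rng G (\<alpha> ! i)"
      proof -
        show "j < length \<alpha>" using \<alpha>(1) by (auto simp: j_def)
        show "src G (\<alpha> ! j) \<in> rng G (\<alpha> ! i)"
        proof (cases "Suc i < length \<alpha>")
          case True
          then show ?thesis using \<alpha>(2) by (simp add: j_def edge_path_def successively_conv_nth)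
        next
          case False
          then have "i = length \<alpha> - 1" using \<beta>(3) by simp
          then show ?thesis using \<alpha> False by (simp add: j_def last_conv_nth hd_conv_nth)
        qed
      qed
      have "src G (\<alpha> ! j) \<in> C" using on_cycle[OF j(1) refl] in_edges[OF j(1)] src_in_verts by auto
      then show ?thesis using j src in_edges[OF \<beta>(3)]
        by (intro bexI[of _ "\<alpha> ! i"]) (auto simp: out_edges_def)
    next
      case (Edge_Path es)
      then have es: "path es" "es \<noteq> []" "src G (hd es) = v"
        using \<beta> is_path_iff_edge_path[of G es] by auto
      then obtain e es' where es': "es = e # es'" by (cases es) auto
      have e: "e \<in> out_edges G v" using es es' by (auto simp: out_edges_def edge_path_Cons)
      show ?thesis
      proof (cases "es' = []")
        case True
        then have "src G (\<alpha> ! i) \<in> rng G e" using \<beta> Edge_Path es' by simp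
        moreover have "src G (\<alpha> ! i) \<in> C"
          using on_cycle[OF \<beta>(3) refl] in_edges[OF \<beta>(3)] src_in_verts by auto
        ultimately show ?thesis using e by blast
      next
        case False
        then have "src G (hd es') \<in> rng G e" "is_path G (Edge_Path es')"
          using es es' unfolding is_path_iff_edge_path by (auto simp: edge_path_Cons)
        moreover from this(2) have "src G (hd es') \<in> C"
          using \<beta> Edge_Path False es' unfolding C_def connects_to_cycle_def
          by (intro CollectI exI[of _ "Edge_Path es'"]) auto
        ultimately show ?thesis using e by blast
      qed
    qed
  qed
  have "hereditary G H"
    using step by (auto simp: hereditary_def H_def intro: gen_verts.range gen_verts.union)
  moreover have "saturated G H"
  proof -
    have "{v} \<in> H" if "regular_vertex G v" "rng G ` out_edges G v \<subseteq> H" for v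
    proof -
      have "v \<in> verts G" using that by (simp add: regular_vertex_def)
      moreover have "v \<notin> C" using leave[of v] that calculation by (auto simp: H_def)
      ultimately show ?thesis by (simp add: H_def gen_verts.vertex)
    qed
    then show ?thesis by (simp add: saturated_def)
  qed
  moreover have "H \<noteq> {}" using gen_verts.empty by (auto simp: H_def)
  moreover have "H \<noteq> gen_verts G"
  proof -
    have "hd \<alpha> \<in> edges G" using \<alpha> by (auto simp: edge_path_def)
    then have v: "src G (hd \<alpha>) \<in> verts G" by (rule src_in_verts)
    then have "src G (hd \<alpha>) \<in> C" using on_cycle[of 0] \<alpha>(1) by (simp add: hd_conv_nth)
    then have "{src G (hd \<alpha>)} \<notin> H" by (simp add: H_def)
    then show ?thesis using gen_verts.vertex[OF v] by auto
  qed
  ultimately have "H = {{}}" using trivial by blast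
  then have "{w} \<notin> H" by simp
  then show ?thesis using gen_verts.vertex[OF w] by (auto simp: H_def C_def)
qed

context leavitt_family
begin

sublocale lpa: subring_type lpa
  by unfold_locales (auto intro: lpa_closed lpa_mult)

lemma two_sided_ideal_iff:
  "two_sided_ideal (ring_on lpa) I \<longleftrightarrow> right_ideal (ring_on lpa) I \<and> (\<forall>a \<in> I. \<forall>x \<in> lpa. x * a \<in> I)"
  by (simp add: two_sided_ideal_def)

text \<open>By reduction the ideal contains some \<open>p {v}\<close>, so the family of all \<open>A\<close> with \<open>p A\<close> in the ideal is not
trivial.\<close>

lemma ideal_is_all:
  assumes trivial: "\<And>H. hereditary G H \<Longrightarrow> saturated G H \<Longrightarrow> H = {} \<or> H = {{}} \<or> H = gen_verts G"
    and exits: "\<And>\<alpha>. is_cycle G \<alpha> \<Longrightarrow> has_exit G \<alpha>"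
    and I: "two_sided_ideal (ring_on lpa) I" "I \<noteq> {0}"
  shows "I = lpa"
proof -
  have I': "I \<subseteq> lpa" "0 \<in> I" "\<And>x y. x \<in> I \<Longrightarrow> y \<in> I \<Longrightarrow> x + y \<in> I" "\<And>x. x \<in> I \<Longrightarrow> - x \<in> I"
    "\<And>a x. a \<in> I \<Longrightarrow> x \<in> lpa \<Longrightarrow> a * x \<in> I" "\<And>a x. a \<in> I \<Longrightarrow> x \<in> lpa \<Longrightarrow> x * a \<in> I"
    using I(1) by (auto simp: two_sided_ideal_iff lpa.right_ideal_iff)
  obtain a where a: "a \<in> I" "a \<noteq> 0" using I(2) I'(2) by blast
  then obtain x y v where "x \<in> lpa" "y \<in> lpa" "v \<in> verts G" "x * a * y = p {v}"
    using nonzero_reducible[OF exits, of a] I'(1) by (auto simp: reducible_def)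
  then have v: "p {v} \<in> I" "v \<in> verts G" using I'(5,6) a by metis+
  define H where "H = {A \<in> gen_verts G. p A \<in> I}"
  have "hereditary G H"
    unfolding hereditary_def
  proof (intro conjI ballI impI)
    show "H \<subseteq> gen_verts G" by (auto simp: H_def)
  next
    fix e assume e: "e \<in> edges G" "{src G e} \<in> H"
    then have "t e * p {src G e} * s e \<in> I" using I' s_in_lpa t_in_lpa by (simp add: H_def)
    then show "rng G e \<in> H" using e by (simp add: H_def t_p t_s)
  next
    fix A B assume A: "A \<in> H" "B \<in> H"
    then have "p A \<in> I" "p B \<in> I" by (auto simp: H_def)
    then have "p A + p B + - (p A * p B) \<in> I" using I' by (meson subsetD)
    then show "A \<union> B \<in> H" using A by (simp add: H_def p_mult p_union gen_verts.union)
  next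
    fix A B assume A: "A \<in> H" "B \<in> gen_verts G" "B \<subseteq> A"
    then have "p A * p B \<in> I" using I' p_in_lpa by (auto simp: H_def)
    moreover have "A \<inter> B = B" using A by blast
    ultimately show "B \<in> H" using A by (simp add: H_def p_mult)
  qed
  moreover have "saturated G H"
    unfolding saturated_def
  proof (intro allI impI)
    fix w assume w: "regular_vertex G w" "rng G ` out_edges G w \<subseteq> H"
    have "s e * t e \<in> I" if "e \<in> out_edges G w" for e
    proof -
      have e: "e \<in> edges G" "p (rng G e) \<in> I" using that w by (auto simp: out_edges_def H_def)
      then have "s e * p (rng G e) * t e \<in> I" using I' s_in_lpa t_in_lpa by auto
      then show ?thesis using e by (simp add: s_p)
    qed
    then have "(\<Sum>e \<in> F. s e * t e) \<in> I" if "F \<subseteq> out_edges G w" for F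
      using that by (induction F rule: infinite_finite_induct) (auto simp: I')
    then have "p {w} \<in> I" by (simp add: p_regular[OF w(1)])
    then show "{w} \<in> H" using w by (simp add: H_def gen_verts.vertex regular_vertex_def)
  qed
  moreover have "{v} \<in> H" using v by (simp add: H_def gen_verts.vertex)
  ultimately have H: "H = gen_verts G" using trivial[of H] by auto
  have mon: "sc c * m \<in> I" if m: "m \<in> mons (edges G) (gen_verts G)" for c m
  proof -
    from m obtain \<alpha> A \<beta> where m: "m = mon \<alpha> A \<beta>" "path \<alpha>" "path \<beta>"
      "A \<in> gen_verts G" by (auto simp: mons_def)
    then have "p A \<in> I" using H by (auto simp: H_def)
    moreover have "sc c * (sw \<alpha> * p A) \<in> lpa" "p A * tw \<beta> \<in> lpa"
      using m by (auto intro!: lpa_closed sw_mult_in_lpa mult_tw_in_lpa p_in_lpa simp: edge_path_def)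
    ultimately have "sc c * (sw \<alpha> * p A) * p A * (p A * tw \<beta>) \<in> I" using I' by auto
    \<comment> \<open>Writing \<open>p A\<close> three times keeps both outer factors inside the algebra.\<close>
    moreover have "sc c * (sw \<alpha> * p A) * p A * (p A * tw \<beta>) = sc c * m"
      using m by (simp add: mon_def mult.assoc p_mult_left)
    ultimately show ?thesis by simp
  qed
  have "x \<in> I" if "x \<in> lpa" for x
    using that unfolding lpa_def
    by (induction rule: vs.span_induct_alt) (use mon I' in auto)
  then show ?thesis using I' by auto
qed

lemma trivial_if_simple:
  assumes simple: "simple_ring (ring_on lpa)" and H: "hereditary G H" "saturated G H"
  shows "H = {} \<or> H = {{}} \<or> H = gen_verts G"
proof (cases "H = {}")
  case False
  have H_sub: "H \<subseteq> gen_verts G" and down: "\<And>A B. A \<in> H \<Longrightarrow> B \<in> gen_verts G \<Longrightarrow> B \<subseteq> A \<Longrightarrow> B \<in> H"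
    using H(1) by (auto simp: hereditary_def)
  have "{} \<in> H" using False down gen_verts.empty by blast
  then obtain J where J: "0 \<in> J" "\<And>x y. x \<in> J \<Longrightarrow> y \<in> J \<Longrightarrow> x + y \<in> J" "\<And>x c. x \<in> J \<Longrightarrow> sc c * x \<in> J"
    and gen: "\<And>x g. x \<in> J \<Longrightarrow> g \<in> p ` gen_verts G \<union> s ` edges G \<union> t ` edges G \<Longrightarrow> g * x \<in> J \<and> x * g \<in> J"
    and JH: "\<And>A. A \<in> gen_verts G \<Longrightarrow> p A \<in> J \<longleftrightarrow> A \<in> H"
    using quotient_ideal[OF H] by metis
  have sw: "sw \<alpha> * x \<in> J \<and> x * sw \<alpha> \<in> J" if "set \<alpha> \<subseteq> edges G" "x \<in> J" for \<alpha> x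
    using that
  proof (induction \<alpha> arbitrary: x)
    case (Cons e \<alpha>)
    have "sw \<alpha> * x \<in> J" using Cons by auto
    then have "s e * (sw \<alpha> * x) \<in> J" using Cons.prems gen[of "sw \<alpha> * x" "s e"] by auto
    moreover have "x * s e \<in> J" using Cons.prems gen[of x "s e"] by auto
    then have "(x * s e) * sw \<alpha> \<in> J" using Cons by auto
    ultimately show ?case by (simp add: mult.assoc)
  qed auto
  have tw: "tw \<alpha> * x \<in> J \<and> x * tw \<alpha> \<in> J" if "set \<alpha> \<subseteq> edges G" "x \<in> J" for \<alpha> x
    using that
  proof (induction \<alpha> arbitrary: x)
    case (Cons e \<alpha>)
    have "t e * x \<in> J" using Cons.prems gen[of x "t e"] by auto
    then have "tw \<alpha> * (t e * x) \<in> J" using Cons by auto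
    moreover have "x * tw \<alpha> \<in> J" using Cons by auto
    then have "(x * tw \<alpha>) * t e \<in> J" using Cons.prems gen[of "x * tw \<alpha>" "t e"] by auto
    ultimately show ?case by (simp add: mult.assoc)
  qed auto
  have mon: "m * x \<in> J \<and> x * m \<in> J" if m: "m \<in> mons (edges G) (gen_verts G)" and x: "x \<in> J" for m x
  proof -
    from m obtain \<alpha> A \<beta> where m: "m = mon \<alpha> A \<beta>" "set \<alpha> \<subseteq> edges G" "set \<beta> \<subseteq> edges G" "A \<in> gen_verts G"
      by (auto simp: mons_def edge_path_def)
    have "sw \<alpha> * (p A * (tw \<beta> * x)) \<in> J" "((x * sw \<alpha>) * p A) * tw \<beta> \<in> J"
      using sw tw gen m x by blast+
    then show ?thesis by (simp add: m(1) mon_def mult.assoc)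
  qed
  have ideal: "y * x \<in> J \<and> x * y \<in> J" if x: "x \<in> J" and y: "y \<in> lpa" for x y
    using y unfolding lpa_def
  proof (induction rule: vs.span_induct_alt)
    case (step c m y)
    then show ?case using mon[OF _ x, of m] J
      by (auto simp: distrib_left distrib_right mult.assoc mult_sc)
  qed (use J in auto)
  have "- x \<in> J" if "x \<in> J" for x using J(3)[OF that, of "- 1"] by (simp add: sc_minus sc_one)
  then have "two_sided_ideal (ring_on lpa) (J \<inter> lpa)"
    unfolding two_sided_ideal_iff lpa.right_ideal_iff
    using J ideal lpa.zero lpa.add lpa.neg lpa.mult by auto
  then consider "J \<inter> lpa = {0}" | "J \<inter> lpa = lpa" using simple by (auto simp: simple_ring_def)
  then show ?thesis
  proof cases
    case 1
    have "A = {}" if A: "A \<in> H" for A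
    proof -
      have "p A \<in> J \<inter> lpa" using A JH H_sub p_in_lpa by auto
      then have "p A = 0" using 1 by simp
      then show ?thesis using p_nonzero[of A] gen_verts_subset[of A] A H_sub by blast
    qed
    then show ?thesis using False by blast
  next
    case 2
    then have "A \<in> H" if "A \<in> gen_verts G" for A using JH[OF that] p_in_lpa[OF that] by auto
    then show ?thesis using H_sub by blast
  qed
qed simp

lemma purely_infinite_vertex:
  assumes "purely_infinite (ring_on lpa)" "v \<in> verts G"
  shows "\<exists>e. infinite_in lpa e \<and> p {v} * e = e"
proof -
  let ?I = "(\<lambda>z. p {v} * z) ` lpa"
  have pp: "p {v} * p {v} = p {v}" using assms by (simp add: p_idem gen_verts.vertex)
  then have "p {v} \<in> ?I" using p_vertex_in_lpa[OF assms(2)] by (metis imageI)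
  then have "?I \<noteq> {0}" using p_vertex_nonzero[OF assms(2)] by blast
  moreover have "right_ideal (ring_on lpa) ?I"
    using assms(2) by (intro lpa.right_ideal_mult p_vertex_in_lpa)
  ultimately obtain e where "e \<in> ?I" "infinite_in lpa e"
    using assms(1) unfolding purely_infinite_def lpa.infinite_idempotent_iff ring_on_simps by blast
  moreover from this(1) have "p {v} * e = e" using pp by (auto simp flip: mult.assoc)
  ultimately show ?thesis by blast
qed

theorem purely_infinite_simple_iff:
  assumes "verts G \<noteq> {}"
  shows "purely_infinite_simple (ring_on lpa) \<longleftrightarrow>
     (\<forall>H. hereditary G H \<and> saturated G H \<longrightarrow> H = {} \<or> H = {{}} \<or> H = gen_verts G) \<and>
     (\<forall>\<alpha>. is_cycle G \<alpha> \<longrightarrow> has_exit G \<alpha>) \<and> (\<exists>\<alpha>. is_cycle G \<alpha>)" (is "?L \<longleftrightarrow> ?R")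
proof
  assume L: ?L
  have "has_exit G \<alpha>" if "is_cycle G \<alpha>" for \<alpha>
  proof (rule ccontr)
    assume no: "\<not> has_exit G \<alpha>"
    have "hd \<alpha> \<in> edges G" using that by (auto simp: is_cycle_iff_edge_path edge_path_def)
    then obtain e where "infinite_in lpa e" "p {src G (hd \<alpha>)} * e = e"
      using L purely_infinite_vertex src_in_verts by (auto simp: purely_infinite_simple_def)
    then show False using exitless_cycle_no_infinite[OF that no] by blast
  qed
  moreover have "\<exists>\<alpha>. is_cycle G \<alpha>"
    using acyclic_no_infinite purely_infinite_vertex L assms by (auto simp: purely_infinite_simple_def)
  ultimately show ?R using trivial_if_simple L by (auto simp: purely_infinite_simple_def)
next
  assume R: ?R
  then have trivial: "\<And>H. hereditary G H \<Longrightarrow> saturated G H \<Longrightarrow> H = {} \<or> H = {{}} \<or> H = gen_verts G"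
    and exits: "\<And>\<alpha>. is_cycle G \<alpha> \<Longrightarrow> has_exit G \<alpha>" by blast+
  from R obtain \<alpha> where \<alpha>: "is_cycle G \<alpha>" by blast
  have conn: "\<exists>\<alpha>. is_cycle G \<alpha> \<and> connects_to_cycle G w \<alpha>" if "w \<in> verts G" for w
    using all_connect_to_cycle[OF trivial \<alpha> that] \<alpha> by blast
  obtain v where v: "v \<in> verts G" using assms by blast
  have "p {v} * p {v} \<noteq> 0" using v p_vertex_nonzero by (simp add: p_idem gen_verts.vertex)
  then have "simple_ring (ring_on lpa)"
    unfolding simple_ring_def using ideal_is_all[OF trivial exits] p_vertex_in_lpa[OF v]
    by auto
  moreover have "purely_infinite (ring_on lpa)"
    unfolding purely_infinite_def
  proof (intro allI impI)
    fix I assume I: "right_ideal (ring_on lpa) I" "I \<noteq> {\<zero>\<^bsub>ring_on lpa\<^esub>}"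
    then obtain a where a: "a \<in> I" "a \<noteq> 0" "a \<in> lpa" by (auto simp: lpa.right_ideal_iff)
    then obtain z where z: "z \<in> lpa" "infinite_in lpa (a * z)"
      using nonzero_infinite[OF exits conn] by blast
    then have "a * z \<in> I" using a I by (auto simp: lpa.right_ideal_iff)
    then show "\<exists>e \<in> I. infinite_idempotent (ring_on lpa) e"
      using z by (auto simp: lpa.infinite_idempotent_iff)
  qed
  ultimately show ?L by (simp add: purely_infinite_simple_def)
qed

end

section \<open>Free algebras\<close>

lemma free_algebra_simps [simp]:
  "carrier (free_algebra K X) = {p. \<forall>w \<in> Poly_Mapping.keys p. letters w \<noteq> [] \<and> set (letters w) \<subseteq> X}"
  "x \<otimes>\<^bsub>free_algebra K X\<^esub> y = x * y" "x \<oplus>\<^bsub>free_algebra K X\<^esub> y = x + y" "\<zero>\<^bsub>free_algebra K X\<^esub> = 0"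
  "c \<odot>\<^bsub>free_algebra K X\<^esub> x = Poly_Mapping.single 0 c * x"
  by (simp_all add: free_algebra_def)

lemma keys_uminus: "Poly_Mapping.keys (- p) = Poly_Mapping.keys (p :: 'a \<Rightarrow>\<^sub>0 'b::ab_group_add)"
  by (auto simp: in_keys_iff)

lemma free_algebra_closed:
  fixes K :: "'k::field itself" and x y :: "'g free_monoid \<Rightarrow>\<^sub>0 'k"
  shows "(0 :: 'g free_monoid \<Rightarrow>\<^sub>0 'k) \<in> carrier (free_algebra K X)"
    "x \<in> carrier (free_algebra K X) \<Longrightarrow> y \<in> carrier (free_algebra K X) \<Longrightarrow> x + y \<in> carrier (free_algebra K X)"
    "x \<in> carrier (free_algebra K X) \<Longrightarrow> - x \<in> carrier (free_algebra K X)"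
    "x \<in> carrier (free_algebra K X) \<Longrightarrow> y \<in> carrier (free_algebra K X) \<Longrightarrow> x - y \<in> carrier (free_algebra K X)"
    "x \<in> carrier (free_algebra K X) \<Longrightarrow> y \<in> carrier (free_algebra K X) \<Longrightarrow> x * y \<in> carrier (free_algebra K X)"
    "x \<in> carrier (free_algebra K X) \<Longrightarrow> Poly_Mapping.single 0 c * x \<in> carrier (free_algebra K X)"
    "g \<in> X \<Longrightarrow> (indet g :: 'g free_monoid \<Rightarrow>\<^sub>0 'k) \<in> carrier (free_algebra K X)"
proof -
  show add: "x + y \<in> carrier (free_algebra K X)"
    if "x \<in> carrier (free_algebra K X)" "y \<in> carrier (free_algebra K X)" for x y :: "'g free_monoid \<Rightarrow>\<^sub>0 'k"
    using that Poly_Mapping.keys_add[of x y] by auto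
  show neg: "- x \<in> carrier (free_algebra K X)"
    if "x \<in> carrier (free_algebra K X)" for x :: "'g free_monoid \<Rightarrow>\<^sub>0 'k"
    using that by (simp add: keys_uminus)
  show "x - y \<in> carrier (free_algebra K X)"
    if "x \<in> carrier (free_algebra K X)" "y \<in> carrier (free_algebra K X)"
    using add[OF that(1) neg[OF that(2)]] by simp
  show "x * y \<in> carrier (free_algebra K X)"
    if "x \<in> carrier (free_algebra K X)" "y \<in> carrier (free_algebra K X)"
    using that keys_mult[of x y] by (fastforce simp: plus_free_monoid_def)
  show "Poly_Mapping.single 0 c * x \<in> carrier (free_algebra K X)" if "x \<in> carrier (free_algebra K X)"
    using that keys_mult[of "Poly_Mapping.single 0 c" x] by (fastforce split: if_splits)
qed (auto simp: indet_def)

lemma free_algebra_additive_subgroup: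
  "additive_subgroup I (free_algebra K X) \<longleftrightarrow> I \<subseteq> carrier (free_algebra K X) \<and> 0 \<in> I \<and>
     (\<forall>x \<in> I. \<forall>y \<in> I. x + y \<in> I) \<and> (\<forall>x \<in> I. - x \<in> I)"
  by (rule typed_additive_subgroup) (rule free_algebra_closed | simp add: free_algebra_def)+

lemma poly_mapping_sum_singles:
  "q = (\<Sum>w \<in> Poly_Mapping.keys q. Poly_Mapping.single w (Poly_Mapping.lookup q w))"
  by (rule poly_mapping_eqI)
    (auto simp: Poly_Mapping.lookup_sum Poly_Mapping.lookup_single when_def in_keys_iff)

lemma poly_mapping_single_induct [case_names zero single add]:
  fixes q :: "'a \<Rightarrow>\<^sub>0 'b::comm_monoid_add"
  assumes "P 0" "\<And>w c. P (Poly_Mapping.single w c)" "\<And>p q. P p \<Longrightarrow> P q \<Longrightarrow> P (p + q)"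
  shows "P q"
proof -
  have "P (\<Sum>w \<in> A. Poly_Mapping.single w (Poly_Mapping.lookup q w))" if "finite A" for A
    using that by (induction A rule: finite_induct) (auto intro: assms)
  then show ?thesis using poly_mapping_sum_singles[of q] by (metis finite_keys)
qed

lemma single_zero_commute:
  fixes q :: "'m::monoid_add \<Rightarrow>\<^sub>0 'k::comm_semiring_1"
  shows "q * Poly_Mapping.single 0 c = Poly_Mapping.single 0 c * q"
  by (induction q rule: poly_mapping_single_induct)
    (simp_all add: mult_single distrib_left distrib_right mult.commute)

section \<open>Representations by partial maps\<close>

text \<open>Letters act on points by partial maps, a word from left to right; consequently words act from the left
on functions of points, by pullback.\<close>

primrec word_act :: "('g \<Rightarrow> 'x \<Rightarrow> 'x option) \<Rightarrow> 'g list \<Rightarrow> 'x \<Rightarrow> 'x option" where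
  "word_act act [] x = Some x"
| "word_act act (g # w) x = Option.bind (act g x) (word_act act w)"

lemma word_act_append: "word_act act (u @ w) x = Option.bind (word_act act u x) (word_act act w)"
  by (induction u arbitrary: x) (auto split: Option.bind_splits)

text \<open>The resulting action of noncommutative polynomials on functions of points.\<close>

definition poly_act ::
    "('g \<Rightarrow> 'x \<Rightarrow> 'x option) \<Rightarrow> ('g free_monoid \<Rightarrow>\<^sub>0 'k::field) \<Rightarrow> ('x \<Rightarrow> 'k) \<Rightarrow> 'x \<Rightarrow> 'k" where
  "poly_act act q \<phi> x = (\<Sum>w \<in> Poly_Mapping.keys q.
     Poly_Mapping.lookup q w * case_option 0 \<phi> (word_act act (letters w) x))"

lemma poly_act_superset:
  assumes "finite A" "Poly_Mapping.keys q \<subseteq> A"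
  shows "poly_act act q \<phi> x = (\<Sum>w \<in> A. Poly_Mapping.lookup q w * case_option 0 \<phi> (word_act act (letters w) x))"
  unfolding poly_act_def using assms by (intro sum.mono_neutral_left) (auto simp: in_keys_iff)

lemma poly_act_zero [simp]: "poly_act act 0 \<phi> x = 0"
  by (simp add: poly_act_def)

lemma poly_act_zero_fun [simp]: "poly_act act q (\<lambda>_. 0) x = 0"
  by (auto simp: poly_act_def intro!: sum.neutral split: option.splits)

lemma poly_act_add: "poly_act act (q + r) \<phi> x = poly_act act q \<phi> x + poly_act act r \<phi> x"
proof -
  let ?A = "Poly_Mapping.keys q \<union> Poly_Mapping.keys r"
  have "finite ?A" "Poly_Mapping.keys (q + r) \<subseteq> ?A" "Poly_Mapping.keys q \<subseteq> ?A" "Poly_Mapping.keys r \<subseteq> ?A"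
    using Poly_Mapping.keys_add[of q r] by auto
  then show ?thesis
    by (simp add: poly_act_superset[of ?A] Poly_Mapping.lookup_add distrib_right sum.distrib)
qed

lemma poly_act_uminus: "poly_act act (- q) \<phi> x = - poly_act act q \<phi> x"
  using poly_act_add[of act q "- q" \<phi> x] by (simp add: eq_neg_iff_add_eq_0 add.commute)

lemma poly_act_diff: "poly_act act (q - r) \<phi> x = poly_act act q \<phi> x - poly_act act r \<phi> x"
  using poly_act_add[of act q "- r" \<phi> x] by (simp add: poly_act_uminus)

lemma poly_act_sum: "poly_act act (\<Sum>i \<in> I. f i) \<phi> x = (\<Sum>i \<in> I. poly_act act (f i) \<phi> x)"
  by (induction I rule: infinite_finite_induct) (simp_all add: poly_act_add)

lemma poly_act_single:
  "poly_act act (Poly_Mapping.single w c) \<phi> x = c * case_option 0 \<phi> (word_act act (letters w) x)"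
  by (simp add: poly_act_superset[of "{w}"])

lemma poly_act_indet [simp]: "poly_act act (indet g) \<phi> x = case_option 0 \<phi> (act g x)"
  by (cases "act g x") (simp_all add: indet_def poly_act_single)

lemma poly_act_mult: "poly_act act (q * r) \<phi> x = poly_act act q (poly_act act r \<phi>) x"
proof (induction q rule: poly_mapping_single_induct)
  case (single u c)
  show ?case
  proof (induction r rule: poly_mapping_single_induct)
    case zero
    have "poly_act act 0 \<phi> = (\<lambda>_. 0)" by (rule ext) simp
    then show ?case by simp
  next
    case (single w d)
    then show ?case
      by (simp add: mult_single poly_act_single plus_free_monoid_def word_act_append
          split: Option.bind_splits option.splits)
  next
    case (add p q)
    then show ?case
      by (simp add: distrib_left poly_act_add poly_act_single split: option.splits)
  qed
qed (simp_all add: distrib_right poly_act_add)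

lemma algebra_ideal_free_iff:
  "algebra_ideal (free_algebra K X) I \<longleftrightarrow> I \<subseteq> carrier (free_algebra K X) \<and> 0 \<in> I \<and>
     (\<forall>x \<in> I. \<forall>y \<in> I. x + y \<in> I) \<and> (\<forall>x \<in> I. - x \<in> I) \<and>
     (\<forall>a \<in> I. \<forall>x \<in> carrier (free_algebra K X). x * a \<in> I \<and> a * x \<in> I) \<and>
     (\<forall>a \<in> I. \<forall>c. Poly_Mapping.single 0 c * a \<in> I)"
  unfolding algebra_ideal_def free_algebra_additive_subgroup
  by (simp only: free_algebra_simps(2-) conj_assoc)

lemma algebra_ideal_kernel:
  "algebra_ideal (free_algebra K X) {q \<in> carrier (free_algebra K X). \<forall>\<phi> x. poly_act act q \<phi> x = 0}"
proof -
  let ?J = "{q \<in> carrier (free_algebra K X). \<forall>\<phi> x. poly_act act q \<phi> x = 0}"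
  have 0: "poly_act act q \<phi> = (\<lambda>_. 0)" if "q \<in> ?J" for q \<phi>
    by (rule ext) (use that in blast)
  show ?thesis
    unfolding algebra_ideal_free_iff
  proof (intro conjI ballI allI)
    show "?J \<subseteq> carrier (free_algebra K X)" by blast
    show "0 \<in> ?J" using free_algebra_closed(1) by (blast intro: poly_act_zero)
    fix a assume a: "a \<in> ?J"
    then have carrier: "a \<in> carrier (free_algebra K X)" by blast
    show "a + b \<in> ?J" if "b \<in> ?J" for b
      using a that free_algebra_closed(2) by (auto simp only: poly_act_add mem_Collect_eq add_0)
    show "- a \<in> ?J"
      using a free_algebra_closed(3) by (auto simp only: poly_act_uminus mem_Collect_eq minus_zero)
    show "x * a \<in> ?J" "a * x \<in> ?J" if "x \<in> carrier (free_algebra K X)" for x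
    proof -
      have "x * a \<in> carrier (free_algebra K X)" "a * x \<in> carrier (free_algebra K X)"
        using that carrier free_algebra_closed(5) by blast+
      then show "x * a \<in> ?J" "a * x \<in> ?J" using 0[OF a] by (simp_all only: poly_act_mult mem_Collect_eq poly_act_zero_fun simp_thms)
    qed
    show "Poly_Mapping.single 0 c * a \<in> ?J" for c
      using free_algebra_closed(6)[OF carrier] 0[OF a]
      by (simp only: poly_act_mult mem_Collect_eq poly_act_zero_fun simp_thms)
  qed
qed

section \<open>Prime filters avoiding a hereditary family\<close>

definition prime_filter :: "('v, 'e) ugraph \<Rightarrow> 'v set set \<Rightarrow> 'v set set \<Rightarrow> bool" where
  "prime_filter G H \<chi> \<longleftrightarrow> \<chi> \<subseteq> gen_verts G - H \<and>
     (\<forall>A \<in> gen_verts G. \<forall>B \<in> gen_verts G. (A \<inter> B \<in> \<chi> \<longleftrightarrow> A \<in> \<chi> \<and> B \<in> \<chi>) \<and> (A \<union> B \<in> \<chi> \<longleftrightarrow> A \<in> \<chi> \<or> B \<in> \<chi>))"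

text \<open>By Zorn's lemma there is a maximal ideal of the lattice that contains \<open>H\<close> and misses \<open>B\<close>; since the
lattice is distributive, it is prime, and its complement is the filter.  A filter is needed instead of a
vertex of \<open>B\<close> since \<open>{v}\<close> may belong to \<open>H\<close> for every \<open>v \<in> B\<close> when \<open>B\<close> is infinite.\<close>

lemma prime_filter_exists:
  assumes her: "hereditary G H" and H0: "{} \<in> H" and B: "B \<in> gen_verts G" "B \<notin> H"
  shows "\<exists>\<chi>. prime_filter G H \<chi> \<and> B \<in> \<chi>"
proof -
  define ideal where "ideal Q \<longleftrightarrow> H \<subseteq> Q \<and> Q \<subseteq> gen_verts G \<and> B \<notin> Q \<and> (\<forall>A \<in> Q. \<forall>C \<in> Q. A \<union> C \<in> Q) \<and>
    (\<forall>A \<in> Q. \<forall>C \<in> gen_verts G. C \<subseteq> A \<longrightarrow> C \<in> Q)" for Q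
  have H: "ideal H" using her B by (auto simp: ideal_def hereditary_def)
  have "\<exists>Q \<in> Collect ideal. \<forall>Q' \<in> Collect ideal. Q \<subseteq> Q' \<longrightarrow> Q' = Q"
  proof (rule subset_Zorn_nonempty)
    show "Collect ideal \<noteq> {}" using H by blast
    fix \<C> assume \<C>: "\<C> \<noteq> {}" "subset.chain (Collect ideal) \<C>"
    then have ids: "\<And>Q. Q \<in> \<C> \<Longrightarrow> ideal Q" and chain: "\<And>Q Q'. Q \<in> \<C> \<Longrightarrow> Q' \<in> \<C> \<Longrightarrow> Q \<subseteq> Q' \<or> Q' \<subseteq> Q"
      by (auto simp: subset.chain_def)
    have "A \<union> C \<in> \<Union> \<C>" if AC: "A \<in> \<Union> \<C>" "C \<in> \<Union> \<C>" for A C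
    proof -
      from AC obtain Q Q' where Q: "A \<in> Q" "Q \<in> \<C>" "C \<in> Q'" "Q' \<in> \<C>" by blast
      then obtain Q'' where "A \<in> Q''" "C \<in> Q''" "Q'' \<in> \<C>" using chain[of Q Q'] by blast
      then have "A \<union> C \<in> Q''" using ids[of Q''] by (simp add: ideal_def)
      then show ?thesis using \<open>Q'' \<in> \<C>\<close> by blast
    qed
    moreover have "C \<in> \<Union> \<C>" if "A \<in> \<Union> \<C>" "C \<in> gen_verts G" "C \<subseteq> A" for A C
    proof -
      from that obtain Q where Q: "A \<in> Q" "Q \<in> \<C>" by blast
      then have "C \<in> Q" using ids[of Q] that(2,3) unfolding ideal_def by blast
      then show ?thesis using Q by blast
    qed
    moreover have "H \<subseteq> \<Union> \<C>" "\<Union> \<C> \<subseteq> gen_verts G" "B \<notin> \<Union> \<C>"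
    proof -
      have *: "H \<subseteq> Q \<and> Q \<subseteq> gen_verts G \<and> B \<notin> Q" if "Q \<in> \<C>" for Q
        using ids[OF that] by (simp add: ideal_def)
      then show "\<Union> \<C> \<subseteq> gen_verts G" "B \<notin> \<Union> \<C>" by blast+
      show "H \<subseteq> \<Union> \<C>" using \<C>(1) * by blast
    qed
    ultimately show "\<Union> \<C> \<in> Collect ideal" unfolding ideal_def by blast
  qed
  then obtain Q where Q: "ideal Q" and max: "\<And>Q'. ideal Q' \<Longrightarrow> Q \<subseteq> Q' \<Longrightarrow> Q' = Q" by auto
  have Q': "H \<subseteq> Q" "Q \<subseteq> gen_verts G" "B \<notin> Q" "\<And>A C. A \<in> Q \<Longrightarrow> C \<in> Q \<Longrightarrow> A \<union> C \<in> Q"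
    "\<And>A C. A \<in> Q \<Longrightarrow> C \<in> gen_verts G \<Longrightarrow> C \<subseteq> A \<Longrightarrow> C \<in> Q"
    using Q by (auto simp: ideal_def)
  have "{} \<in> Q" using H0 Q' by blast
  have cover: "\<exists>q \<in> Q. B \<subseteq> q \<union> A" if A: "A \<in> gen_verts G" "A \<notin> Q" for A
  proof (rule ccontr)
    assume no: "\<not> (\<exists>q \<in> Q. B \<subseteq> q \<union> A)"
    define Q'' where "Q'' = {C \<in> gen_verts G. \<exists>q \<in> Q. C \<subseteq> q \<union> A}"
    have "ideal Q''"
      unfolding ideal_def
    proof (intro conjI ballI impI)
      show "H \<subseteq> Q''" using Q' by (auto simp: Q''_def)
      show "Q'' \<subseteq> gen_verts G" "B \<notin> Q''" using no by (auto simp: Q''_def)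
      fix C D assume C: "C \<in> Q''"
      then obtain q where q: "q \<in> Q" "C \<subseteq> q \<union> A" "C \<in> gen_verts G" by (auto simp: Q''_def)
      show "D \<in> Q''" if "D \<in> gen_verts G" "D \<subseteq> C" using that q by (auto simp: Q''_def)
      assume "D \<in> Q''"
      then obtain q' where q': "q' \<in> Q" "D \<subseteq> q' \<union> A" "D \<in> gen_verts G" by (auto simp: Q''_def)
      have "q \<union> q' \<in> Q" "C \<union> D \<subseteq> (q \<union> q') \<union> A" using q q' Q' by auto
      then show "C \<union> D \<in> Q''" using q q' by (auto simp: Q''_def intro: gen_verts.union)
    qed
    moreover have "Q \<subseteq> Q''" using Q' by (auto simp: Q''_def)
    ultimately have "Q'' = Q" by (rule max)
    moreover have "A \<in> Q''" using A \<open>{} \<in> Q\<close> by (auto simp: Q''_def)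
    ultimately show False using A by simp
  qed
  let ?\<chi> = "gen_verts G - Q"
  have "prime_filter G H ?\<chi>"
    unfolding prime_filter_def
  proof (intro conjI ballI)
    show "?\<chi> \<subseteq> gen_verts G - H" using Q' by blast
    fix A C assume AC: "A \<in> gen_verts G" "C \<in> gen_verts G"
    then have AC': "A \<union> C \<in> gen_verts G" "A \<inter> C \<in> gen_verts G" by (auto intro: gen_verts.intros)
    have "A \<inter> C \<notin> Q" if not_in: "A \<notin> Q" "C \<notin> Q"
    proof
      assume "A \<inter> C \<in> Q"
      moreover obtain q q' where "q \<in> Q" "B \<subseteq> q \<union> A" "q' \<in> Q" "B \<subseteq> q' \<union> C"
        using cover[OF AC(1) not_in(1)] cover[OF AC(2) not_in(2)] by blast
      ultimately have "q \<union> q' \<union> (A \<inter> C) \<in> Q" "B \<subseteq> q \<union> q' \<union> (A \<inter> C)" using Q'(4) by auto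
      then show False using Q'(3,5) B by blast
    qed
    then show "A \<inter> C \<in> ?\<chi> \<longleftrightarrow> A \<in> ?\<chi> \<and> C \<in> ?\<chi>"
      using AC AC' Q'(5)[of A "A \<inter> C"] Q'(5)[of C "A \<inter> C"] by auto
    show "A \<union> C \<in> ?\<chi> \<longleftrightarrow> A \<in> ?\<chi> \<or> C \<in> ?\<chi>"
      using AC AC' Q'(4)[of A C] Q'(5)[of "A \<union> C" A] Q'(5)[of "A \<union> C" C] by auto
  qed
  then show ?thesis using B Q' by blast
qed

section \<open>Boundary paths\<close>

text \<open>A boundary path is an infinite path, or a finite path followed by a prime filter.  Both are written as
sequences: an entry \<open>Inl e\<close> is an edge of the path and an entry \<open>Inr \<chi>\<close> ends it.  What follows the end is
not tied to it, so that a finite path is represented by many points; this does no harm to the action.\<close>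

type_synonym ('v, 'e) boundary_seq = "nat \<Rightarrow> 'e + 'v set set"

text \<open>The sets in which a boundary path starts.\<close>

fun start_filter :: "('v, 'e) ugraph \<Rightarrow> 'e + 'v set set \<Rightarrow> 'v set set" where
  "start_filter G (Inl e) = {A \<in> gen_verts G. src G e \<in> A}"
| "start_filter G (Inr \<chi>) = \<chi>"

text \<open>At a regular vertex a path has to go on, so the final filter must not be concentrated at such a
vertex; this enforces the relation of regular vertices.\<close>

definition boundary_paths :: "('v, 'e) ugraph \<Rightarrow> 'v set set \<Rightarrow> ('v, 'e) boundary_seq set" where
  "boundary_paths G H = {x. \<forall>i. case x i of
       Inl e \<Rightarrow> e \<in> edges G \<and> {src G e} \<notin> H \<and> rng G e \<in> start_filter G (x (Suc i))
     | Inr \<chi> \<Rightarrow> prime_filter G H \<chi> \<and> (\<forall>v. regular_vertex G v \<longrightarrow> {v} \<notin> \<chi>)}"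

text \<open>As words act by pullback, \<open>Edge e\<close> removes the first edge and \<open>Ghost e\<close> prepends \<open>e\<close>.\<close>

fun boundary_act ::
    "('v, 'e) ugraph \<Rightarrow> 'v set set \<Rightarrow> ('v, 'e) lpa_gen \<Rightarrow> ('v, 'e) boundary_seq \<Rightarrow> ('v, 'e) boundary_seq option" where
  "boundary_act G H (Proj A) x =
     (if x \<in> boundary_paths G H \<and> A \<in> start_filter G (x 0) then Some x else None)"
| "boundary_act G H (Edge e) x =
     (if x \<in> boundary_paths G H \<and> x 0 = Inl e then Some (\<lambda>i. x (Suc i)) else None)"
| "boundary_act G H (Ghost e) x =
     (if x \<in> boundary_paths G H \<and> e \<in> edges G \<and> rng G e \<in> start_filter G (x 0)
      then Some (case_nat (Inl e) x) else None)"

context ultragraph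
begin

context
  fixes H :: "'v set set"
  assumes her: "hereditary G H" and sat: "saturated G H" and H0: "{} \<in> H"
begin

lemma hereditary_down: "A \<in> H \<Longrightarrow> B \<in> gen_verts G \<Longrightarrow> B \<subseteq> A \<Longrightarrow> B \<in> H"
  using her unfolding hereditary_def by blast

lemma boundary_tail: "x \<in> boundary_paths G H \<Longrightarrow> (\<lambda>i. x (Suc i)) \<in> boundary_paths G H"
  by (auto simp: boundary_paths_def)

lemma boundary_head:
  assumes "x \<in> boundary_paths G H" "x 0 = Inl e"
  shows "e \<in> edges G" "{src G e} \<notin> H" "rng G e \<in> start_filter G (x (Suc 0))"
  using assms by (auto simp: boundary_paths_def dest: spec[of _ 0])

lemma start_prime:
  assumes "x \<in> boundary_paths G H" shows "prime_filter G H (start_filter G (x 0))"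
proof (cases "x 0")
  case (Inl e)
  note e = boundary_head[OF assms Inl]
  have "A \<notin> H" if "src G e \<in> A" for A
    using hereditary_down[of A "{src G e}"] e that src_in_verts by (auto intro: gen_verts.vertex)
  then show ?thesis by (auto simp: Inl prime_filter_def intro: gen_verts.inter gen_verts.union)
next
  case (Inr \<chi>)
  then show ?thesis using assms by (auto simp: boundary_paths_def dest: spec[of _ 0])
qed

lemma boundary_cons:
  assumes "x \<in> boundary_paths G H" "e \<in> edges G" "rng G e \<in> start_filter G (x 0)"
  shows "case_nat (Inl e) x \<in> boundary_paths G H"
proof -
  have "rng G e \<notin> H" using start_prime[OF assms(1)] assms(3) by (auto simp: prime_filter_def)
  then have "{src G e} \<notin> H" using her assms(2) by (auto simp: hereditary_def)
  then show ?thesis using assms by (auto simp: boundary_paths_def split: nat.splits)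
qed

lemma start_empty: "x \<in> boundary_paths G H \<Longrightarrow> {} \<notin> start_filter G (x 0)"
  using start_prime H0 by (auto simp: prime_filter_def)

lemma start_inter:
  "x \<in> boundary_paths G H \<Longrightarrow> A \<in> gen_verts G \<Longrightarrow> B \<in> gen_verts G \<Longrightarrow>
    A \<inter> B \<in> start_filter G (x 0) \<longleftrightarrow> A \<in> start_filter G (x 0) \<and> B \<in> start_filter G (x 0)"
  using start_prime by (auto simp: prime_filter_def)

lemma start_union:
  "x \<in> boundary_paths G H \<Longrightarrow> A \<in> gen_verts G \<Longrightarrow> B \<in> gen_verts G \<Longrightarrow>
    A \<union> B \<in> start_filter G (x 0) \<longleftrightarrow> A \<in> start_filter G (x 0) \<or> B \<in> start_filter G (x 0)"
  using start_prime by (auto simp: prime_filter_def)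

lemma src_start: "e \<in> edges G \<Longrightarrow> {src G e} \<in> start_filter G (Inl e)"
  using src_in_verts by (auto intro: gen_verts.vertex)

lemma start_regular:
  assumes "x \<in> boundary_paths G H" "regular_vertex G v"
  shows "{v} \<in> start_filter G (x 0) \<longleftrightarrow> (\<exists>e \<in> out_edges G v. x 0 = Inl e)"
proof (cases "x 0")
  case (Inl e)
  then show ?thesis using boundary_head[OF assms(1) Inl] assms(2)
    by (auto simp: out_edges_def regular_vertex_def intro: gen_verts.vertex)
next
  case (Inr \<chi>)
  then show ?thesis using assms by (auto simp: boundary_paths_def dest: spec[of _ 0])
qed

text \<open>Start from a prime filter through \<open>B\<close>.  If it is concentrated at a regular vertex \<open>v\<close>, saturation
provides an edge from \<open>v\<close> whose range is not in \<open>H\<close>, and the construction goes on with this range; otherwise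
the filter may end the path.  In the latter case the construction is continued with the same set, merely to fill the
sequence.\<close>

lemma boundary_path_exists:
  assumes B: "B \<in> gen_verts G" "B \<notin> H"
  shows "\<exists>x \<in> boundary_paths G H. B \<in> start_filter G (x 0)"
proof -
  define good where "good a C \<longleftrightarrow> C \<in> gen_verts G \<and> C \<notin> H \<and> (case a of
      Inl e \<Rightarrow> e \<in> edges G \<and> {src G e} \<notin> H \<and> C = rng G e
    | Inr \<chi> \<Rightarrow> prime_filter G H \<chi> \<and> (\<forall>v. regular_vertex G v \<longrightarrow> {v} \<notin> \<chi>))" for a :: "'e + 'v set set" and C
  have step: "\<exists>a C'. good a C' \<and> C \<in> start_filter G a" if C: "C \<in> gen_verts G" "C \<notin> H" for C
  proof -
    obtain \<chi> where \<chi>: "prime_filter G H \<chi>" "C \<in> \<chi>" using prime_filter_exists[OF her H0 C] by blast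
    show ?thesis
    proof (cases "\<exists>v. regular_vertex G v \<and> {v} \<in> \<chi>")
      case True
      then obtain v where v: "regular_vertex G v" "{v} \<in> \<chi>" by blast
      have v': "{v} \<in> gen_verts G" using v by (auto simp: regular_vertex_def intro: gen_verts.vertex)
      have "{v} \<notin> H" using \<chi> v by (auto simp: prime_filter_def)
      then obtain e where e: "e \<in> out_edges G v" "rng G e \<notin> H"
        using sat v by (auto simp: saturated_def)
      have "C \<inter> {v} \<in> \<chi>" using \<chi> v v' C by (auto simp: prime_filter_def)
      moreover have "{} \<notin> \<chi>" using \<chi>(1) H0 by (auto simp: prime_filter_def)
      ultimately have "C \<inter> {v} \<noteq> {}" by metis
      then have "v \<in> C" by blast
      then show ?thesis using e C \<open>{v} \<notin> H\<close>
        by (intro exI[of _ "Inl e"] exI[of _ "rng G e"])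
          (auto simp: good_def out_edges_def intro: gen_verts.range)
    next
      case False
      then show ?thesis using \<chi> C by (intro exI[of _ "Inr \<chi>"] exI[of _ C]) (auto simp: good_def)
    qed
  qed
  obtain a0 C0 where start: "good a0 C0" "B \<in> start_filter G a0" using step[OF B] by blast
  have "\<exists>f. \<forall>n. (good (fst (f n)) (snd (f n)) \<and> (n = 0 \<longrightarrow> f n = (a0, C0))) \<and>
      snd (f n) \<in> start_filter G (fst (f (Suc n)))"
  proof (rule dependent_nat_choice)
    show "\<exists>x. good (fst x) (snd x) \<and> (0 = 0 \<longrightarrow> x = (a0, C0))" using start by auto
    fix x :: "('e + 'v set set) \<times> 'v set" and n :: nat
    assume "good (fst x) (snd x) \<and> (n = 0 \<longrightarrow> x = (a0, C0))"
    then have "snd x \<in> gen_verts G" "snd x \<notin> H" by (auto simp: good_def)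
    then obtain a C where "good a C" "snd x \<in> start_filter G a" using step by blast
    then show "\<exists>y. (good (fst y) (snd y) \<and> (Suc n = 0 \<longrightarrow> y = (a0, C0))) \<and> snd x \<in> start_filter G (fst y)"
      by (intro exI[of _ "(a, C)"]) auto
  qed
  then obtain f where f: "\<And>n. good (fst (f n)) (snd (f n))" "f 0 = (a0, C0)"
    "\<And>n. snd (f n) \<in> start_filter G (fst (f (Suc n)))" by metis
  have "(\<lambda>i. fst (f i)) \<in> boundary_paths G H"
    unfolding boundary_paths_def
  proof (intro CollectI allI)
    fix i show "case fst (f i) of
       Inl e \<Rightarrow> e \<in> edges G \<and> {src G e} \<notin> H \<and> rng G e \<in> start_filter G (fst (f (Suc i)))
     | Inr \<chi> \<Rightarrow> prime_filter G H \<chi> \<and> (\<forall>v. regular_vertex G v \<longrightarrow> {v} \<notin> \<chi>)"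
      using f(1)[of i] f(3)[of i] by (auto simp: good_def split: sum.splits)
  qed
  then show ?thesis using f(2) start by (intro bexI[of _ "\<lambda>i. fst (f i)"]) auto
qed

lemma lpa_rels_act:
  assumes "r \<in> lpa_rels K G" shows "poly_act (boundary_act G H) r \<phi> x = 0"
  using assms
proof cases
  case proj_empty
  then show ?thesis using start_empty[of x] by auto
next
  case (proj_mult A B)
  then show ?thesis using start_inter by (auto simp: poly_act_diff poly_act_mult)
next
  case (proj_union A B)
  then show ?thesis using start_inter start_union by (auto simp: poly_act_diff poly_act_add)
next
  case (src_edge e)
  then show ?thesis using src_start by (auto simp: poly_act_diff poly_act_mult)
next
  case (edge_rng e)
  then show ?thesis using boundary_tail boundary_head by (auto simp: poly_act_diff poly_act_mult)
next
  case (rng_ghost e)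
  then show ?thesis by (auto simp: poly_act_diff poly_act_mult)
next
  case (ghost_src e)
  then show ?thesis using boundary_cons src_start by (auto simp: poly_act_diff poly_act_mult)
next
  case (ghost_edge e f)
  then show ?thesis using boundary_cons by (auto simp: poly_act_diff poly_act_mult)
next
  case (regular v)
  have fin: "finite (out_edges G v)" using regular by (simp add: regular_vertex_def)
  have summand: "poly_act (boundary_act G H) (ss e * ss_star e) \<phi> x
      = (if x \<in> boundary_paths G H \<and> x 0 = Inl e then \<phi> x else 0)" for e
  proof (cases "x \<in> boundary_paths G H \<and> x 0 = Inl e")
    case True
    then have "case_nat (Inl e) (\<lambda>i. x (Suc i)) = x" by (auto simp: fun_eq_iff split: nat.splits)
    then show ?thesis using True boundary_tail boundary_head[of x e] by (simp add: poly_act_mult)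
  qed (auto simp: poly_act_mult)
  show ?thesis
  proof (cases "x \<in> boundary_paths G H \<and> {v} \<in> start_filter G (x 0)")
    case True
    then obtain e where e: "e \<in> out_edges G v" "x 0 = Inl e" using start_regular regular by blast
    have "(\<Sum>f \<in> out_edges G v. if x \<in> boundary_paths G H \<and> x 0 = Inl f then \<phi> x else 0)
        = (\<Sum>f \<in> out_edges G v. if f = e then \<phi> x else 0)"
      using True e by (intro sum.cong) auto
    then show ?thesis using True e fin regular by (simp add: poly_act_diff poly_act_sum summand)
  next
    case False
    then have "\<not> (x \<in> boundary_paths G H \<and> x 0 = Inl e)" if "e \<in> out_edges G v" for e
      using start_regular regular that by blast
    then have "(\<Sum>f \<in> out_edges G v. if x \<in> boundary_paths G H \<and> x 0 = Inl f then \<phi> x else 0) = 0"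
      by (intro sum.neutral) auto
    then show ?thesis using False regular by (auto simp: poly_act_diff poly_act_sum summand)
  qed
qed

lemma pp_act_zero_iff:
  assumes "A \<in> gen_verts G"
  shows "(\<forall>\<phi> x. poly_act (boundary_act G H) (pp A) \<phi> x = (0 :: 'k::field)) \<longleftrightarrow> A \<in> H"
proof
  assume 0: "\<forall>\<phi> x. poly_act (boundary_act G H) (pp A) \<phi> x = (0 :: 'k)"
  show "A \<in> H"
  proof (rule ccontr)
    assume "A \<notin> H"
    then obtain x where "x \<in> boundary_paths G H" "A \<in> start_filter G (x 0)"
      using boundary_path_exists[OF assms] by blast
    then have "poly_act (boundary_act G H) (pp A) (\<lambda>_. 1 :: 'k) x = 1" by simp
    then show False using 0 by simp
  qed
next
  assume "A \<in> H"
  then have "\<not> (x \<in> boundary_paths G H \<and> A \<in> start_filter G (x 0))" for x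
    using start_prime[of x] by (auto simp: prime_filter_def)
  then show "\<forall>\<phi> x. poly_act (boundary_act G H) (pp A) \<phi> x = (0 :: 'k)" by auto
qed

end

lemma lpa_rels_carrier: "lpa_rels K G \<subseteq> carrier (free_algebra K (lpa_gens G))"
proof
  fix r assume "r \<in> lpa_rels K G"
  have gens: "A \<in> gen_verts G \<Longrightarrow> Proj A \<in> lpa_gens G" "e \<in> edges G \<Longrightarrow> Edge e \<in> lpa_gens G"
    "e \<in> edges G \<Longrightarrow> Ghost e \<in> lpa_gens G" for A e
    by (auto simp: lpa_gens_def)
  have sum: "(\<Sum>i \<in> I. f i) \<in> carrier (free_algebra K (lpa_gens G))"
    if "\<And>i. i \<in> I \<Longrightarrow> f i \<in> carrier (free_algebra K (lpa_gens G))" for I :: "'e set" and f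
    using that by (induction I rule: infinite_finite_induct) (auto intro: free_algebra_closed simp del: free_algebra_simps(1))
  from \<open>r \<in> lpa_rels K G\<close> show "r \<in> carrier (free_algebra K (lpa_gens G))"
    by cases (auto intro!: free_algebra_closed sum gens gen_verts.intros src_in_verts
        simp: regular_vertex_def out_edges_def simp del: free_algebra_simps(1))
qed

text \<open>The ideal is the kernel of the action on boundary paths that avoid \<open>H\<close>.\<close>

theorem quotient_ideal_exists:
  assumes "hereditary G H" "saturated G H" "{} \<in> H"
  obtains J where "algebra_ideal (free_algebra K (lpa_gens G)) J" "lpa_rels K G \<subseteq> J"
    "\<And>A. A \<in> gen_verts G \<Longrightarrow> pp A \<in> J \<longleftrightarrow> A \<in> H"
proof
  let ?J = "{q \<in> carrier (free_algebra K (lpa_gens G)). \<forall>\<phi> x. poly_act (boundary_act G H) q \<phi> x = 0}"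
  show "algebra_ideal (free_algebra K (lpa_gens G)) ?J" by (rule algebra_ideal_kernel)
  show "lpa_rels K G \<subseteq> ?J" using lpa_rels_carrier lpa_rels_act[OF assms] by blast
  show "pp A \<in> ?J \<longleftrightarrow> A \<in> H" if "A \<in> gen_verts G" for A
    using pp_act_zero_iff[OF assms that] free_algebra_closed(7)[of "Proj A" "lpa_gens G" K] that
    by (auto simp: lpa_gens_def simp del: free_algebra_simps(1) poly_act_indet)
qed

end

section \<open>A ring type containing all quotients of subalgebras\<close>

text \<open>For a subspace \<open>J\<close> closed under multiplication, the idealizer is the largest subalgebra in which \<open>J\<close> is a
two-sided ideal.  The type below is the product, over all such \<open>J\<close>, of the quotients of the idealizers.  A type cannot
depend on an ultragraph, but this product serves all ultragraphs simultaneously: each quotient algebra embeds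
into one factor.\<close>

definition subspace_ring :: "('g free_monoid \<Rightarrow>\<^sub>0 'k::field) set \<Rightarrow> bool" where
  "subspace_ring J \<longleftrightarrow> 0 \<in> J \<and> (\<forall>x \<in> J. \<forall>y \<in> J. x + y \<in> J \<and> x * y \<in> J) \<and> (\<forall>x \<in> J. - x \<in> J) \<and>
     (\<forall>x \<in> J. \<forall>c. Poly_Mapping.single 0 c * x \<in> J)"

definition idealizer :: "'a::ring set \<Rightarrow> 'a set" where
  "idealizer J = {x. \<forall>j \<in> J. x * j \<in> J \<and> j * x \<in> J}"

lemma subspace_ringD:
  assumes "subspace_ring J"
  shows "0 \<in> J" "x \<in> J \<Longrightarrow> y \<in> J \<Longrightarrow> x + y \<in> J" "x \<in> J \<Longrightarrow> - x \<in> J" "x \<in> J \<Longrightarrow> y \<in> J \<Longrightarrow> x - y \<in> J"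
    "x \<in> J \<Longrightarrow> y \<in> idealizer J \<Longrightarrow> x * y \<in> J" "x \<in> J \<Longrightarrow> y \<in> idealizer J \<Longrightarrow> y * x \<in> J"
proof -
  show "x - y \<in> J" if "x \<in> J" "y \<in> J"
    using assms that unfolding subspace_ring_def by (metis add_uminus_conv_diff)
qed (use assms in \<open>auto simp: subspace_ring_def idealizer_def\<close>)

lemma idealizer_closed:
  assumes J: "subspace_ring J"
  shows "0 \<in> idealizer J" "1 \<in> idealizer J" "Poly_Mapping.single 0 c \<in> idealizer J"
    "x \<in> idealizer J \<Longrightarrow> y \<in> idealizer J \<Longrightarrow> x + y \<in> idealizer J"
    "x \<in> idealizer J \<Longrightarrow> y \<in> idealizer J \<Longrightarrow> x * y \<in> idealizer J"
    "x \<in> idealizer J \<Longrightarrow> - x \<in> idealizer J"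
proof -
  show "0 \<in> idealizer J" "1 \<in> idealizer J" using subspace_ringD(1)[OF J] by (auto simp: idealizer_def)
  show "Poly_Mapping.single 0 c \<in> idealizer J"
    using J by (auto simp: idealizer_def subspace_ring_def single_zero_commute)
  show "- x \<in> idealizer J" if "x \<in> idealizer J"
    using that subspace_ringD(3)[OF J] by (auto simp: idealizer_def)
  assume xy: "x \<in> idealizer J" "y \<in> idealizer J"
  show "x + y \<in> idealizer J"
    using xy subspace_ringD(2)[OF J] by (auto simp: idealizer_def distrib_left distrib_right)
  have "x * y * j \<in> J \<and> j * (x * y) \<in> J" if "j \<in> J" for j
    using xy subspace_ringD(5,6)[OF J] that by (metis mult.assoc)
  then show "x * y \<in> idealizer J" by (simp add: idealizer_def)
qed

definition subquotient_rel where
  "subquotient_rel f g \<longleftrightarrow> (\<forall>J. subspace_ring J \<longrightarrow> f J \<in> idealizer J \<and> g J \<in> idealizer J \<and> f J - g J \<in> J)"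

quotient_type (overloaded) ('g, 'k) subquotients =
  "('g free_monoid \<Rightarrow>\<^sub>0 'k::field) set \<Rightarrow> ('g free_monoid \<Rightarrow>\<^sub>0 'k)" / partial: subquotient_rel
proof (rule part_equivpI)
  have "subquotient_rel (\<lambda>_. 0) (\<lambda>_. 0 :: 'g free_monoid \<Rightarrow>\<^sub>0 'k)"
    by (auto simp: subquotient_rel_def idealizer_closed subspace_ringD)
  then show "\<exists>f :: ('g free_monoid \<Rightarrow>\<^sub>0 'k) set \<Rightarrow> 'g free_monoid \<Rightarrow>\<^sub>0 'k. subquotient_rel f f" by blast
  show "symp (subquotient_rel :: (('g free_monoid \<Rightarrow>\<^sub>0 'k) set \<Rightarrow> 'g free_monoid \<Rightarrow>\<^sub>0 'k) \<Rightarrow> _)"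
  proof (rule sympI)
    fix f g :: "('g free_monoid \<Rightarrow>\<^sub>0 'k) set \<Rightarrow> 'g free_monoid \<Rightarrow>\<^sub>0 'k"
    assume "subquotient_rel f g"
    moreover have "g J - f J = - (f J - g J)" for J by simp
    ultimately show "subquotient_rel g f" unfolding subquotient_rel_def using subspace_ringD(3) by metis
  qed
  show "transp (subquotient_rel :: (('g free_monoid \<Rightarrow>\<^sub>0 'k) set \<Rightarrow> 'g free_monoid \<Rightarrow>\<^sub>0 'k) \<Rightarrow> _)"
  proof (rule transpI)
    fix f g h :: "('g free_monoid \<Rightarrow>\<^sub>0 'k) set \<Rightarrow> 'g free_monoid \<Rightarrow>\<^sub>0 'k"
    assume "subquotient_rel f g" "subquotient_rel g h"
    moreover have "f J - h J = (f J - g J) + (g J - h J)" for J by simp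
    ultimately show "subquotient_rel f h" unfolding subquotient_rel_def using subspace_ringD(2) by metis
  qed
qed

lemma subquotient_rel_mult:
  assumes "subquotient_rel f f'" "subquotient_rel g g'"
  shows "subquotient_rel (\<lambda>J. f J * g J) (\<lambda>J. f' J * g' J)"
  unfolding subquotient_rel_def
proof (intro allI impI)
  fix J :: "('a free_monoid \<Rightarrow>\<^sub>0 'b) set" assume J: "subspace_ring J"
  then have fg: "f J - f' J \<in> J" "g J - g' J \<in> J" "g J \<in> idealizer J" "f' J \<in> idealizer J"
    using assms by (auto simp: subquotient_rel_def)
  then have "(f J - f' J) * g J + f' J * (g J - g' J) \<in> J"
    by (intro subspace_ringD(2)[OF J] subspace_ringD(5)[OF J fg(1,3)] subspace_ringD(6)[OF J fg(2,4)])
  moreover have "(f J - f' J) * g J + f' J * (g J - g' J) = f J * g J - f' J * g' J"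
    by (simp add: left_diff_distrib right_diff_distrib)
  ultimately show "f J * g J \<in> idealizer J \<and> f' J * g' J \<in> idealizer J \<and> f J * g J - f' J * g' J \<in> J"
    using assms J by (auto simp: subquotient_rel_def idealizer_closed)
qed

lemma subquotient_rel_add:
  assumes "subquotient_rel f f'" "subquotient_rel g g'"
  shows "subquotient_rel (\<lambda>J. f J + g J) (\<lambda>J. f' J + g' J)"
  unfolding subquotient_rel_def
proof (intro allI impI)
  fix J :: "('a free_monoid \<Rightarrow>\<^sub>0 'b) set" assume J: "subspace_ring J"
  then have "(f J - f' J) + (g J - g' J) \<in> J"
    using assms by (intro subspace_ringD(2)[OF J]) (auto simp: subquotient_rel_def)
  then show "f J + g J \<in> idealizer J \<and> f' J + g' J \<in> idealizer J \<and> f J + g J - (f' J + g' J) \<in> J"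
    using assms J by (simp add: subquotient_rel_def idealizer_closed algebra_simps)
qed

lemma subquotient_rel_uminus:
  assumes "subquotient_rel f f'" shows "subquotient_rel (\<lambda>J. - f J) (\<lambda>J. - f' J)"
  unfolding subquotient_rel_def
proof (intro allI impI)
  fix J :: "('a free_monoid \<Rightarrow>\<^sub>0 'b) set" assume J: "subspace_ring J"
  then have "- (f J - f' J) \<in> J"
    using assms by (auto simp: subquotient_rel_def intro!: subspace_ringD(3)[OF J] simp del: minus_diff_eq)
  then show "- f J \<in> idealizer J \<and> - f' J \<in> idealizer J \<and> - f J - - f' J \<in> J"
    using assms J by (simp add: subquotient_rel_def idealizer_closed)
qed

lemma subquotient_rel_const:
  "subquotient_rel (\<lambda>_. Poly_Mapping.single 0 c) (\<lambda>_. Poly_Mapping.single 0 c)"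
  by (auto simp: subquotient_rel_def idealizer_closed subspace_ringD)

instantiation subquotients :: (type, field) ring_1
begin

lift_definition zero_subquotients :: "('a, 'b) subquotients" is "\<lambda>_. 0"
  using subquotient_rel_const[of 0] by simp

lift_definition one_subquotients :: "('a, 'b) subquotients" is "\<lambda>_. 1"
  using subquotient_rel_const[of 1] by simp

lift_definition plus_subquotients :: "('a, 'b) subquotients \<Rightarrow> ('a, 'b) subquotients \<Rightarrow> ('a, 'b) subquotients"
  is "\<lambda>f g J. f J + g J" by (rule subquotient_rel_add)

lift_definition uminus_subquotients :: "('a, 'b) subquotients \<Rightarrow> ('a, 'b) subquotients"
  is "\<lambda>f J. - f J" by (rule subquotient_rel_uminus)

lift_definition times_subquotients :: "('a, 'b) subquotients \<Rightarrow> ('a, 'b) subquotients \<Rightarrow> ('a, 'b) subquotients"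
  is "\<lambda>f g J. f J * g J" by (rule subquotient_rel_mult)

definition minus_subquotients :: "('a, 'b) subquotients \<Rightarrow> ('a, 'b) subquotients \<Rightarrow> ('a, 'b) subquotients" where
  "minus_subquotients x y = x + - y"

instance
proof
  fix a b c :: "('a, 'b) subquotients"
  show "a + b + c = a + (b + c)"
    by transfer (simp add: add.assoc subquotient_rel_add)
  show "a + b = b + a"
  proof transfer
    fix f g :: "('a free_monoid \<Rightarrow>\<^sub>0 'b) set \<Rightarrow> 'a free_monoid \<Rightarrow>\<^sub>0 'b"
    assume "subquotient_rel f f" "subquotient_rel g g"
    then have "subquotient_rel (\<lambda>J. f J + g J) (\<lambda>J. f J + g J)" by (rule subquotient_rel_add)
    moreover have "(\<lambda>J. f J + g J) = (\<lambda>J. g J + f J)" by (rule ext) (rule add.commute)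
    ultimately show "subquotient_rel (\<lambda>J. f J + g J) (\<lambda>J. g J + f J)" by simp
  qed
  show "0 + a = a" by transfer simp
  show "- a + a = 0" by transfer (use subquotient_rel_const[of 0] in simp)
  show "a - b = a + - b" by (rule minus_subquotients_def)
  show "a * b * c = a * (b * c)"
    by transfer (simp add: mult.assoc subquotient_rel_mult)
  show "(a + b) * c = a * c + b * c"
    by transfer (simp add: distrib_right subquotient_rel_mult subquotient_rel_add)
  show "a * (b + c) = a * b + a * c"
    by transfer (simp add: distrib_left subquotient_rel_mult subquotient_rel_add)
  show "1 * a = a" "a * 1 = a" by (transfer; simp)+
  show "(0 :: ('a, 'b) subquotients) \<noteq> 1"
  proof transfer
    have "subspace_ring {0 :: 'a free_monoid \<Rightarrow>\<^sub>0 'b}" by (simp add: subspace_ring_def)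
    then show "\<not> subquotient_rel (\<lambda>_. 0) (\<lambda>_. 1 :: 'a free_monoid \<Rightarrow>\<^sub>0 'b)"
      by (auto simp: subquotient_rel_def intro!: exI[of _ "{0}"])
  qed
qed

end

lift_definition scalar :: "'k::field \<Rightarrow> ('g, 'k) subquotients" is "\<lambda>c _. Poly_Mapping.single 0 c"
  by (rule subquotient_rel_const)

text \<open>Scalars are constant polynomials in every factor, and so they are central.\<close>

lemma scalar_hom:
  fixes c d :: "'k::field"
  shows "(scalar (c + d) :: ('g, 'k) subquotients) = scalar c + scalar d"
    "(scalar (c * d) :: ('g, 'k) subquotients) = scalar c * scalar d"
    "(scalar 1 :: ('g, 'k) subquotients) = 1"
proof -
  show "(scalar (c + d) :: ('g, 'k) subquotients) = scalar c + scalar d"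
    by transfer (simp only: single_add[symmetric] subquotient_rel_const)
  show "(scalar (c * d) :: ('g, 'k) subquotients) = scalar c * scalar d"
    by transfer (simp only: mult_single add_0 subquotient_rel_const)
  show "(scalar 1 :: ('g, 'k) subquotients) = 1"
    by transfer (simp only: single_one[symmetric] subquotient_rel_const)
qed

lemma scalar_central: "x * scalar c = scalar c * x"
proof transfer
  fix f :: "('a free_monoid \<Rightarrow>\<^sub>0 'b) set \<Rightarrow> 'a free_monoid \<Rightarrow>\<^sub>0 'b" and c :: 'b
  assume "subquotient_rel f f"
  then have "subquotient_rel (\<lambda>J. f J * Poly_Mapping.single 0 c) (\<lambda>J. f J * Poly_Mapping.single 0 c)"
    by (rule subquotient_rel_mult) (rule subquotient_rel_const)
  then show "subquotient_rel (\<lambda>J. f J * Poly_Mapping.single 0 c) (\<lambda>J. Poly_Mapping.single 0 c * f J)"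
    by (simp add: single_zero_commute)
qed

text \<open>The class of \<open>q\<close> in the factor that belongs to \<open>J\<close>, and zero in all other factors.\<close>

definition coset_rep ::
    "('g free_monoid \<Rightarrow>\<^sub>0 'k::field) set \<Rightarrow> ('g free_monoid \<Rightarrow>\<^sub>0 'k) \<Rightarrow>
      ('g free_monoid \<Rightarrow>\<^sub>0 'k) set \<Rightarrow> 'g free_monoid \<Rightarrow>\<^sub>0 'k" where
  "coset_rep J q J' = (if J' = J then q else 0)"

definition coset_of ::
    "('g free_monoid \<Rightarrow>\<^sub>0 'k::field) set \<Rightarrow> ('g free_monoid \<Rightarrow>\<^sub>0 'k) \<Rightarrow> ('g, 'k) subquotients" where
  "coset_of J q = abs_subquotients (coset_rep J q)"

context
  fixes J :: "('g free_monoid \<Rightarrow>\<^sub>0 'k::field) set"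
  assumes J: "subspace_ring J"
begin

lemma coset_rep_rel_iff:
  assumes "q \<in> idealizer J" "r \<in> idealizer J"
  shows "subquotient_rel (coset_rep J q) (coset_rep J r) \<longleftrightarrow> q - r \<in> J"
  using assms J by (auto simp: subquotient_rel_def coset_rep_def idealizer_closed subspace_ringD)

lemma coset_rep_self: "q \<in> idealizer J \<Longrightarrow> subquotient_rel (coset_rep J q) (coset_rep J q)"
  by (simp add: coset_rep_rel_iff subspace_ringD[OF J])

lemma coset_of_eq_iff:
  assumes "q \<in> idealizer J" "r \<in> idealizer J" shows "coset_of J q = coset_of J r \<longleftrightarrow> q - r \<in> J"
  using Quotient_rel[OF Quotient_subquotients, of "coset_rep J q" "coset_rep J r"] assms
  by (simp add: coset_of_def coset_rep_rel_iff coset_rep_self subspace_ringD(1)[OF J])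

lemma coset_of_zero [simp]: "coset_of J 0 = 0"
  by (simp add: coset_of_def zero_subquotients_def coset_rep_def[abs_def] cong: if_cong)

lemma coset_of_eq_zero_iff: "q \<in> idealizer J \<Longrightarrow> coset_of J q = 0 \<longleftrightarrow> q \<in> J"
  using coset_of_eq_iff[of q 0] J by (simp add: idealizer_closed)

lemma coset_of_hom:
  assumes "q \<in> idealizer J" "r \<in> idealizer J"
  shows "coset_of J (q + r) = coset_of J q + coset_of J r" "coset_of J (q * r) = coset_of J q * coset_of J r"
    "coset_of J (Poly_Mapping.single 0 c * q) = scalar c * coset_of J q" "coset_of J (- q) = - coset_of J q"
proof -
  note rel = coset_rep_self[OF assms(1)] coset_rep_self[OF assms(2)]
  have "coset_rep J (q + r) = (\<lambda>J'. coset_rep J q J' + coset_rep J r J')"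
    by (auto simp: coset_rep_def)
  then show "coset_of J (q + r) = coset_of J q + coset_of J r"
    using rel by (simp add: coset_of_def plus_subquotients.abs_eq)
  have "coset_rep J (q * r) = (\<lambda>J'. coset_rep J q J' * coset_rep J r J')"
    by (auto simp: coset_rep_def)
  then show "coset_of J (q * r) = coset_of J q * coset_of J r"
    using rel by (simp add: coset_of_def times_subquotients.abs_eq)
  have "coset_rep J (Poly_Mapping.single 0 c * q) = (\<lambda>J'. Poly_Mapping.single 0 c * coset_rep J q J')"
    by (auto simp: coset_rep_def)
  then show "coset_of J (Poly_Mapping.single 0 c * q) = scalar c * coset_of J q"
    by (simp add: coset_of_def scalar_def times_subquotients.abs_eq[OF subquotient_rel_const rel(1)])
  have "coset_rep J (- q) = (\<lambda>J'. - coset_rep J q J')"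
    by (auto simp: coset_rep_def)
  then show "coset_of J (- q) = - coset_of J q"
    using rel by (simp add: coset_of_def uminus_subquotients.abs_eq)
qed

lemma coset_of_diff:
  "q \<in> idealizer J \<Longrightarrow> r \<in> idealizer J \<Longrightarrow> coset_of J (q - r) = coset_of J q - coset_of J r"
  using coset_of_hom(1)[of q "- r"] coset_of_hom(4)[of r] J by (simp add: idealizer_closed)

end

section \<open>Transport of pure infiniteness and simplicity along isomorphisms\<close>

text \<open>An isomorphism of nonunital rings.  The ring laws are assumed for the target, and \<open>R\<close> inherits them.\<close>

locale ring_transport =
  fixes R :: "('a, 'm) ring_scheme" and S :: "('b, 'n) ring_scheme" and h :: "'a \<Rightarrow> 'b"
  assumes R: "abelian_group R" and S: "abelian_group S"
    and bij: "bij_betw h (carrier R) (carrier S)"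
    and h_add: "\<And>x y. x \<in> carrier R \<Longrightarrow> y \<in> carrier R \<Longrightarrow> h (x \<oplus>\<^bsub>R\<^esub> y) = h x \<oplus>\<^bsub>S\<^esub> h y"
    and h_mult: "\<And>x y. x \<in> carrier R \<Longrightarrow> y \<in> carrier R \<Longrightarrow> h (x \<otimes>\<^bsub>R\<^esub> y) = h x \<otimes>\<^bsub>S\<^esub> h y"
    and R_mult: "\<And>x y. x \<in> carrier R \<Longrightarrow> y \<in> carrier R \<Longrightarrow> x \<otimes>\<^bsub>R\<^esub> y \<in> carrier R"
    and S_assoc: "\<And>x y z. x \<in> carrier S \<Longrightarrow> y \<in> carrier S \<Longrightarrow> z \<in> carrier S \<Longrightarrow>
      x \<otimes>\<^bsub>S\<^esub> y \<otimes>\<^bsub>S\<^esub> z = x \<otimes>\<^bsub>S\<^esub> (y \<otimes>\<^bsub>S\<^esub> z)"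
    and S_distrib: "\<And>x y z. x \<in> carrier S \<Longrightarrow> y \<in> carrier S \<Longrightarrow> z \<in> carrier S \<Longrightarrow>
      x \<otimes>\<^bsub>S\<^esub> (y \<oplus>\<^bsub>S\<^esub> z) = x \<otimes>\<^bsub>S\<^esub> y \<oplus>\<^bsub>S\<^esub> x \<otimes>\<^bsub>S\<^esub> z"
begin

lemma h_carrier [simp]: "x \<in> carrier R \<Longrightarrow> h x \<in> carrier S"
  using bij by (auto simp: bij_betw_def)

lemma h_inj: "x \<in> carrier R \<Longrightarrow> y \<in> carrier R \<Longrightarrow> h x = h y \<longleftrightarrow> x = y"
  using bij by (auto simp: bij_betw_def inj_on_def)

lemma h_surj: "y \<in> carrier S \<Longrightarrow> \<exists>x \<in> carrier R. h x = y"
  using bij by (force simp: bij_betw_def)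

lemma group_hom: "group_hom (add_monoid R) (add_monoid S) h"
proof -
  have "group (add_monoid R)" "group (add_monoid S)" using R S by (simp_all add: abelian_group.a_group)
  then show ?thesis by (auto simp: group_hom_def group_hom_axioms_def hom_def h_add)
qed

lemma h_zero: "h \<zero>\<^bsub>R\<^esub> = \<zero>\<^bsub>S\<^esub>"
  using group_hom.hom_one[OF group_hom] by simp

lemma R_zero: "\<zero>\<^bsub>R\<^esub> \<in> carrier R"
  using R by (simp add: abelian_group.axioms abelian_monoid.zero_closed)

lemma R_add: "x \<in> carrier R \<Longrightarrow> y \<in> carrier R \<Longrightarrow> x \<oplus>\<^bsub>R\<^esub> y \<in> carrier R"
  using R by (simp add: abelian_group.axioms abelian_monoid.a_closed)

lemma R_assoc:
  assumes "x \<in> carrier R" "y \<in> carrier R" "z \<in> carrier R"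
  shows "x \<otimes>\<^bsub>R\<^esub> y \<otimes>\<^bsub>R\<^esub> z = x \<otimes>\<^bsub>R\<^esub> (y \<otimes>\<^bsub>R\<^esub> z)"
proof -
  have "h (x \<otimes>\<^bsub>R\<^esub> y \<otimes>\<^bsub>R\<^esub> z) = h (x \<otimes>\<^bsub>R\<^esub> (y \<otimes>\<^bsub>R\<^esub> z))" using assms by (simp add: h_mult R_mult S_assoc)
  then show ?thesis using assms by (simp add: h_inj R_mult)
qed

lemma R_distrib:
  assumes "x \<in> carrier R" "y \<in> carrier R" "z \<in> carrier R"
  shows "x \<otimes>\<^bsub>R\<^esub> (y \<oplus>\<^bsub>R\<^esub> z) = x \<otimes>\<^bsub>R\<^esub> y \<oplus>\<^bsub>R\<^esub> x \<otimes>\<^bsub>R\<^esub> z"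
proof -
  have "h (x \<otimes>\<^bsub>R\<^esub> (y \<oplus>\<^bsub>R\<^esub> z)) = h (x \<otimes>\<^bsub>R\<^esub> y \<oplus>\<^bsub>R\<^esub> x \<otimes>\<^bsub>R\<^esub> z)"
    using assms by (simp add: h_mult h_add R_mult R_add S_distrib)
  then show ?thesis using assms by (simp add: h_inj R_mult R_add)
qed

lemma inverse: "ring_transport S R (inv_into (carrier R) h)"
proof -
  let ?g = "inv_into (carrier R) h"
  have g: "?g (h x) = x" if "x \<in> carrier R" for x
    using that bij by (simp add: bij_betw_def)
  have pull: "\<exists>a \<in> carrier R. x = h a" if "x \<in> carrier S" for x using h_surj[OF that] by blast
  show ?thesis
  proof (rule ring_transport.intro, goal_cases)
    case 1 show ?case by (rule S)
  next
    case 2 show ?case by (rule R)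
  next
    case 3 show ?case using bij by (rule bij_betw_inv_into)
  next
    case (4 x y) then show ?case using pull[of x] pull[of y] g R_add by (auto simp flip: h_add)
  next
    case (5 x y) then show ?case using pull[of x] pull[of y] g R_mult by (auto simp flip: h_mult)
  next
    case (6 x y) then show ?case using pull[of x] pull[of y] R_mult by (auto simp flip: h_mult)
  qed (simp_all add: R_assoc R_distrib)
qed

lemma right_ideal_principal:
  assumes e: "e \<in> carrier R" shows "right_ideal R ((\<lambda>x. e \<otimes>\<^bsub>R\<^esub> x) ` carrier R)"
  unfolding right_ideal_def
proof (intro conjI ballI)
  have "group (add_monoid R)" using R by (simp add: abelian_group.a_group)
  then have "group_hom (add_monoid R) (add_monoid R) (\<lambda>x. e \<otimes>\<^bsub>R\<^esub> x)"
    using e by (auto simp: group_hom_def group_hom_axioms_def hom_def R_mult R_distrib)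
  then show "additive_subgroup ((\<lambda>x. e \<otimes>\<^bsub>R\<^esub> x) ` carrier R) R"
    using group_hom.img_is_subgroup by (fastforce simp: additive_subgroup_def)
  show "a \<otimes>\<^bsub>R\<^esub> x \<in> (\<lambda>x. e \<otimes>\<^bsub>R\<^esub> x) ` carrier R"
    if "a \<in> (\<lambda>x. e \<otimes>\<^bsub>R\<^esub> x) ` carrier R" "x \<in> carrier R" for a x
    using that e R_mult by (auto simp: R_assoc)
qed

lemma inverse_image: "I \<subseteq> carrier S \<Longrightarrow> h ` inv_into (carrier R) h ` I = I"
  using bij by (simp add: bij_betw_def image_inv_into_cancel)

lemma right_ideal_subset: "right_ideal T I \<Longrightarrow> I \<subseteq> carrier T"
  by (auto simp: right_ideal_def additive_subgroup_def subgroup_def)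

lemma right_ideal_image:
  assumes "right_ideal R I" shows "right_ideal S (h ` I)"
  unfolding right_ideal_def
proof (intro conjI ballI)
  show "additive_subgroup (h ` I) S"
    using group_hom.subgroup_img_is_subgroup[OF group_hom, of I] assms
    by (simp add: right_ideal_def additive_subgroup_def)
  fix a x assume "a \<in> h ` I" "x \<in> carrier S"
  then obtain b y where "b \<in> I" "y \<in> carrier R" "a = h b" "x = h y" using h_surj by blast
  moreover from this have "b \<in> carrier R" using right_ideal_subset[OF assms] by auto
  ultimately show "a \<otimes>\<^bsub>S\<^esub> x \<in> h ` I" using assms by (auto simp: right_ideal_def simp flip: h_mult)
qed

lemma two_sided_ideal_image:
  assumes "two_sided_ideal R I" shows "two_sided_ideal S (h ` I)"
  unfolding two_sided_ideal_def
proof (intro conjI ballI)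
  have I: "right_ideal R I" using assms by (simp add: two_sided_ideal_def)
  then show "right_ideal S (h ` I)" by (rule right_ideal_image)
  fix a x assume "a \<in> h ` I" "x \<in> carrier S"
  then obtain b y where "b \<in> I" "y \<in> carrier R" "a = h b" "x = h y" using h_surj by blast
  moreover from this have "b \<in> carrier R" using right_ideal_subset[OF I] by auto
  ultimately show "x \<otimes>\<^bsub>S\<^esub> a \<in> h ` I" using assms by (auto simp: two_sided_ideal_def simp flip: h_mult)
qed

lemma set_add_image:
  assumes "A \<subseteq> carrier R" "B \<subseteq> carrier R" shows "h ` (A <+>\<^bsub>R\<^esub> B) = h ` A <+>\<^bsub>S\<^esub> h ` B"
proof -
  have "h (a \<oplus>\<^bsub>R\<^esub> b) = h a \<oplus>\<^bsub>S\<^esub> h b" if "a \<in> A" "b \<in> B" for a b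
    using that assms by (auto intro: h_add)
  then show ?thesis unfolding set_add_def set_mult_def by (auto simp: image_iff) metis+
qed

lemma direct_summand_image:
  assumes "direct_summand R M P" shows "direct_summand S (h ` M) (h ` P)"
proof -
  obtain N where M: "right_ideal R M" and N: "right_ideal R N" "M <+>\<^bsub>R\<^esub> N = P" "M \<inter> N = {\<zero>\<^bsub>R\<^esub>}"
    using assms by (auto simp: direct_summand_def)
  have sub: "M \<subseteq> carrier R" "N \<subseteq> carrier R" using M N right_ideal_subset by auto
  have "h ` M <+>\<^bsub>S\<^esub> h ` N = h ` P" using set_add_image[OF sub] N by simp
  moreover have "h ` M \<inter> h ` N = h ` (M \<inter> N)"
    using bij inj_on_image_Int[OF _ sub, of h] by (simp add: bij_betw_def)
  moreover have "h ` {\<zero>\<^bsub>R\<^esub>} = {\<zero>\<^bsub>S\<^esub>}" by (simp add: h_zero)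
  ultimately have "h ` M \<inter> h ` N = {\<zero>\<^bsub>S\<^esub>}" "h ` M <+>\<^bsub>S\<^esub> h ` N = h ` P" using N(3) by metis+
  then show ?thesis
    unfolding direct_summand_def using right_ideal_image[OF M] right_ideal_image[OF N(1)] by blast
qed

lemma right_iso_image:
  assumes iso: "right_iso R M N" and sub: "right_ideal R M" "right_ideal R N"
  shows "right_iso S (h ` M) (h ` N)"
proof -
  obtain \<phi> where bij\<phi>: "bij_betw \<phi> M N"
    and \<phi>: "\<And>x y. x \<in> M \<Longrightarrow> y \<in> M \<Longrightarrow> \<phi> (x \<oplus>\<^bsub>R\<^esub> y) = \<phi> x \<oplus>\<^bsub>R\<^esub> \<phi> y"
      "\<And>x r. x \<in> M \<Longrightarrow> r \<in> carrier R \<Longrightarrow> \<phi> (x \<otimes>\<^bsub>R\<^esub> r) = \<phi> x \<otimes>\<^bsub>R\<^esub> r"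
    using iso unfolding right_iso_def by metis
  have MN: "M \<subseteq> carrier R" "N \<subseteq> carrier R" using sub right_ideal_subset by auto
  have inj: "inj_on h M" "inj_on h N" using bij MN by (auto simp: bij_betw_def intro: inj_on_subset)
  define \<psi> where "\<psi> = h \<circ> \<phi> \<circ> inv_into M h"
  have \<psi>: "\<psi> (h x) = h (\<phi> x)" if "x \<in> M" for x using that inj by (simp add: \<psi>_def)
  have \<phi>M: "\<phi> x \<in> carrier R" if "x \<in> M" for x using bij\<phi> MN that by (auto simp: bij_betw_def)
  have M_closed: "x \<oplus>\<^bsub>R\<^esub> y \<in> M" "x \<otimes>\<^bsub>R\<^esub> r \<in> M" if "x \<in> M" "y \<in> M" "r \<in> carrier R" for x y r
    using sub(1) that by (auto simp: right_ideal_def additive_subgroup_def subgroup_def)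
  have "bij_betw \<psi> (h ` M) (h ` N)"
    unfolding \<psi>_def
    by (intro bij_betw_trans[OF bij_betw_inv_into[OF inj_on_imp_bij_betw[OF inj(1)]]]
        bij_betw_trans[OF bij\<phi> inj_on_imp_bij_betw[OF inj(2)], unfolded comp_def] | simp add: comp_assoc comp_def)+
  moreover have "\<psi> (x \<oplus>\<^bsub>S\<^esub> y) = \<psi> x \<oplus>\<^bsub>S\<^esub> \<psi> y" if xy: "x \<in> h ` M" "y \<in> h ` M" for x y
  proof -
    from xy obtain a b where ab: "a \<in> M" "b \<in> M" "x = h a" "y = h b" by blast
    then have "x \<oplus>\<^bsub>S\<^esub> y = h (a \<oplus>\<^bsub>R\<^esub> b)" using MN by (simp add: h_add subsetD)
    then show ?thesis using ab M_closed(1)[OF ab(1,2) R_zero] \<phi>M by (simp add: \<psi> \<phi> h_add)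
  qed
  moreover have "\<psi> (x \<otimes>\<^bsub>S\<^esub> r) = \<psi> x \<otimes>\<^bsub>S\<^esub> r" if xr: "x \<in> h ` M" "r \<in> carrier S" for x r
  proof -
    from xr obtain a b where ab: "a \<in> M" "b \<in> carrier R" "x = h a" "r = h b" using h_surj by blast
    then have "x \<otimes>\<^bsub>S\<^esub> r = h (a \<otimes>\<^bsub>R\<^esub> b)" using MN by (simp add: h_mult subsetD)
    then show ?thesis using ab M_closed(2)[OF ab(1,1,2)] \<phi>M by (simp add: \<psi> \<phi> h_mult)
  qed
  ultimately show ?thesis unfolding right_iso_def by blast
qed

lemma infinite_idempotent_image:
  assumes "infinite_idempotent R e" shows "infinite_idempotent S (h e)"
proof -
  let ?eR = "(\<lambda>x. e \<otimes>\<^bsub>R\<^esub> x) ` carrier R"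
  obtain M where e: "e \<in> carrier R" "e \<otimes>\<^bsub>R\<^esub> e = e" and M: "direct_summand R M ?eR" "M \<noteq> ?eR" "right_iso R ?eR M"
    using assms(1) by (auto simp: infinite_idempotent_def idempotent_def Let_def)
  have eR: "right_ideal R ?eR" using right_ideal_principal[OF e(1)] .
  have eq: "h ` ?eR = (\<lambda>x. h e \<otimes>\<^bsub>S\<^esub> x) ` carrier S"
  proof -
    have "h ` ?eR = (\<lambda>x. h e \<otimes>\<^bsub>S\<^esub> x) ` h ` carrier R"
      using e by (auto simp: image_image h_mult intro!: image_cong)
    then show ?thesis using bij by (simp add: bij_betw_def)
  qed
  have "h ` M \<noteq> h ` ?eR"
    using M(2) right_ideal_subset[OF eR] right_ideal_subset[of R M] M(1) bij inj_on_image_eq_iff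
    unfolding bij_betw_def direct_summand_def by metis
  moreover have "direct_summand S (h ` M) (h ` ?eR)" using M direct_summand_image by blast
  moreover have "right_iso S (h ` ?eR) (h ` M)"
    using M eR by (intro right_iso_image) (auto simp: direct_summand_def)
  moreover have "idempotent S (h e)" using e by (simp add: idempotent_def flip: h_mult)
  ultimately show ?thesis unfolding infinite_idempotent_def Let_def eq[symmetric] by blast
qed

lemma purely_infinite_simple_image:
  assumes PIS: "purely_infinite_simple R" shows "purely_infinite_simple S"
proof -
  interpret inv: ring_transport S R "inv_into (carrier R) h" by (rule inverse)
  let ?g = "inv_into (carrier R) h"
  have "simple_ring S"
    unfolding simple_ring_def
  proof (intro conjI allI impI)
    obtain a b where ab: "a \<in> carrier R" "b \<in> carrier R" "a \<otimes>\<^bsub>R\<^esub> b \<noteq> \<zero>\<^bsub>R\<^esub>"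
      using PIS by (auto simp: purely_infinite_simple_def simple_ring_def)
    then have "h a \<otimes>\<^bsub>S\<^esub> h b \<noteq> \<zero>\<^bsub>S\<^esub>" using h_inj[OF R_mult R_zero] by (simp flip: h_mult h_zero)
    then show "\<exists>a \<in> carrier S. \<exists>b \<in> carrier S. a \<otimes>\<^bsub>S\<^esub> b \<noteq> \<zero>\<^bsub>S\<^esub>" using ab h_carrier by blast
    fix J assume J: "two_sided_ideal S J"
    then have sub: "J \<subseteq> carrier S" using right_ideal_subset by (auto simp: two_sided_ideal_def)
    have "?g ` J = {\<zero>\<^bsub>R\<^esub>} \<or> ?g ` J = carrier R"
      using inv.two_sided_ideal_image[OF J] PIS by (auto simp: purely_infinite_simple_def simple_ring_def)
    then have "h ` ?g ` J = h ` {\<zero>\<^bsub>R\<^esub>} \<or> h ` ?g ` J = h ` carrier R" by metis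
    then have "h ` ?g ` J = {\<zero>\<^bsub>S\<^esub>} \<or> h ` ?g ` J = carrier S"
      using bij_betw_imp_surj_on[OF bij] by (simp only: image_insert image_empty h_zero)
    then show "J = {\<zero>\<^bsub>S\<^esub>} \<or> J = carrier S" by (simp only: inverse_image[OF sub])
  qed
  moreover have "purely_infinite S"
    unfolding purely_infinite_def
  proof (intro allI impI)
    fix J assume J: "right_ideal S J" "J \<noteq> {\<zero>\<^bsub>S\<^esub>}"
    have img: "h ` ?g ` J = J" using inverse_image right_ideal_subset[OF J(1)] by blast
    then have "?g ` J \<noteq> {\<zero>\<^bsub>R\<^esub>}" using J(2) h_zero by force
    then obtain e where "e \<in> ?g ` J" "infinite_idempotent R e"
      using inv.right_ideal_image[OF J(1)] PIS
      unfolding purely_infinite_simple_def purely_infinite_def by blast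
    then show "\<exists>e \<in> J. infinite_idempotent S e" using infinite_idempotent_image img by blast
  qed
  ultimately show ?thesis by (simp add: purely_infinite_simple_def)
qed

lemma purely_infinite_simple_iff: "purely_infinite_simple R \<longleftrightarrow> purely_infinite_simple S"
  using purely_infinite_simple_image ring_transport.purely_infinite_simple_image[OF inverse] by blast

end

section \<open>Realization of the Leavitt path algebra\<close>

lemma generated_ideal_is_ideal:
  assumes "S \<subseteq> carrier (free_algebra K X)"
  shows "algebra_ideal (free_algebra K X) (generated_ideal (free_algebra K X) S)"
proof -
  let ?F = "free_algebra K X" and ?I = "generated_ideal (free_algebra K X) S"
  have "algebra_ideal ?F (carrier ?F)"
    unfolding algebra_ideal_free_iff by (intro conjI ballI allI subset_refl free_algebra_closed)
  then have sub: "?I \<subseteq> carrier ?F" using assms unfolding generated_ideal_def by blast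
  have props: "0 \<in> J" "x \<in> J \<Longrightarrow> y \<in> J \<Longrightarrow> x + y \<in> J" "x \<in> J \<Longrightarrow> - x \<in> J"
    "a \<in> J \<Longrightarrow> z \<in> carrier ?F \<Longrightarrow> z * a \<in> J" "a \<in> J \<Longrightarrow> z \<in> carrier ?F \<Longrightarrow> a * z \<in> J"
    "a \<in> J \<Longrightarrow> Poly_Mapping.single 0 c * a \<in> J"
    if "algebra_ideal ?F J" for J x y a z c
    using that unfolding algebra_ideal_free_iff by blast+
  show ?thesis
    unfolding algebra_ideal_free_iff
  proof (intro conjI ballI allI)
    show "?I \<subseteq> carrier ?F" by (rule sub)
  qed (use props in \<open>unfold generated_ideal_def, blast+\<close>)
qed

lemma generated_ideal_superset: "S \<subseteq> generated_ideal A S"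
  by (auto simp: generated_ideal_def)

lemma generated_ideal_least: "algebra_ideal A J \<Longrightarrow> S \<subseteq> J \<Longrightarrow> generated_ideal A S \<subseteq> J"
  by (auto simp: generated_ideal_def)

context
  fixes K :: "'k::field itself" and X :: "'g set" and I :: "('g free_monoid \<Rightarrow>\<^sub>0 'k) set"
  assumes I: "algebra_ideal (free_algebra K X) I"
begin

abbreviation (input) FA where "FA \<equiv> carrier (free_algebra K X)"

lemma algebra_ideal_closed: "I \<subseteq> FA" "0 \<in> I" "x \<in> I \<Longrightarrow> y \<in> I \<Longrightarrow> x + y \<in> I" "x \<in> I \<Longrightarrow> - x \<in> I"
    "a \<in> I \<Longrightarrow> z \<in> FA \<Longrightarrow> z * a \<in> I" "a \<in> I \<Longrightarrow> z \<in> FA \<Longrightarrow> a * z \<in> I"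
    "a \<in> I \<Longrightarrow> Poly_Mapping.single 0 c * a \<in> I"
  using I unfolding algebra_ideal_free_iff by blast+

lemma algebra_ideal_diff: "x \<in> I \<Longrightarrow> y \<in> I \<Longrightarrow> x - y \<in> I"
  using algebra_ideal_closed(3)[of x "- y"] algebra_ideal_closed(4) by simp

lemma algebra_ideal_subspace_ring: "subspace_ring I"
  unfolding subspace_ring_def
proof (intro conjI ballI allI)
  show "x * y \<in> I" if "x \<in> I" "y \<in> I" for x y using algebra_ideal_closed(5)[OF that(2)] algebra_ideal_closed(1) that(1) by blast
qed (simp_all only: algebra_ideal_closed(2,3,4,7))

lemma free_algebra_idealizer: "FA \<subseteq> idealizer I"
proof
  fix x assume "x \<in> FA"
  then show "x \<in> idealizer I" unfolding idealizer_def using algebra_ideal_closed(5,6) by (intro CollectI ballI conjI)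
qed

lemma coset_of_FA:
  assumes "q \<in> FA" "r \<in> FA"
  shows "coset_of I (q + r) = coset_of I q + coset_of I r" "coset_of I (q * r) = coset_of I q * coset_of I r"
    "coset_of I (Poly_Mapping.single 0 c * q) = scalar c * coset_of I q" "coset_of I (- q) = - coset_of I q"
    "coset_of I (q - r) = coset_of I q - coset_of I r"
    "coset_of I q = coset_of I r \<longleftrightarrow> q - r \<in> I" "coset_of I q = 0 \<longleftrightarrow> q \<in> I"
proof -
  have qr: "q \<in> idealizer I" "r \<in> idealizer I" using assms free_algebra_idealizer by blast+
  show "coset_of I (q + r) = coset_of I q + coset_of I r" "coset_of I (q * r) = coset_of I q * coset_of I r"
    "coset_of I (Poly_Mapping.single 0 c * q) = scalar c * coset_of I q" "coset_of I (- q) = - coset_of I q"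
    by (rule coset_of_hom[OF algebra_ideal_subspace_ring qr])+
  show "coset_of I (q - r) = coset_of I q - coset_of I r" by (rule coset_of_diff[OF algebra_ideal_subspace_ring qr])
  show "coset_of I q = coset_of I r \<longleftrightarrow> q - r \<in> I" by (rule coset_of_eq_iff[OF algebra_ideal_subspace_ring qr])
  show "coset_of I q = 0 \<longleftrightarrow> q \<in> I" by (rule coset_of_eq_zero_iff[OF algebra_ideal_subspace_ring qr(1)])
qed

abbreviation (input) cs :: "('g free_monoid \<Rightarrow>\<^sub>0 'k) \<Rightarrow> ('g free_monoid \<Rightarrow>\<^sub>0 'k) set" where
  "cs q \<equiv> I +>\<^bsub>free_algebra K X\<^esub> q"

lemma coset_eq: "cs q = {i + q | i. i \<in> I}"
  by (auto simp: a_r_coset_def')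

lemma coset_self: "q \<in> cs q"
  unfolding coset_eq using algebra_ideal_closed(2) by force

lemma coset_member: "q' \<in> cs q \<longleftrightarrow> q' - q \<in> I"
  unfolding coset_eq by (auto simp: algebra_simps) (metis add_diff_cancel_left' diff_add_cancel add.commute)

lemma coset_eq_iff: "cs q = cs r \<longleftrightarrow> q - r \<in> I"
proof
  assume "cs q = cs r"
  then show "q - r \<in> I" using coset_self[of q] by (simp add: coset_member)
next
  assume qr: "q - r \<in> I"
  have "x - q \<in> I \<longleftrightarrow> x - r \<in> I" for x
    using algebra_ideal_closed(3)[OF _ qr, of "x - q"] algebra_ideal_diff[OF _ qr, of "x - r"] by auto
  then show "cs q = cs r" by (auto simp: coset_member)
qed

lemma quotient_carrier: "carrier (quotient_algebra (free_algebra K X) I) = cs ` FA"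
  by (auto simp: quotient_algebra_def A_RCOSETS_def')

lemma coset_FA: "q \<in> FA \<Longrightarrow> q' \<in> cs q \<Longrightarrow> q' \<in> FA"
  unfolding coset_eq using algebra_ideal_closed(1) free_algebra_closed(2) by blast

lemma quotient_add:
  assumes "a \<in> FA" "b \<in> FA"
  shows "cs a \<oplus>\<^bsub>quotient_algebra (free_algebra K X) I\<^esub> cs b
    = cs (a + b)"
proof -
  have sums: "(\<exists>x y. x - a \<in> I \<and> y - b \<in> I \<and> z = x + y) \<longleftrightarrow> z - (a + b) \<in> I" for z
  proof
    assume "\<exists>x y. x - a \<in> I \<and> y - b \<in> I \<and> z = x + y"
    then obtain x y where "x - a \<in> I" "y - b \<in> I" "z = x + y" by blast
    then show "z - (a + b) \<in> I" using algebra_ideal_closed(3)[of "x - a" "y - b"] by (simp add: algebra_simps)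
  next
    assume "z - (a + b) \<in> I"
    then show "\<exists>x y. x - a \<in> I \<and> y - b \<in> I \<and> z = x + y"
      using algebra_ideal_closed(2) by (intro exI[of _ "z - b"] exI[of _ b]) (simp add: algebra_simps)
  qed
  have members: "z \<in> cs a \<oplus>\<^bsub>quotient_algebra (free_algebra K X) I\<^esub> cs b
      \<longleftrightarrow> (\<exists>x y. x - a \<in> I \<and> y - b \<in> I \<and> z = x + y)" for z
    by (simp add: quotient_algebra_def set_add_def' coset_member Bex_def)
  show ?thesis by (rule Set.set_eqI) (simp only: members sums coset_member)
qed

lemma quotient_mult:
  assumes ab: "a \<in> FA" "b \<in> FA"
  shows "cs a \<otimes>\<^bsub>quotient_algebra (free_algebra K X) I\<^esub> cs b
    = cs (a * b)"
proof -
  have "cs (x * y) = cs (a * b)"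
    if x: "x \<in> cs a" and y: "y \<in> cs b" for x y
  proof -
    have "(x - a) * y + a * (y - b) \<in> I"
      using x y coset_FA[OF ab(2) y] ab by (intro algebra_ideal_closed) (auto simp only: coset_member)
    then show ?thesis unfolding coset_eq_iff by (simp add: algebra_simps)
  qed
  then have "(\<Union>x \<in> cs a. \<Union>y \<in> cs b. cs (x * y))
      = (\<Union>x \<in> cs a. \<Union>y \<in> cs b. cs (a * b))"
    by (intro SUP_cong refl) auto
  also have "\<dots> = cs (a * b)"
    using coset_self[of a] coset_self[of b] by blast
  finally show ?thesis by (simp add: quotient_algebra_def rcoset_mult_def)
qed

definition realize :: "('g free_monoid \<Rightarrow>\<^sub>0 'k) set \<Rightarrow> ('g, 'k) subquotients" where
  "realize Y = coset_of I (SOME q. q \<in> Y)"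

lemma realize_coset:
  assumes "q \<in> FA" shows "realize (cs q) = coset_of I q"
proof -
  have "(SOME q'. q' \<in> cs q) \<in> cs q"
    using coset_self[of q] by (rule someI)
  then show ?thesis unfolding realize_def
    using assms coset_FA by (simp only: coset_of_FA(6) coset_member)
qed

lemma image_subring: "subring_type (coset_of I ` FA)"
proof
  show "0 \<in> coset_of I ` FA" using coset_of_zero[OF algebra_ideal_subspace_ring] free_algebra_closed(1) by (metis imageI)
  fix x assume "x \<in> coset_of I ` FA"
  then obtain a where a: "a \<in> FA" "x = coset_of I a" by blast
  show "- x \<in> coset_of I ` FA" using a free_algebra_closed(3) coset_of_FA(4) by (metis imageI)
  fix y assume "y \<in> coset_of I ` FA"
  then obtain b where b: "b \<in> FA" "y = coset_of I b" by blast
  show "x + y \<in> coset_of I ` FA" using a b free_algebra_closed(2) coset_of_FA(1) by (metis imageI)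
  show "x * y \<in> coset_of I ` FA" using a b free_algebra_closed(5) coset_of_FA(2) by (metis imageI)
qed

text \<open>Sending a coset to the class of any of its elements identifies the quotient algebra with a
subring of the ring type.\<close>

lemma quotient_transport:
  "ring_transport (quotient_algebra (free_algebra K X) I) (ring_on (coset_of I ` FA)) realize"
proof -
  let ?Q = "quotient_algebra (free_algebra K X) I"
  have rep: "\<exists>q \<in> FA. x = cs q" if "x \<in> carrier ?Q" for x using that unfolding quotient_carrier by blast
  have zero: "\<zero>\<^bsub>?Q\<^esub> = cs 0" by (simp add: quotient_algebra_def coset_eq)
  have c_in: "cs q \<in> carrier ?Q" if "q \<in> FA" for q using that unfolding quotient_carrier by blast
  show ?thesis
  proof (rule ring_transport.intro)
    show "abelian_group ?Q"
    proof (rule abelian_groupI)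
      show "\<zero>\<^bsub>?Q\<^esub> \<in> carrier ?Q" unfolding zero using free_algebra_closed(1) by (rule c_in)
      fix x assume "x \<in> carrier ?Q"
      then obtain a where a: "a \<in> FA" "x = cs a" using rep by blast
      show "\<zero>\<^bsub>?Q\<^esub> \<oplus>\<^bsub>?Q\<^esub> x = x" unfolding zero a(2) using a(1) free_algebra_closed(1)[of K X]
        by (simp only: quotient_add add_0)
      have "cs (- a) \<oplus>\<^bsub>?Q\<^esub> x = \<zero>\<^bsub>?Q\<^esub>" unfolding zero a(2) using a(1) free_algebra_closed(3)[OF a(1)]
        by (simp only: quotient_add left_minus)
      then show "\<exists>y \<in> carrier ?Q. y \<oplus>\<^bsub>?Q\<^esub> x = \<zero>\<^bsub>?Q\<^esub>" using c_in[OF free_algebra_closed(3)[OF a(1)]] by blast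
      fix y assume "y \<in> carrier ?Q"
      then obtain b where b: "b \<in> FA" "y = cs b" using rep by blast
      show "x \<oplus>\<^bsub>?Q\<^esub> y \<in> carrier ?Q"
        unfolding a(2) b(2) quotient_add[OF a(1) b(1)] using free_algebra_closed(2)[OF a(1) b(1)] by (rule c_in)
      show "x \<oplus>\<^bsub>?Q\<^esub> y = y \<oplus>\<^bsub>?Q\<^esub> x"
        unfolding a(2) b(2) quotient_add[OF a(1) b(1)] quotient_add[OF b(1) a(1)] by (simp only: add.commute)
      fix z assume "z \<in> carrier ?Q"
      then obtain c where c: "c \<in> FA" "z = cs c" using rep by blast
      show "x \<oplus>\<^bsub>?Q\<^esub> y \<oplus>\<^bsub>?Q\<^esub> z = x \<oplus>\<^bsub>?Q\<^esub> (y \<oplus>\<^bsub>?Q\<^esub> z)"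
        unfolding a(2) b(2) c(2) using a(1) b(1) c(1) free_algebra_closed(2)[OF a(1) b(1)] free_algebra_closed(2)[OF b(1) c(1)]
        by (simp only: quotient_add add.assoc)
    qed
    show "abelian_group (ring_on (coset_of I ` FA))"
      by (rule subring_type.abelian_group_ring_on) (rule image_subring)
    show "bij_betw realize (carrier ?Q) (carrier (ring_on (coset_of I ` FA)))"
    proof (rule bij_betw_imageI)
      show "inj_on realize (carrier ?Q)"
      proof (rule inj_onI)
        fix x y assume "x \<in> carrier ?Q" "y \<in> carrier ?Q" and eq: "realize x = realize y"
        then obtain a b where "a \<in> FA" "b \<in> FA" "x = cs a" "y = cs b" using rep by metis
        then show "x = y" using eq by (simp only: realize_coset coset_of_FA(6) coset_eq_iff)
      qed
      show "realize ` carrier ?Q = carrier (ring_on (coset_of I ` FA))"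
        unfolding quotient_carrier image_image ring_on_simps using realize_coset by (rule image_cong[OF refl])
    qed
    fix x y assume "x \<in> carrier ?Q" "y \<in> carrier ?Q"
    then obtain a b where ab: "a \<in> FA" "b \<in> FA" "x = cs a" "y = cs b" using rep by metis
    show "realize (x \<oplus>\<^bsub>?Q\<^esub> y) = realize x \<oplus>\<^bsub>ring_on (coset_of I ` FA)\<^esub> realize y"
      using ab free_algebra_closed(2)[OF ab(1,2)] by (simp only: quotient_add realize_coset coset_of_FA ring_on_simps)
    show "realize (x \<otimes>\<^bsub>?Q\<^esub> y) = realize x \<otimes>\<^bsub>ring_on (coset_of I ` FA)\<^esub> realize y"
      using ab free_algebra_closed(5)[OF ab(1,2)] by (simp only: quotient_mult realize_coset coset_of_FA ring_on_simps)
    show "x \<otimes>\<^bsub>?Q\<^esub> y \<in> carrier ?Q"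
      unfolding ab(3,4) quotient_mult[OF ab(1,2)] using free_algebra_closed(5)[OF ab(1,2)] by (rule c_in)
  qed (simp_all only: ring_on_simps mult.assoc distrib_left)
qed

end

text \<open>The generators satisfy the relations by construction.  The ideal attached to \<open>H\<close> is the image of the kernel of
the boundary path representation, which contains the ideal of relations; this is why membership of
\<open>p A\<close> can be decided in the free algebra.\<close>

lemma leavitt_relations_hold:
  fixes K :: "'k::field itself"
  assumes "ultragraph G"
  defines "I \<equiv> generated_ideal (free_algebra K (lpa_gens G)) (lpa_rels K G)"
  shows "leavitt_family G (scalar :: 'k \<Rightarrow> _) (\<lambda>A. coset_of I (pp A)) (\<lambda>e. coset_of I (ss e)) (\<lambda>e. coset_of I (ss_star e))"
    and "leavitt_family.lpa G (scalar :: 'k \<Rightarrow> _) (\<lambda>A. coset_of I (pp A)) (\<lambda>e. coset_of I (ss e)) (\<lambda>e. coset_of I (ss_star e))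
      = coset_of I ` carrier (free_algebra K (lpa_gens G))"
proof -
  interpret ultragraph G by fact
  let ?F = "free_algebra K (lpa_gens G)"
  let ?C = "carrier ?F"
  have I: "algebra_ideal ?F I" unfolding I_def by (rule generated_ideal_is_ideal) (rule lpa_rels_carrier)
  have rels: "r \<in> I" if "r \<in> lpa_rels K G" for r
    using that generated_ideal_superset[of "lpa_rels K G" ?F] unfolding I_def by blast
  have zero_if: "coset_of I r = 0" if "r \<in> lpa_rels K G" for r
    using rels[OF that] lpa_rels_carrier that coset_of_FA(7)[OF I, of r] by blast
  have gens [simp]: "A \<in> gen_verts G \<Longrightarrow> pp A \<in> ?C" "e \<in> edges G \<Longrightarrow> ss e \<in> ?C" "e \<in> edges G \<Longrightarrow> ss_star e \<in> ?C" for A e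
    by (rule free_algebra_closed(7), simp add: lpa_gens_def)+
  have vert [simp]: "{src G e} \<in> gen_verts G" "rng G e \<in> gen_verts G" if "e \<in> edges G" for e
    using that src_in_verts by (auto intro: gen_verts.intros)
  have prod [simp]: "q * r \<in> ?C" if "q \<in> ?C" "r \<in> ?C" for q r using that by (rule free_algebra_closed(5))
  have sum: "(\<Sum>i \<in> S. f i) \<in> ?C \<and> coset_of I (\<Sum>i \<in> S. f i) = (\<Sum>i \<in> S. coset_of I (f i))"
    if "\<And>i. i \<in> S \<Longrightarrow> f i \<in> ?C" for S and f :: "'x \<Rightarrow> _"
    using that free_algebra_closed(1)[of K "lpa_gens G"] coset_of_zero[OF algebra_ideal_subspace_ring[OF I]]
    by (induction S rule: infinite_finite_induct)
      (simp_all add: free_algebra_closed(2) coset_of_FA(1)[OF I] del: free_algebra_simps(1))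
  note hom = coset_of_FA[OF I]
  have diff0: "coset_of I q = coset_of I r" if "q - r \<in> lpa_rels K G" "q \<in> ?C" "r \<in> ?C" for q r
    using rels[OF that(1)] hom(6)[OF that(2,3)] by simp
  let ?p = "\<lambda>A. coset_of I (pp A)" and ?s = "\<lambda>e. coset_of I (ss e)" and ?t = "\<lambda>e. coset_of I (ss_star e)"
  show fam: "leavitt_family G (scalar :: 'k \<Rightarrow> _) ?p ?s ?t"
  proof (unfold_locales, goal_cases)
    case (1 c d) show ?case by (rule scalar_hom)
  next
    case (2 c d) show ?case by (rule scalar_hom)
  next
    case 3 show ?case by (rule scalar_hom)
  next
    case (4 x c) show ?case by (rule scalar_central)
  next
    case 5 show ?case by (rule zero_if) (rule lpa_rels.proj_empty)
  next
    case (6 A B)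
    then show ?case using diff0[OF lpa_rels.proj_mult[OF 6]] by (simp add: hom gen_verts.inter del: free_algebra_simps(1))
  next
    case (7 A B)
    have "pp A + pp B - pp (A \<inter> B) \<in> ?C" "pp A + pp B \<in> ?C"
      using 7 by (auto intro!: free_algebra_closed(4) free_algebra_closed(2) simp: gen_verts.inter simp del: free_algebra_simps(1))
    then show ?case using 7 diff0[OF lpa_rels.proj_union[OF 7]]
      by (simp add: hom gen_verts.inter gen_verts.union del: free_algebra_simps(1))
  next
    case (8 e) then show ?case using diff0[OF lpa_rels.src_edge[OF 8]] by (simp add: hom del: free_algebra_simps(1))
  next
    case (9 e) then show ?case using diff0[OF lpa_rels.edge_rng[OF 9]] by (simp add: hom del: free_algebra_simps(1))
  next
    case (10 e) then show ?case using diff0[OF lpa_rels.rng_ghost[OF 10]] by (simp add: hom del: free_algebra_simps(1))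
  next
    case (11 e) then show ?case using diff0[OF lpa_rels.ghost_src[OF 11]] by (simp add: hom del: free_algebra_simps(1))
  next
    case (12 e f)
    have "(if e = f then pp (rng G e) else 0) \<in> ?C"
      using 12 free_algebra_closed(1)[of K "lpa_gens G"] by (simp del: free_algebra_simps(1))
    then show ?case using 12 diff0[OF lpa_rels.ghost_edge[OF 12]] coset_of_zero[OF algebra_ideal_subspace_ring[OF I]]
      by (auto simp add: hom simp del: free_algebra_simps(1))
  next
    case (13 v)
    have out: "ss e * ss_star e \<in> ?C" if "e \<in> out_edges G v" for e using that by (simp add: out_edges_def del: free_algebra_simps(1))
    have v: "{v} \<in> gen_verts G" using 13 by (auto simp: regular_vertex_def intro: gen_verts.intros)
    have "?p {v} = coset_of I (\<Sum>e \<in> out_edges G v. ss e * ss_star e)"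
      by (intro diff0[OF lpa_rels.regular[OF 13]] gens(1)[OF v] sum[THEN conjunct1] out)
    also have "\<dots> = (\<Sum>e \<in> out_edges G v. coset_of I (ss e * ss_star e))"
      by (intro sum[THEN conjunct2] out)
    also have "\<dots> = (\<Sum>e \<in> out_edges G v. ?s e * ?t e)"
      by (intro sum.cong refl hom(2)) (simp_all add: out_edges_def del: free_algebra_simps(1))
    finally show ?case .
  next
    case (14 H)
    then obtain J where J: "algebra_ideal ?F J" "lpa_rels K G \<subseteq> J" "\<And>A. A \<in> gen_verts G \<Longrightarrow> pp A \<in> J \<longleftrightarrow> A \<in> H"
      using quotient_ideal_exists[of H K] by metis
    have IJ: "I \<subseteq> J" unfolding I_def using J(1,2) by (rule generated_ideal_least)
    note Jc = algebra_ideal_closed[OF J(1)]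
    have JC: "q \<in> ?C" if "q \<in> J" for q using that Jc(1) by blast
    let ?J = "coset_of I ` J"
    have "0 \<in> ?J" using Jc(2) coset_of_zero[OF algebra_ideal_subspace_ring[OF I]] by (metis imageI)
    moreover have "x + y \<in> ?J" if xy: "x \<in> ?J" "y \<in> ?J" for x y
    proof -
      from xy obtain q r where qr: "q \<in> J" "r \<in> J" "x = coset_of I q" "y = coset_of I r" by blast
      then have "x + y = coset_of I (q + r)" by (simp only: hom(1)[OF JC JC])
      then show ?thesis using Jc(3)[OF qr(1,2)] by (rule image_eqI)
    qed
    moreover have "scalar c * x \<in> ?J" if x: "x \<in> ?J" for x c
    proof -
      from x obtain q where q: "q \<in> J" "x = coset_of I q" by blast
      then have "scalar c * x = coset_of I (Poly_Mapping.single 0 c * q)" by (simp only: hom(3)[OF JC JC])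
      then show ?thesis using Jc(7)[OF q(1)] by (rule image_eqI)
    qed
    moreover have "g * x \<in> ?J" "x * g \<in> ?J"
      if "x \<in> ?J" "g \<in> ?p ` gen_verts G \<union> ?s ` edges G \<union> ?t ` edges G" for x g
    proof -
      from that(2) obtain r where r: "r \<in> ?C" "g = coset_of I r" using gens by blast
      from that(1) obtain q where q: "q \<in> J" "x = coset_of I q" by blast
      have "g * x = coset_of I (r * q)" "x * g = coset_of I (q * r)"
        unfolding r(2) q(2) by (simp_all only: hom(2)[OF r(1) JC[OF q(1)]] hom(2)[OF JC[OF q(1)] r(1)])
      then show "g * x \<in> ?J" "x * g \<in> ?J" using Jc(5,6)[OF q(1) r(1)] by (simp_all only: imageI)
    qed
    moreover have "?p A \<in> ?J \<longleftrightarrow> A \<in> H" if A: "A \<in> gen_verts G" for A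
    proof
      assume "?p A \<in> ?J"
      then obtain q where q: "q \<in> J" "?p A = coset_of I q" by blast
      then have "pp A - q \<in> J" using hom(6)[OF gens(1)[OF A] JC[OF q(1)]] IJ by blast
      then have "pp A \<in> J" using Jc(3)[of "pp A - q" q] q(1) by simp
      then show "A \<in> H" using J(3)[OF A] by simp
    next
      assume "A \<in> H"
      then show "?p A \<in> ?J" using J(3)[OF A] by (simp only: imageI)
    qed
    ultimately show ?case by (intro exI[of _ ?J] conjI ballI allI) assumption+
  qed
  interpret fam: leavitt_family G "scalar :: 'k \<Rightarrow> _" ?p ?s ?t by (rule fam)
  show "fam.lpa = coset_of I ` ?C"
  proof
    have word: "coset_of I (Poly_Mapping.single (Word w) (1 :: 'k)) \<in> fam.lpa \<and> Poly_Mapping.single (Word w) (1 :: 'k) \<in> ?C"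
      if "w \<noteq> []" "set w \<subseteq> lpa_gens G" for w
      using that
    proof (induction w rule: list_nonempty_induct)
      case (single g)
      then have g: "g \<in> lpa_gens G" by simp
      then have "coset_of I (indet g :: _ \<Rightarrow>\<^sub>0 'k) \<in> fam.lpa"
        using fam.p_in_lpa fam.s_in_lpa fam.t_in_lpa by (auto simp: lpa_gens_def)
      moreover have "(indet g :: _ \<Rightarrow>\<^sub>0 'k) \<in> ?C" using g by (rule free_algebra_closed(7))
      ultimately show ?case unfolding indet_def by blast
    next
      case (cons g w)
      then have g: "g \<in> lpa_gens G" by simp
      then have "coset_of I (indet g :: _ \<Rightarrow>\<^sub>0 'k) \<in> fam.lpa"
        using fam.p_in_lpa fam.s_in_lpa fam.t_in_lpa by (auto simp: lpa_gens_def)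
      moreover have gC: "(indet g :: _ \<Rightarrow>\<^sub>0 'k) \<in> ?C" using g by (rule free_algebra_closed(7))
      moreover have "Poly_Mapping.single (Word (g # w)) (1 :: 'k) = indet g * Poly_Mapping.single (Word w) 1"
        by (simp add: indet_def mult_single plus_free_monoid_def)
      moreover have "coset_of I (Poly_Mapping.single (Word w) (1 :: 'k)) \<in> fam.lpa"
        "Poly_Mapping.single (Word w) (1 :: 'k) \<in> ?C" using cons by auto
      ultimately show ?case using hom(2) prod fam.lpa_mult by metis
    qed
    show "coset_of I ` ?C \<subseteq> fam.lpa"
    proof
      fix x assume "x \<in> coset_of I ` ?C"
      then obtain q where q: "q \<in> ?C" "x = coset_of I q" by blast
      have monomial: "Poly_Mapping.single w (Poly_Mapping.lookup q w) \<in> ?C \<and>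
          coset_of I (Poly_Mapping.single w (Poly_Mapping.lookup q w)) \<in> fam.lpa"
        if "w \<in> Poly_Mapping.keys q" for w
      proof -
        have "letters w \<noteq> []" "set (letters w) \<subseteq> lpa_gens G" using q(1) that by auto
        from word[OF this] have "coset_of I (Poly_Mapping.single w (1 :: 'k)) \<in> fam.lpa" "Poly_Mapping.single w (1 :: 'k) \<in> ?C"
          by simp_all
        moreover have "Poly_Mapping.single w (Poly_Mapping.lookup q w)
            = Poly_Mapping.single 0 (Poly_Mapping.lookup q w) * Poly_Mapping.single w 1"
          by (simp add: mult_single)
        ultimately show ?thesis using hom(3) free_algebra_closed(6) fam.lpa_closed(5) by metis
      qed
      have "coset_of I q = coset_of I (\<Sum>w \<in> Poly_Mapping.keys q. Poly_Mapping.single w (Poly_Mapping.lookup q w))"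
        by (rule arg_cong[OF poly_mapping_sum_singles])
      also have "\<dots> = (\<Sum>w \<in> Poly_Mapping.keys q. coset_of I (Poly_Mapping.single w (Poly_Mapping.lookup q w)))"
        by (rule sum[THEN conjunct2]) (rule monomial[THEN conjunct1])
      finally show "x \<in> fam.lpa"
        unfolding q(2) by (simp only:) (rule fam.lpa_closed(6), rule monomial[THEN conjunct2])
    qed
    interpret im: subring_type "coset_of I ` ?C" by (rule image_subring[OF I])
    have sc: "scalar c * x \<in> coset_of I ` ?C" if "x \<in> coset_of I ` ?C" for c x
    proof -
      from that obtain q where q: "q \<in> ?C" "x = coset_of I q" by blast
      then have "scalar c * x = coset_of I (Poly_Mapping.single 0 c * q)" by (simp only: hom(3)[OF q(1) q(1)])
      then show ?thesis using free_algebra_closed(6)[OF q(1)] by (rule image_eqI)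
    qed
    have sw: "fam.sw \<alpha> * x \<in> coset_of I ` ?C" if "set \<alpha> \<subseteq> edges G" "x \<in> coset_of I ` ?C" for \<alpha> x
      using that
    proof (induction \<alpha>)
      case (Cons e \<alpha>)
      then have e: "e \<in> edges G" and "fam.sw \<alpha> * x \<in> coset_of I ` ?C" by (simp_all only: list.set insert_subset simp_thms)
      from this(2) have "?s e * (fam.sw \<alpha> * x) \<in> coset_of I ` ?C" by (rule im.mult[OF imageI[OF gens(2)[OF e]]])
      then show ?case by (simp only: fam.sw_simps mult.assoc)
    qed simp
    have tw: "x * fam.tw \<alpha> \<in> coset_of I ` ?C" if "set \<alpha> \<subseteq> edges G" "x \<in> coset_of I ` ?C" for \<alpha> x
      using that
    proof (induction \<alpha>)
      case (Cons e \<alpha>)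
      then have e: "e \<in> edges G" and "x * fam.tw \<alpha> \<in> coset_of I ` ?C" by (simp_all only: list.set insert_subset simp_thms)
      from this(2) have "(x * fam.tw \<alpha>) * ?t e \<in> coset_of I ` ?C" by (rule im.mult[OF _ imageI[OF gens(3)[OF e]]])
      then show ?case by (simp only: fam.tw_simps mult.assoc)
    qed simp
    have mon: "m \<in> coset_of I ` ?C" if m: "m \<in> fam.mons (edges G) (gen_verts G)" for m
    proof -
      from m obtain \<alpha> A \<beta> where "m = fam.sw \<alpha> * ?p A * fam.tw \<beta>" "set \<alpha> \<subseteq> edges G" "set \<beta> \<subseteq> edges G" "A \<in> gen_verts G"
        by (auto simp: fam.mons_def fam.mon_def edge_path_def)
      then show ?thesis using sw tw gens(1) by (metis imageI)
    qed
    show "fam.lpa \<subseteq> coset_of I ` ?C"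
    proof
      fix x assume "x \<in> fam.lpa"
      then show "x \<in> coset_of I ` ?C"
        unfolding fam.lpa_def
      proof (induction rule: fam.vs.span_induct_alt)
        case base show ?case by (rule im.zero)
      next
        case (step c m y) show ?case by (rule im.add[OF sc[OF mon[OF step(1)]] step(2)])
      qed
    qed
  qed
qed

text \<open>The characterization with a single cycle holds for the realized family.  Under the first condition the existence of
one cycle and the connection of every vertex to a cycle are equivalent; passing from the latter to the former
uses that there is a vertex.\<close>

theorem theorem3p4:
  fixes G :: "('v, 'e) ugraph" and K :: "'k::field itself"
  assumes "ultragraph G" and "verts G \<noteq> {}"
  shows "(purely_infinite_simple (leavitt_path_algebra K G) \<longleftrightarrow>
           (\<forall>H. hereditary G H \<and> saturated G H \<longrightarrow> H = {} \<or> H = {{}} \<or> H = gen_verts G) \<and>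
           (\<forall>\<alpha>. is_cycle G \<alpha> \<longrightarrow> has_exit G \<alpha>) \<and>
           (\<forall>w \<in> verts G. \<exists>\<alpha>. is_cycle G \<alpha> \<and> connects_to_cycle G w \<alpha>)) \<and>
         (purely_infinite_simple (leavitt_path_algebra K G) \<longleftrightarrow>
           (\<forall>H. hereditary G H \<and> saturated G H \<longrightarrow> H = {} \<or> H = {{}} \<or> H = gen_verts G) \<and>
           (\<forall>\<alpha>. is_cycle G \<alpha> \<longrightarrow> has_exit G \<alpha>) \<and>
           (\<exists>\<alpha>. is_cycle G \<alpha>))"
proof -
  interpret ultragraph G by fact
  define I where "I = generated_ideal (free_algebra K (lpa_gens G)) (lpa_rels K G)"
  let ?p = "\<lambda>A. coset_of I (pp A)" and ?s = "\<lambda>e. coset_of I (ss e)" and ?t = "\<lambda>e. coset_of I (ss_star e)"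
  interpret fam: leavitt_family G "scalar :: 'k \<Rightarrow> _" ?p ?s ?t
    unfolding I_def using assms(1) by (rule leavitt_relations_hold)
  have I: "algebra_ideal (free_algebra K (lpa_gens G)) I"
    unfolding I_def by (rule generated_ideal_is_ideal) (rule lpa_rels_carrier)
  have lpa: "fam.lpa = coset_of I ` carrier (free_algebra K (lpa_gens G))"
    unfolding I_def using assms(1) by (rule leavitt_relations_hold)
  have "purely_infinite_simple (leavitt_path_algebra K G) \<longleftrightarrow> purely_infinite_simple (ring_on fam.lpa)"
    using ring_transport.purely_infinite_simple_iff[OF quotient_transport[OF I]]
    by (simp only: leavitt_path_algebra_def Let_def I_def[symmetric] lpa)
  note iff = this[unfolded fam.purely_infinite_simple_iff[OF assms(2)]]
  have "(\<forall>w \<in> verts G. \<exists>\<alpha>. is_cycle G \<alpha> \<and> connects_to_cycle G w \<alpha>) \<longleftrightarrow> (\<exists>\<alpha>. is_cycle G \<alpha>)"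
    if "\<forall>H. hereditary G H \<and> saturated G H \<longrightarrow> H = {} \<or> H = {{}} \<or> H = gen_verts G"
    using all_connect_to_cycle that assms(2) by blast
  then show ?thesis using iff by blast
qed

end
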